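(* Let $X$ be a uniformly locally finite metric space with property A, and let $h$ and $k$ be self-adjoint coarse operators on $\ell_2(X)$ inducing flows $\sigma_h$ and $\sigma_k$ on $\mathrm{C}^*_u(X)$ (i.e. $e^{ith}\mathrm{C}^*_u(X)e^{-ith}=\mathrm{C}^*_u(X)=e^{itk}\mathrm{C}^*_u(X)e^{-itk}$ for all $t$, and $\sigma_{h,t}(a)=e^{ith}ae^{-ith}$, $\sigma_{k,t}(a)=e^{itk}ae^{-itk}$ are strongly continuous on $\mathrm{C}^*_u(X)$). If $h-k$ is bounded on $c_{00}(X)$, then $\sigma_h$ and $\sigma_k$ are cocycle perturbations of each other.
   Context: Uniformly locally finite: $\sup_x|B_r(x)|<\infty$ for all $r>0$. $c_{00}(X)$ is the space of finitely supported vectors of $\ell_2(X)$, with canonical basis $(\delta_x)$. A partial translation is a bijection $f\colon\mathrm{dom}(f)\subseteq X\to\mathrm{ran}(f)\subseteq X$ with $\sup_{x\in\mathrm{dom}(f)}d(x,f(x))<\infty$; $v_f\delta_x=\delta_{f(x)}$ for $x\in\mathrm{dom}(f)$ and $0$ otherwise; $\mathrm{C}^*_u(X)$ is the $\mathrm{C}^*$-algebra generated by all $v_f$. Property A: for all $\varepsilon,r>0$ there is $x\mapsto\xi_x$ into the unit sphere of $\ell_2(X)$ with $\|\xi_x-\xi_y\|\le\varepsilon$ when $d(x,y)\le r$ and $\sup\{d(x,y):\langle\xi_x,\delta_y\rangle\ne0\}<\infty$. A closed operator $h$ is coarse if $v_f(\mathrm{dom}(h))\subseteq\mathrm{dom}(h)$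 and $hv_f-v_fh$ is bounded on $\mathrm{dom}(h)$ for every partial translation $f$. For a pre-flow $\sigma\colon\mathbb{R}\to\mathrm{Aut}(A)$ on a unital $\mathrm{C}^*$-algebra $A$, a cocycle is a norm continuous family of unitaries $(u_t)$ in $A$ with $u_{t+s}=u_t\sigma_t(u_s)$, and $\rho_t=u_t\sigma_t(\cdot)u_t^*$ is then a cocycle perturbation of $\sigma$. *)

theory Defs
  imports "HOL-Analysis.Analysis"
begin

type_synonym 'a vec = "'a \<Rightarrow> complex"
type_synonym 'a op = "'a vec \<Rightarrow> 'a vec"

definition l2 :: "'a vec set" where
  "l2 = {\<xi>. (\<lambda>x. (cmod (\<xi> x))^2) summable_on UNIV}"

definition l2norm :: "'a vec \<Rightarrow> real" where
  "l2norm \<xi> = sqrt (\<Sum>\<^sub>\<infinity>x. (cmod (\<xi> x))^2)"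

definition l2inner :: "'a vec \<Rightarrow> 'a vec \<Rightarrow> complex" where
  "l2inner \<xi> \<eta> = (\<Sum>\<^sub>\<infinity>x. cnj (\<xi> x) * \<eta> x)"

definition c00 :: "'a vec set" where
  "c00 = {\<xi>. finite {x. \<xi> x \<noteq> 0}}"

definition eq_on_l2 :: "'a op \<Rightarrow> 'a op \<Rightarrow> bool" where
  "eq_on_l2 S T \<longleftrightarrow> (\<forall>\<xi>\<in>l2. S \<xi> = T \<xi>)"

definition linear_on_l2 :: "'a op \<Rightarrow> bool" where
  "linear_on_l2 T \<longleftrightarrow> (\<forall>\<xi>\<in>l2. \<forall>\<eta>\<in>l2. \<forall>c::complex.
      T (\<lambda>x. \<xi> x + c * \<eta> x) = (\<lambda>x. T \<xi> x + c * T \<eta> x))"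

definition bounded_op :: "'a op \<Rightarrow> bool" where
  "bounded_op T \<longleftrightarrow> (\<forall>\<xi>\<in>l2. T \<xi> \<in> l2) \<and> linear_on_l2 T \<and>
     (\<exists>C. \<forall>\<xi>\<in>l2. l2norm (T \<xi>) \<le> C * l2norm \<xi>)"

definition opnorm :: "'a op \<Rightarrow> real" where
  "opnorm T = (SUP \<xi>\<in>{\<xi>\<in>l2. l2norm \<xi> \<le> 1}. l2norm (T \<xi>))"

definition is_adjoint :: "'a op \<Rightarrow> 'a op \<Rightarrow> bool" where
  "is_adjoint T S \<longleftrightarrow> (\<forall>\<xi>\<in>l2. S \<xi> \<in> l2) \<and>
     (\<forall>\<xi>\<in>l2. \<forall>\<eta>\<in>l2. l2inner (T \<xi>) \<eta> = l2inner \<xi> (S \<eta>))"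

definition adj :: "'a op \<Rightarrow> 'a op" where
  "adj T = (SOME S. is_adjoint T S)"

definition unitary_op :: "'a op \<Rightarrow> bool" where
  "unitary_op u \<longleftrightarrow> bounded_op u \<and> (\<exists>S. is_adjoint u S) \<and>
     eq_on_l2 (adj u \<circ> u) id \<and> eq_on_l2 (u \<circ> adj u) id"

definition uniformly_locally_finite :: "'a::metric_space itself \<Rightarrow> bool" where
  "uniformly_locally_finite _ \<longleftrightarrow>
     (\<forall>r>0. \<exists>N::nat. \<forall>x::'a. finite (cball x r) \<and> card (cball x r) \<le> N)"

definition property_A :: "'a::metric_space itself \<Rightarrow> bool" where
  "property_A _ \<longleftrightarrow> (\<forall>\<epsilon>>0. \<forall>r>0. \<exists>\<xi> :: 'a \<Rightarrow> 'a vec.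
      (\<forall>x. \<xi> x \<in> l2 \<and> l2norm (\<xi> x) = 1) \<and>
      (\<forall>x y. dist x y \<le> r \<longrightarrow> l2norm (\<lambda>z. \<xi> x z - \<xi> y z) \<le> \<epsilon>) \<and>
      (\<exists>S. \<forall>x y. cnj (\<xi> x y) \<noteq> 0 \<longrightarrow> dist x y \<le> S))"
  \<comment> \<open>the inner product of xi_x with delta_y is cnj (xi x y)\<close>

definition partial_translation :: "'a::metric_space set \<Rightarrow> ('a \<Rightarrow> 'a) \<Rightarrow> bool" where
  "partial_translation A f \<longleftrightarrow> inj_on f A \<and> (\<exists>r. \<forall>x\<in>A. dist x (f x) \<le> r)"

text \<open>v_f: sends delta_x to delta_(f x) for x in dom f, and delta_x to 0 otherwise
  (its bounded extension to ell_2).\<close>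
definition vop :: "'a set \<Rightarrow> ('a \<Rightarrow> 'a) \<Rightarrow> 'a op" where
  "vop A f \<xi> = (\<lambda>y. if y \<in> f ` A then \<xi> (the_inv_into A f y) else 0)"

inductive_set roe_star_alg :: "('a::metric_space) op set" where
  gen: "partial_translation A f \<Longrightarrow> vop A f \<in> roe_star_alg"
| add: "S \<in> roe_star_alg \<Longrightarrow> T \<in> roe_star_alg \<Longrightarrow> (\<lambda>\<xi> x. S \<xi> x + T \<xi> x) \<in> roe_star_alg"
| smult: "T \<in> roe_star_alg \<Longrightarrow> (\<lambda>\<xi> x. c * T \<xi> x) \<in> roe_star_alg"
| comp: "S \<in> roe_star_alg \<Longrightarrow> T \<in> roe_star_alg \<Longrightarrow> S \<circ> T \<in> roe_star_alg"
| star: "T \<in> roe_star_alg \<Longrightarrow> is_adjoint T S \<Longrightarrow> S \<in> roe_star_alg"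

definition uniform_roe :: "('a::metric_space) op set" where
  "uniform_roe = {T. bounded_op T \<and>
     (\<forall>\<epsilon>>0. \<exists>S\<in>roe_star_alg. opnorm (\<lambda>\<xi> x. T \<xi> x - S \<xi> x) \<le> \<epsilon>)}"

definition l2_convergent_to :: "(nat \<Rightarrow> 'a vec) \<Rightarrow> 'a vec \<Rightarrow> bool" where
  "l2_convergent_to s \<xi> \<longleftrightarrow> (\<lambda>n. l2norm (\<lambda>x. s n x - \<xi> x)) \<longlonglongrightarrow> 0"

definition linear_op_on :: "'a vec set \<Rightarrow> 'a op \<Rightarrow> bool" where
  "linear_op_on D H \<longleftrightarrow> D \<subseteq> l2 \<and> (\<forall>\<xi>\<in>D. H \<xi> \<in> l2) \<and>
     (\<forall>\<xi>\<in>D. \<forall>\<eta>\<in>D. \<forall>c::complex. (\<lambda>x. \<xi> x + c * \<eta> x) \<in> D \<and>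
        H (\<lambda>x. \<xi> x + c * \<eta> x) = (\<lambda>x. H \<xi> x + c * H \<eta> x))"

definition closed_op :: "'a vec set \<Rightarrow> 'a op \<Rightarrow> bool" where
  "closed_op D H \<longleftrightarrow> linear_op_on D H \<and>
     (\<forall>s \<xi> \<eta>. (\<forall>n. s n \<in> D) \<longrightarrow> \<xi> \<in> l2 \<longrightarrow> \<eta> \<in> l2 \<longrightarrow>
        l2_convergent_to s \<xi> \<longrightarrow> l2_convergent_to (\<lambda>n. H (s n)) \<eta> \<longrightarrow>
        \<xi> \<in> D \<and> H \<xi> = \<eta>)"

definition self_adjoint_op :: "'a vec set \<Rightarrow> 'a op \<Rightarrow> bool" where
  "self_adjoint_op D H \<longleftrightarrow> linear_op_on D H \<and>
     (\<forall>\<xi>\<in>l2. \<forall>\<epsilon>>0. \<exists>\<eta>\<in>D. l2norm (\<lambda>x. \<xi> x - \<eta> x) < \<epsilon>) \<and>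
     (\<forall>\<eta>\<in>l2. \<eta> \<in> D \<longleftrightarrow> (\<exists>\<zeta>\<in>l2. \<forall>\<xi>\<in>D. l2inner (H \<xi>) \<eta> = l2inner \<xi> \<zeta>)) \<and>
     (\<forall>\<xi>\<in>D. \<forall>\<eta>\<in>D. l2inner (H \<xi>) \<eta> = l2inner \<xi> (H \<eta>))"

definition coarse_op :: "('a::metric_space) vec set \<Rightarrow> 'a op \<Rightarrow> bool" where
  "coarse_op D H \<longleftrightarrow> closed_op D H \<and>
     (\<forall>A f. partial_translation A f \<longrightarrow>
        vop A f ` D \<subseteq> D \<and>
        (\<exists>C. \<forall>\<xi>\<in>D. l2norm (\<lambda>x. H (vop A f \<xi>) x - vop A f (H \<xi>) x) \<le> C * l2norm \<xi>))"

text \<open>U is the strongly continuous unitary group t \<mapsto> e^{itH}, i.e. (Stone) the one whose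
  generator is i H.\<close>
definition exp_group :: "(real \<Rightarrow> 'a op) \<Rightarrow> 'a vec set \<Rightarrow> 'a op \<Rightarrow> bool" where
  "exp_group U D H \<longleftrightarrow>
     (\<forall>t. bounded_op (U t) \<and> (\<forall>\<xi>\<in>l2. l2norm (U t \<xi>) = l2norm \<xi>)) \<and>
     (\<forall>\<xi>\<in>l2. U 0 \<xi> = \<xi>) \<and>
     (\<forall>s t. \<forall>\<xi>\<in>l2. U (s + t) \<xi> = U s (U t \<xi>)) \<and>
     (\<forall>\<xi>\<in>l2. \<forall>s. ((\<lambda>t. l2norm (\<lambda>x. U t \<xi> x - U s \<xi> x)) \<longlongrightarrow> 0) (at s)) \<and>
     (\<forall>\<xi>\<in>l2. \<xi> \<in> D \<longleftrightarrow> (\<exists>\<eta>\<in>l2.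
         ((\<lambda>t. l2norm (\<lambda>x. (U t \<xi> x - \<xi> x) / complex_of_real t - \<eta> x)) \<longlongrightarrow> 0) (at 0))) \<and>
     (\<forall>\<xi>\<in>D.
         ((\<lambda>t. l2norm (\<lambda>x. (U t \<xi> x - \<xi> x) / complex_of_real t - \<i> * H \<xi> x)) \<longlongrightarrow> 0) (at 0))"

definition conj_flow :: "(real \<Rightarrow> 'a op) \<Rightarrow> real \<Rightarrow> 'a op \<Rightarrow> 'a op" where
  "conj_flow U t a = (\<lambda>\<xi>. U t (a (U (- t) \<xi>)))"

definition induces_flow :: "(real \<Rightarrow> ('a::metric_space) op) \<Rightarrow> bool" where
  "induces_flow U \<longleftrightarrow>
     (\<forall>t. \<forall>a\<in>uniform_roe. conj_flow U t a \<in> uniform_roe) \<and>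
     (\<forall>t. \<forall>b\<in>uniform_roe. \<exists>a\<in>uniform_roe. eq_on_l2 b (conj_flow U t a)) \<and>
     (\<forall>a\<in>uniform_roe. \<forall>s.
        ((\<lambda>t. opnorm (\<lambda>\<xi> x. conj_flow U t a \<xi> x - conj_flow U s a \<xi> x)) \<longlongrightarrow> 0) (at s))"

definition is_cocycle :: "(real \<Rightarrow> ('a::metric_space) op \<Rightarrow> 'a op) \<Rightarrow> (real \<Rightarrow> 'a op) \<Rightarrow> bool" where
  "is_cocycle \<sigma> u \<longleftrightarrow>
     (\<forall>t. u t \<in> uniform_roe \<and> unitary_op (u t)) \<and>
     (\<forall>s. ((\<lambda>t. opnorm (\<lambda>\<xi> x. u t \<xi> x - u s \<xi> x)) \<longlongrightarrow> 0) (at s)) \<and>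
     (\<forall>t s. eq_on_l2 (u (t + s)) (u t \<circ> \<sigma> t (u s)))"

definition cocycle_perturbation ::
    "(real \<Rightarrow> ('a::metric_space) op \<Rightarrow> 'a op) \<Rightarrow> (real \<Rightarrow> 'a op \<Rightarrow> 'a op) \<Rightarrow> bool" where
  "cocycle_perturbation \<rho> \<sigma> \<longleftrightarrow> (\<exists>u. is_cocycle \<sigma> u \<and>
     (\<forall>t. \<forall>a\<in>uniform_roe. eq_on_l2 (\<rho> t a) (u t \<circ> \<sigma> t a \<circ> adj (u t))))"

end

theory Submission
  imports Defs
begin

text \<open>The cocycle is \<open>u\<^sub>t = e\<^sup>i\<^sup>t\<^sup>h e\<^sup>-\<^sup>i\<^sup>t\<^sup>k\<close>.

  Nikodym's boundedness theorem bounds the commutators of \<open>h\<close> with the projections onto finite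
  sets uniformly, so \<open>\<langle>h \<eta>, \<xi>\<rangle> - \<langle>\<eta>, k \<xi>\<rangle>\<close> is a bounded form on the two domains, without
  any core being identified; differentiating \<open>\<langle>e\<^sup>i\<^sup>t\<^sup>h \<eta>, e\<^sup>i\<^sup>t\<^sup>k \<xi>\<rangle>\<close> gives
  \<open>\<parallel>u\<^sub>t - 1\<parallel> \<le> C \<bar>t\<bar>\<close>.

  Since both flows preserve the uniform Roe algebra, \<open>u\<^sub>t\<close> normalises it. Property A yields
  contractive Schur multipliers of finite propagation that tend to the identity on the algebra, and
  Schur's lemma on \<open>l\<^sub>1\<close> makes this convergence uniform over the operators \<open>u\<^sub>t s u\<^sub>t\<^sup>*\<close> with
  \<open>s\<close> a diagonal sign matrix. Averaging over \<open>s\<close> recovers \<open>u\<^sub>t\<close> up to an invertible diagonal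
  factor when \<open>t\<close> is small, so \<open>u\<^sub>t\<close> lies in the algebra; the cocycle identity extends this to
  all \<open>t\<close>.\<close>

subsection \<open>The Hilbert space of square-summable vectors\<close>

text \<open>Vectors of \<open>c00\<close> lie in both domains, but nothing says that they form a
  core of either operator, so a bound for \<open>h - k\<close> on \<open>c00\<close> does not by
  itself compare the operators. Truncating a domain vector to a finite set costs a commutator, and
  this cost must be uniform in the finite set, whereas coarseness only gives a constant for each
  subset separately. The same gap returns in the second half: being normalised by \<open>u\<close>
  makes the conjugate of each single diagonal projection approximable by multipliers, but the
  projections form no norm compact family. Both times the cure is that the dependence on the subset
  is countably additive with a summable density, and for such densities smallness on every subset
  forces smallness in l1. A unitary that normalises the algebra need not lie in it: the reflection
  of the integers is an example, and its matrix is far from the diagonal. Closeness to 1 rules this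
  out by keeping the diagonal entries of \<open>u\<close> away from 0, which is why small times are
  treated separately.\<close>

lemma l2I:
  assumes "\<And>F. finite F \<Longrightarrow> L2_set (\<lambda>x. cmod (\<xi> x)) F \<le> C"
  shows l2_memI: "\<xi> \<in> l2" and l2norm_leI: "l2norm \<xi> \<le> C"
proof -
  have C: "0 \<le> C" using assms[of "{}"] by simp
  have b: "(\<Sum>x\<in>F. (cmod (\<xi> x))\<^sup>2) \<le> C\<^sup>2" if "finite F" for F
    using assms[OF that] unfolding L2_set_def
    by (metis C abs_of_nonneg real_sqrt_abs real_sqrt_le_iff)
  have s: "(\<lambda>x. (cmod (\<xi> x))\<^sup>2) summable_on UNIV"
    by (rule nonneg_bdd_above_summable_on) (auto intro!: bdd_aboveI2 b)
  then show "\<xi> \<in> l2" by (simp add: l2_def)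
  have "(\<Sum>\<^sub>\<infinity>x. (cmod (\<xi> x))\<^sup>2) \<le> C\<^sup>2"
    by (rule infsum_le_finite_sums[OF s]) (use b in auto)
  then show "l2norm \<xi> \<le> C"
    unfolding l2norm_def using C real_le_lsqrt by blast
qed

lemma L2_set_le_l2norm:
  assumes "\<xi> \<in> l2" "finite F"
  shows "L2_set (\<lambda>x. cmod (\<xi> x)) F \<le> l2norm \<xi>"
  unfolding L2_set_def l2norm_def
  by (rule real_sqrt_le_mono, rule finite_sum_le_infsum) (use assms in \<open>auto simp: l2_def\<close>)

lemma l2norm_nonneg [simp]: "0 \<le> l2norm \<xi>"
  unfolding l2norm_def by (simp add: infsum_nonneg)

lemma l2norm_scale: "l2norm (\<lambda>x. c * \<xi> x) = cmod c * l2norm \<xi>"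
  unfolding l2norm_def
  by (simp add: norm_mult power_mult_distrib infsum_cmult_right' real_sqrt_mult)

lemma l2norm_minus_commute: "l2norm (\<lambda>x. \<xi> x - \<eta> x) = l2norm (\<lambda>x. \<eta> x - \<xi> x)"
  unfolding l2norm_def by (subst norm_minus_commute) (rule refl)

lemma l2norm_zero [simp]: "l2norm (\<lambda>x. 0) = 0"
  unfolding l2norm_def by simp

lemma cmod_le_l2norm:
  assumes "\<xi> \<in> l2"
  shows "cmod (\<xi> x) \<le> l2norm \<xi>"
  using L2_set_le_l2norm[OF assms, of "{x}"] by simp

lemma l2norm_eq_0D:
  assumes "\<xi> \<in> l2" "l2norm \<xi> = 0"
  shows "\<xi> = (\<lambda>x. 0)"
proof
  fix x show "\<xi> x = 0" using cmod_le_l2norm[OF assms(1), of x] assms(2) by simp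
qed

lemma l2_plus:
  assumes "\<xi> \<in> l2" "\<eta> \<in> l2"
  shows l2_add: "(\<lambda>x. \<xi> x + \<eta> x) \<in> l2"
    and l2norm_triangle: "l2norm (\<lambda>x. \<xi> x + \<eta> x) \<le> l2norm \<xi> + l2norm \<eta>"
proof -
  have "L2_set (\<lambda>x. cmod (\<xi> x + \<eta> x)) F \<le> l2norm \<xi> + l2norm \<eta>" if "finite F" for F
  proof -
    have "L2_set (\<lambda>x. cmod (\<xi> x + \<eta> x)) F \<le> L2_set (\<lambda>x. cmod (\<xi> x) + cmod (\<eta> x)) F"
      by (intro L2_set_mono norm_triangle_ineq) auto
    also have "\<dots> \<le> L2_set (\<lambda>x. cmod (\<xi> x)) F + L2_set (\<lambda>x. cmod (\<eta> x)) F"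
      by (rule L2_set_triangle_ineq)
    also have "\<dots> \<le> l2norm \<xi> + l2norm \<eta>"
      using assms that by (intro add_mono L2_set_le_l2norm)
    finally show ?thesis .
  qed
  note * = l2I[OF this]
  show "(\<lambda>x. \<xi> x + \<eta> x) \<in> l2" "l2norm (\<lambda>x. \<xi> x + \<eta> x) \<le> l2norm \<xi> + l2norm \<eta>"
    by (rule *, assumption)+
qed

lemma l2_zero [simp]: "(\<lambda>x. 0) \<in> l2"
  by (simp add: l2_def)

lemma l2_scale: "\<xi> \<in> l2 \<Longrightarrow> (\<lambda>x. c * \<xi> x) \<in> l2"
  unfolding l2_def by (simp add: norm_mult power_mult_distrib summable_on_cmult_right)

lemma l2_diff: "\<xi> \<in> l2 \<Longrightarrow> \<eta> \<in> l2 \<Longrightarrow> (\<lambda>x. \<xi> x - \<eta> x) \<in> l2"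
proof -
  assume "\<xi> \<in> l2" "\<eta> \<in> l2"
  then have "(\<lambda>x. \<xi> x + (-1) * \<eta> x) \<in> l2" by (intro l2_add l2_scale)
  then show ?thesis by (simp only: mult_minus1 add_uminus_conv_diff)
qed

lemma l2_divide: "\<xi> \<in> l2 \<Longrightarrow> (\<lambda>x. \<xi> x / c) \<in> l2"
  unfolding divide_inverse mult.commute[of _ "inverse c"] by (rule l2_scale)

lemma l2_lin: "\<xi> \<in> l2 \<Longrightarrow> \<eta> \<in> l2 \<Longrightarrow> (\<lambda>x. \<xi> x + c * \<eta> x) \<in> l2"
  by (intro l2_add l2_scale)

lemma l2norm_triangle_sub:
  assumes "\<xi> \<in> l2" "\<eta> \<in> l2"
  shows "l2norm \<xi> \<le> l2norm (\<lambda>x. \<xi> x - \<eta> x) + l2norm \<eta>"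
  using l2norm_triangle[OF l2_diff[OF assms] assms(2)] by simp

section \<open>Diagonal projections, basis vectors and finite truncation\<close>

definition cut :: "'a set \<Rightarrow> 'a vec \<Rightarrow> 'a vec" where
  "cut A \<xi> = (\<lambda>x. if x \<in> A then \<xi> x else 0)"

definition delta :: "'a \<Rightarrow> 'a vec" where
  "delta x = (\<lambda>y. if y = x then 1 else 0)"

lemma vop_id: "vop A id = cut A"
proof (intro ext)
  fix \<xi> :: "'a vec" and y
  show "vop A id \<xi> y = cut A \<xi> y"
    using the_inv_into_f_f[of id A y] by (simp add: vop_def cut_def)
qed

lemma partial_translation_id: "partial_translation A id"
  unfolding partial_translation_def by auto

lemma c00_subset_l2: "c00 \<subseteq> l2"
proof
  fix \<xi> :: "'a vec" assume "\<xi> \<in> c00"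
  then have f: "finite {x. \<xi> x \<noteq> 0}" by (simp add: c00_def)
  have "(\<lambda>x. (cmod (\<xi> x))\<^sup>2) summable_on UNIV \<longleftrightarrow> (\<lambda>x. (cmod (\<xi> x))\<^sup>2) summable_on {x. \<xi> x \<noteq> 0}"
    by (rule summable_on_cong_neutral) auto
  with f show "\<xi> \<in> l2" unfolding l2_def by simp
qed

lemma cut_c00:
  assumes "finite A"
  shows "cut A \<xi> \<in> c00"
proof -
  have "{x. cut A \<xi> x \<noteq> 0} \<subseteq> A" by (auto simp: cut_def)
  then show ?thesis using assms finite_subset unfolding c00_def by blast
qed

lemma delta_c00: "delta x \<in> c00"
  by (simp add: delta_def c00_def)

lemma delta_l2 [simp]: "delta x \<in> l2"
  by (rule subsetD[OF c00_subset_l2 delta_c00])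

lemma l2norm_delta [simp]: "l2norm (delta x) = 1"
proof -
  have "(\<Sum>\<^sub>\<infinity>y. (cmod (delta x y))\<^sup>2) = (\<Sum>\<^sub>\<infinity>y\<in>{x}. (cmod (delta x y))\<^sup>2)"
    by (rule infsum_cong_neutral) (auto simp: delta_def)
  then show ?thesis by (simp add: l2norm_def delta_def)
qed

lemma cut_l2_norm:
  assumes "\<xi> \<in> l2"
  shows cut_l2: "cut A \<xi> \<in> l2" and l2norm_cut: "l2norm (cut A \<xi>) \<le> l2norm \<xi>"
proof -
  have "L2_set (\<lambda>x. cmod (cut A \<xi> x)) F \<le> l2norm \<xi>" if "finite F" for F
    by (rule order_trans[OF L2_set_mono L2_set_le_l2norm[OF assms that]]) (auto simp: cut_def)
  note * = l2I[OF this]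
  show "cut A \<xi> \<in> l2" "l2norm (cut A \<xi>) \<le> l2norm \<xi>" by (rule *, assumption)+
qed

lemma l2norm_cut_finite: "finite F \<Longrightarrow> l2norm (cut F \<xi>) = L2_set (\<lambda>x. cmod (\<xi> x)) F"
proof -
  assume F: "finite F"
  have "(\<Sum>\<^sub>\<infinity>y. (cmod (cut F \<xi> y))\<^sup>2) = (\<Sum>\<^sub>\<infinity>y\<in>F. (cmod (\<xi> y))\<^sup>2)"
    by (rule infsum_cong_neutral) (auto simp: cut_def)
  then show ?thesis using F by (simp add: l2norm_def L2_set_def)
qed

lemma cut_tendsto:
  assumes "\<xi> \<in> l2"
  shows "((\<lambda>F. l2norm (\<lambda>x. \<xi> x - cut F \<xi> x)) \<longlongrightarrow> 0) (finite_subsets_at_top UNIV)"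
proof -
  let ?g = "\<lambda>x. (cmod (\<xi> x))\<^sup>2"
  have s: "?g summable_on UNIV" using assms by (simp add: l2_def)
  have "(sum ?g \<longlongrightarrow> infsum ?g UNIV) (finite_subsets_at_top UNIV)"
    by (rule infsum_tendsto[OF s])
  then have "((\<lambda>F. sqrt (infsum ?g UNIV - sum ?g F)) \<longlongrightarrow> sqrt (infsum ?g UNIV - infsum ?g UNIV))
      (finite_subsets_at_top UNIV)"
    by (intro tendsto_intros)
  moreover have "\<forall>\<^sub>F F in finite_subsets_at_top UNIV.
      sqrt (infsum ?g UNIV - sum ?g F) = l2norm (\<lambda>x. \<xi> x - cut F \<xi> x)"
  proof (rule eventually_finite_subsets_at_top_weakI)
    fix F :: "'a set" assume F: "finite F" "F \<subseteq> UNIV"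
    have "infsum ?g (UNIV - F) = infsum ?g UNIV - infsum ?g F"
      by (rule infsum_Diff) (use s F in auto)
    moreover have "(\<Sum>\<^sub>\<infinity>x. (cmod (\<xi> x - cut F \<xi> x))\<^sup>2) = infsum ?g (UNIV - F)"
      by (rule infsum_cong_neutral) (auto simp: cut_def)
    ultimately show "sqrt (infsum ?g UNIV - sum ?g F) = l2norm (\<lambda>x. \<xi> x - cut F \<xi> x)"
      using F by (simp add: l2norm_def)
  qed
  ultimately show ?thesis by (simp add: tendsto_cong)
qed

section \<open>The inner product and testing against dense sets\<close>

lemma l2_inner_abs_summable:
  assumes "\<xi> \<in> l2" "\<eta> \<in> l2"
  shows l2_prod_abs_summable: "(\<lambda>x. cmod (cnj (\<xi> x) * \<eta> x)) summable_on A"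
    and l2_prod_infsum_le: "(\<Sum>\<^sub>\<infinity>x\<in>A. cmod (cnj (\<xi> x) * \<eta> x)) \<le> l2norm \<xi> * l2norm \<eta>"
proof -
  have b: "(\<Sum>x\<in>F. cmod (cnj (\<xi> x) * \<eta> x)) \<le> l2norm \<xi> * l2norm \<eta>" if "finite F" for F
  proof -
    have "(\<Sum>x\<in>F. cmod (cnj (\<xi> x) * \<eta> x)) = (\<Sum>x\<in>F. \<bar>cmod (\<xi> x)\<bar> * \<bar>cmod (\<eta> x)\<bar>)"
      by (simp add: norm_mult)
    also have "\<dots> \<le> L2_set (\<lambda>x. cmod (\<xi> x)) F * L2_set (\<lambda>x. cmod (\<eta> x)) F"
      by (rule L2_set_mult_ineq)
    also have "\<dots> \<le> l2norm \<xi> * l2norm \<eta>"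
      using assms that by (intro mult_mono L2_set_le_l2norm) auto
    finally show ?thesis .
  qed
  show s: "(\<lambda>x. cmod (cnj (\<xi> x) * \<eta> x)) summable_on A"
    by (rule nonneg_bdd_above_summable_on) (auto intro!: bdd_aboveI2 b)
  show "(\<Sum>\<^sub>\<infinity>x\<in>A. cmod (cnj (\<xi> x) * \<eta> x)) \<le> l2norm \<xi> * l2norm \<eta>"
    by (rule infsum_le_finite_sums[OF s]) (use b in auto)
qed

lemma l2_prod_summable:
  "\<xi> \<in> l2 \<Longrightarrow> \<eta> \<in> l2 \<Longrightarrow> (\<lambda>x. cnj (\<xi> x) * \<eta> x) summable_on A"
  by (rule abs_summable_summable, rule l2_prod_abs_summable)

lemma l2inner_cauchy_schwarz:
  assumes "\<xi> \<in> l2" "\<eta> \<in> l2"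
  shows "cmod (l2inner \<xi> \<eta>) \<le> l2norm \<xi> * l2norm \<eta>"
  unfolding l2inner_def
  by (rule order_trans[OF norm_infsum_bound l2_prod_infsum_le])
     (use assms l2_prod_abs_summable in auto)

lemma l2inner_add_right:
  "\<xi> \<in> l2 \<Longrightarrow> \<eta> \<in> l2 \<Longrightarrow> \<zeta> \<in> l2 \<Longrightarrow> l2inner \<xi> (\<lambda>x. \<eta> x + \<zeta> x) = l2inner \<xi> \<eta> + l2inner \<xi> \<zeta>"
  unfolding l2inner_def by (simp add: distrib_left infsum_add l2_prod_summable)

lemma l2inner_scale_right: "l2inner \<xi> (\<lambda>x. c * \<eta> x) = c * l2inner \<xi> \<eta>"
proof -
  have "l2inner \<xi> (\<lambda>x. c * \<eta> x) = (\<Sum>\<^sub>\<infinity>x. c * (cnj (\<xi> x) * \<eta> x))"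
    unfolding l2inner_def by (simp add: algebra_simps)
  then show ?thesis unfolding l2inner_def by (simp add: infsum_cmult_right')
qed

lemma l2inner_cnj: "cnj (l2inner \<xi> \<eta>) = l2inner \<eta> \<xi>"
  unfolding l2inner_def infsum_cnj[symmetric] by (simp add: mult.commute)

lemma l2inner_scale_left: "l2inner (\<lambda>x. c * \<xi> x) \<eta> = cnj c * l2inner \<xi> \<eta>"
  by (subst (1 2) l2inner_cnj[symmetric]) (simp only: l2inner_scale_right complex_cnj_mult)

lemma l2inner_add_left:
  "\<xi> \<in> l2 \<Longrightarrow> \<eta> \<in> l2 \<Longrightarrow> \<zeta> \<in> l2 \<Longrightarrow> l2inner (\<lambda>x. \<xi> x + \<eta> x) \<zeta> = l2inner \<xi> \<zeta> + l2inner \<eta> \<zeta>"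
  by (subst (1 2 3) l2inner_cnj[symmetric]) (simp only: l2inner_add_right complex_cnj_add)

lemma l2inner_diff_right:
  "\<xi> \<in> l2 \<Longrightarrow> \<eta> \<in> l2 \<Longrightarrow> \<zeta> \<in> l2 \<Longrightarrow> l2inner \<xi> (\<lambda>x. \<eta> x - \<zeta> x) = l2inner \<xi> \<eta> - l2inner \<xi> \<zeta>"
  using l2inner_add_right[of \<xi> \<eta> "\<lambda>x. (-1) * \<zeta> x"] l2_scale[of \<zeta> "-1"]
    l2inner_scale_right[of \<xi> "-1" \<zeta>] by simp

lemma l2inner_diff_left:
  "\<xi> \<in> l2 \<Longrightarrow> \<eta> \<in> l2 \<Longrightarrow> \<zeta> \<in> l2 \<Longrightarrow> l2inner (\<lambda>x. \<xi> x - \<eta> x) \<zeta> = l2inner \<xi> \<zeta> - l2inner \<eta> \<zeta>"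
  by (subst (1 2 3) l2inner_cnj[symmetric]) (simp only: l2inner_diff_right complex_cnj_diff)

lemma l2inner_self: "l2inner \<xi> \<xi> = complex_of_real ((l2norm \<xi>)\<^sup>2)" if "\<xi> \<in> l2"
proof -
  have "l2inner \<xi> \<xi> = (\<Sum>\<^sub>\<infinity>x. complex_of_real ((cmod (\<xi> x))\<^sup>2))"
    unfolding l2inner_def by (intro infsum_cong, subst complex_norm_square, rule mult.commute)
  also have "\<dots> = complex_of_real (\<Sum>\<^sub>\<infinity>x. (cmod (\<xi> x))\<^sup>2)"
    using that by (intro infsumI has_sum_of_real has_sum_infsum) (simp add: l2_def)
  finally show ?thesis unfolding l2norm_def by (simp add: infsum_nonneg)
qed

lemma l2inner_delta_left [simp]: "l2inner (delta x) \<xi> = \<xi> x"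
proof -
  have "l2inner (delta x) \<xi> = (\<Sum>\<^sub>\<infinity>y\<in>{x}. \<xi> y)"
    unfolding l2inner_def by (rule infsum_cong_neutral) (auto simp: delta_def)
  then show ?thesis by simp
qed

lemma l2inner_delta_right [simp]: "l2inner \<xi> (delta x) = cnj (\<xi> x)"
  by (subst l2inner_cnj[symmetric]) simp

lemma l2inner_cut: "l2inner (cut A \<xi>) \<eta> = (\<Sum>\<^sub>\<infinity>x\<in>A. cnj (\<xi> x) * \<eta> x)"
  unfolding l2inner_def by (rule infsum_cong_neutral) (auto simp: cut_def)

lemma l2inner_cut_right: "l2inner \<xi> (cut A \<eta>) = (\<Sum>\<^sub>\<infinity>x\<in>A. cnj (\<xi> x) * \<eta> x)"
  unfolding l2inner_def by (rule infsum_cong_neutral) (auto simp: cut_def)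

text \<open>Writing \<open>\<xi>\<close> as \<open>\<xi> - \<eta>\<close> plus a nearby
  \<open>\<eta>\<close> in \<open>D\<close> gives |\<xi>|^2 <= C |\<xi>| up to an error. The test
  vectors range over a set such as an operator domain, since form estimates are available only
  there.\<close>

lemma l2norm_le_by_inner:
  assumes \<xi>: "\<xi> \<in> l2" and D: "D \<subseteq> l2"
    and dense: "\<And>\<zeta> \<epsilon>. \<zeta> \<in> l2 \<Longrightarrow> \<epsilon> > 0 \<Longrightarrow> \<exists>\<eta>\<in>D. l2norm (\<lambda>x. \<zeta> x - \<eta> x) < \<epsilon>"
    and b: "\<And>\<eta>. \<eta> \<in> D \<Longrightarrow> cmod (l2inner \<eta> \<xi>) \<le> C * l2norm \<eta>" and C: "C \<ge> 0"
  shows "l2norm \<xi> \<le> C"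
proof -
  have "(l2norm \<xi>)\<^sup>2 \<le> C * l2norm \<xi> + \<epsilon>" if e: "\<epsilon> > 0" for \<epsilon>
  proof -
    \<comment> \<open>Both errors, \<open>d * l2norm \<xi>\<close> from Cauchy-Schwarz and
      \<open>C * d\<close> from the norm of \<open>\<eta>\<close>, fit into \<epsilon>; the summand
      1 keeps the denominator positive.\<close>
    define d where "d = \<epsilon> / (C + l2norm \<xi> + 1)"
    have p: "C + l2norm \<xi> + 1 > 0" using C by (simp add: add_nonneg_pos)
    have d: "d > 0" "d * (C + l2norm \<xi>) \<le> \<epsilon>" using e p C by (auto simp: d_def field_simps)
    obtain \<eta> where \<eta>: "\<eta> \<in> D" "l2norm (\<lambda>x. \<xi> x - \<eta> x) < d" using dense[OF \<xi> d(1)] by blast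
    have \<eta>2: "\<eta> \<in> l2" using \<eta> D by blast
    have "l2norm \<eta> \<le> l2norm \<xi> + d"
      using l2norm_triangle_sub[OF \<eta>2 \<xi>] \<eta>(2) l2norm_minus_commute[of \<xi> \<eta>] by linarith
    then have 1: "cmod (l2inner \<eta> \<xi>) \<le> C * (l2norm \<xi> + d)"
      using b[OF \<eta>(1)] C by (meson mult_left_mono order_trans)
    have 2: "cmod (l2inner (\<lambda>x. \<xi> x - \<eta> x) \<xi>) \<le> d * l2norm \<xi>"
      by (rule order_trans[OF l2inner_cauchy_schwarz]) (use \<xi> \<eta>2 \<eta>(2) in \<open>auto intro: l2_diff mult_right_mono\<close>)
    have "(l2norm \<xi>)\<^sup>2 = cmod (l2inner \<xi> \<xi>)" using l2inner_self[OF \<xi>] by (simp add: norm_power)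
    also have "l2inner \<xi> \<xi> = l2inner (\<lambda>x. \<xi> x - \<eta> x) \<xi> + l2inner \<eta> \<xi>"
      using l2inner_diff_left[OF \<xi> \<eta>2 \<xi>] by simp
    also have "cmod \<dots> \<le> d * l2norm \<xi> + C * (l2norm \<xi> + d)"
      by (rule order_trans[OF norm_triangle_ineq add_mono[OF 2 1]])
    also have "\<dots> \<le> C * l2norm \<xi> + \<epsilon>" using d(2) by (simp add: algebra_simps)
    finally show ?thesis .
  qed
  then have "(l2norm \<xi>)\<^sup>2 \<le> C * l2norm \<xi>" by (rule field_le_epsilon)
  then show ?thesis
    using C l2norm_nonneg[of \<xi>] unfolding power2_eq_square
    by (metis mult_le_cancel_right order_le_less)
qed

text \<open>\<open>exp_group\<close> asks only for norm preservation; this identity turns it into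
  preservation of inner products. Each coefficient is the conjugate of the scalar in front of
  \<open>\<eta>\<close>, as \<open>l2inner\<close> is conjugate linear in its first
  argument.\<close>

lemma l2inner_polarization:
  assumes "\<xi> \<in> l2" "\<eta> \<in> l2"
  shows "4 * l2inner \<xi> \<eta> =
    complex_of_real ((l2norm (\<lambda>x. \<xi> x + 1 * \<eta> x))\<^sup>2) - complex_of_real ((l2norm (\<lambda>x. \<xi> x + (-1) * \<eta> x))\<^sup>2)
    - \<i> * complex_of_real ((l2norm (\<lambda>x. \<xi> x + \<i> * \<eta> x))\<^sup>2) + \<i> * complex_of_real ((l2norm (\<lambda>x. \<xi> x + (-\<i>) * \<eta> x))\<^sup>2)"
proof -
  have "complex_of_real ((l2norm (\<lambda>x. \<xi> x + c * \<eta> x))\<^sup>2) =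
     l2inner \<xi> \<xi> + c * l2inner \<xi> \<eta> + cnj c * l2inner \<eta> \<xi> + c * cnj c * l2inner \<eta> \<eta>" for c
    using assms l2_scale[OF assms(2), of c]
    by (subst l2inner_self[symmetric])
       (auto simp: l2_lin l2inner_add_left l2inner_add_right l2inner_scale_left l2inner_scale_right algebra_simps)
  note e = this[of 1] this[of "-1"] this[of \<i>] this[of "-\<i>"]
  show ?thesis unfolding e by (simp add: algebra_simps)
qed

subsection \<open>Bounded operators and their matrices\<close>

lemma bounded_op_l2: "bounded_op T \<Longrightarrow> \<xi> \<in> l2 \<Longrightarrow> T \<xi> \<in> l2"
  unfolding bounded_op_def by blast

lemma bounded_op_lin:
  "bounded_op T \<Longrightarrow> \<xi> \<in> l2 \<Longrightarrow> \<eta> \<in> l2 \<Longrightarrow> T (\<lambda>x. \<xi> x + c * \<eta> x) = (\<lambda>x. T \<xi> x + c * T \<eta> x)"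
  unfolding bounded_op_def linear_on_l2_def by blast

lemma bounded_op_boundE:
  assumes "bounded_op T"
  obtains C where "C \<ge> 0" "\<And>\<xi>. \<xi> \<in> l2 \<Longrightarrow> l2norm (T \<xi>) \<le> C * l2norm \<xi>"
proof -
  obtain C where C: "\<And>\<xi>. \<xi> \<in> l2 \<Longrightarrow> l2norm (T \<xi>) \<le> C * l2norm \<xi>"
    using assms unfolding bounded_op_def by auto
  have "l2norm (T \<xi>) \<le> max C 0 * l2norm \<xi>" if "\<xi> \<in> l2" for \<xi>
    by (rule order_trans[OF C[OF that] mult_right_mono]) auto
  then show ?thesis using that[of "max C 0"] by simp
qed

lemma bounded_op_zero: "bounded_op T \<Longrightarrow> T (\<lambda>x. 0) = (\<lambda>x. 0)"
  using bounded_op_lin[of T "\<lambda>x. 0" "\<lambda>x. 0" "-1"] by simp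

lemma bounded_op_scale: "bounded_op T \<Longrightarrow> \<xi> \<in> l2 \<Longrightarrow> T (\<lambda>x. c * \<xi> x) = (\<lambda>x. c * T \<xi> x)"
  using bounded_op_lin[of T "\<lambda>x. 0" \<xi> c] bounded_op_zero[of T] by simp

lemma bounded_op_diff:
  "bounded_op T \<Longrightarrow> \<xi> \<in> l2 \<Longrightarrow> \<eta> \<in> l2 \<Longrightarrow> T (\<lambda>x. \<xi> x - \<eta> x) = (\<lambda>x. T \<xi> x - T \<eta> x)"
  using bounded_op_lin[of T \<xi> \<eta> "-1"] by simp

lemma opnorm_leI:
  assumes "\<And>\<xi>. \<xi> \<in> l2 \<Longrightarrow> l2norm (T \<xi>) \<le> C * l2norm \<xi>" "C \<ge> 0"
  shows "opnorm T \<le> C"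
  unfolding opnorm_def
proof (rule cSUP_least)
  show "{\<xi> \<in> l2. l2norm \<xi> \<le> 1} \<noteq> ({} :: 'a vec set)"
    using l2_zero l2norm_zero by (metis (mono_tags, lifting) empty_iff mem_Collect_eq zero_le_one)
next
  fix \<xi> :: "'a vec" assume "\<xi> \<in> {\<xi> \<in> l2. l2norm \<xi> \<le> 1}"
  then have \<xi>: "\<xi> \<in> l2" "l2norm \<xi> \<le> 1" by auto
  show "l2norm (T \<xi>) \<le> C"
    using order_trans[OF assms(1)[OF \<xi>(1)] mult_left_mono[OF \<xi>(2) assms(2)]] by simp
qed

lemma opnorm_bound:
  assumes T: "bounded_op T" and \<xi>: "\<xi> \<in> l2"
  shows "l2norm (T \<xi>) \<le> opnorm T * l2norm \<xi>"
proof (cases "l2norm \<xi> = 0")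
  case True
  then have "\<xi> = (\<lambda>x. 0)" by (rule l2norm_eq_0D[OF \<xi>])
  then show ?thesis using bounded_op_zero[OF T] by simp
next
  case False
  define c where "c = complex_of_real (1 / l2norm \<xi>)"
  have c: "cmod c = 1 / l2norm \<xi>" by (simp add: c_def norm_divide)
  let ?\<eta> = "\<lambda>x. c * \<xi> x"
  have \<eta>: "?\<eta> \<in> l2" "l2norm ?\<eta> = 1" using \<xi> False by (auto simp: l2norm_scale c intro: l2_scale)
  obtain C where C: "C \<ge> 0" "\<And>\<xi>. \<xi> \<in> l2 \<Longrightarrow> l2norm (T \<xi>) \<le> C * l2norm \<xi>"
    by (rule bounded_op_boundE[OF T]) blast
  have "l2norm (T ?\<eta>) \<le> opnorm T"
    unfolding opnorm_def
  proof (rule cSUP_upper)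
    show "?\<eta> \<in> {\<xi> \<in> l2. l2norm \<xi> \<le> 1}" using \<eta> by simp
    show "bdd_above ((\<lambda>\<xi>. l2norm (T \<xi>)) ` {\<xi> \<in> l2. l2norm \<xi> \<le> 1})"
    proof (rule bdd_aboveI2)
      fix \<xi> :: "'a vec" assume "\<xi> \<in> {\<xi> \<in> l2. l2norm \<xi> \<le> 1}"
      then have \<xi>: "\<xi> \<in> l2" "l2norm \<xi> \<le> 1" by auto
      show "l2norm (T \<xi>) \<le> C"
        using order_trans[OF C(2)[OF \<xi>(1)] mult_left_mono[OF \<xi>(2) C(1)]] by simp
    qed
  qed
  moreover have "l2norm (T ?\<eta>) = l2norm (T \<xi>) / l2norm \<xi>"
    unfolding bounded_op_scale[OF T \<xi>] l2norm_scale c by simp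
  ultimately show ?thesis using False l2norm_nonneg[of \<xi>] by (simp add: divide_le_eq split: if_splits)
qed

lemma bounded_opI:
  assumes "\<And>\<xi>. \<xi> \<in> l2 \<Longrightarrow> T \<xi> \<in> l2"
    and "\<And>\<xi> \<eta> c. \<xi> \<in> l2 \<Longrightarrow> \<eta> \<in> l2 \<Longrightarrow> T (\<lambda>x. \<xi> x + c * \<eta> x) = (\<lambda>x. T \<xi> x + c * T \<eta> x)"
    and "\<And>\<xi>. \<xi> \<in> l2 \<Longrightarrow> l2norm (T \<xi>) \<le> C * l2norm \<xi>"
  shows "bounded_op T"
  unfolding bounded_op_def linear_on_l2_def using assms by blast

lemma bounded_op_add:
  assumes S: "bounded_op S" and T: "bounded_op T"
  shows "bounded_op (\<lambda>\<xi> x. S \<xi> x + T \<xi> x)"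
proof -
  obtain C where C: "C \<ge> 0" "\<And>\<xi>. \<xi> \<in> l2 \<Longrightarrow> l2norm (S \<xi>) \<le> C * l2norm \<xi>"
    by (rule bounded_op_boundE[OF S]) blast
  obtain D where D: "D \<ge> 0" "\<And>\<xi>. \<xi> \<in> l2 \<Longrightarrow> l2norm (T \<xi>) \<le> D * l2norm \<xi>"
    by (rule bounded_op_boundE[OF T]) blast
  show ?thesis
  proof (rule bounded_opI)
    fix \<xi> :: "'a vec" assume \<xi>: "\<xi> \<in> l2"
    note b = bounded_op_l2[OF S \<xi>] bounded_op_l2[OF T \<xi>]
    show "(\<lambda>x. S \<xi> x + T \<xi> x) \<in> l2" by (rule l2_add[OF b])
    show "l2norm (\<lambda>x. S \<xi> x + T \<xi> x) \<le> (C + D) * l2norm \<xi>"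
      using l2norm_triangle[OF b] C(2)[OF \<xi>] D(2)[OF \<xi>] by (simp add: distrib_right)
  qed (simp add: bounded_op_lin[OF S] bounded_op_lin[OF T] algebra_simps)
qed

lemma bounded_op_smult:
  assumes T: "bounded_op T"
  shows "bounded_op (\<lambda>\<xi> x. c * T \<xi> x)"
proof -
  obtain D where D: "D \<ge> 0" "\<And>\<xi>. \<xi> \<in> l2 \<Longrightarrow> l2norm (T \<xi>) \<le> D * l2norm \<xi>"
    by (rule bounded_op_boundE[OF T]) blast
  show ?thesis
  proof (rule bounded_opI)
    fix \<xi> :: "'a vec" assume \<xi>: "\<xi> \<in> l2"
    show "(\<lambda>x. c * T \<xi> x) \<in> l2" by (rule l2_scale[OF bounded_op_l2[OF T \<xi>]])
    show "l2norm (\<lambda>x. c * T \<xi> x) \<le> (cmod c * D) * l2norm \<xi>"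
      unfolding l2norm_scale mult.assoc by (rule mult_left_mono[OF D(2)[OF \<xi>]]) simp
  qed (simp add: bounded_op_lin[OF T] algebra_simps)
qed

lemma bounded_op_sub:
  assumes S: "bounded_op S" and T: "bounded_op T"
  shows "bounded_op (\<lambda>\<xi> x. S \<xi> x - T \<xi> x)"
  using bounded_op_add[OF S bounded_op_smult[OF T, of "-1"]] by simp

lemma bounded_op_comp:
  assumes S: "bounded_op S" and T: "bounded_op T"
  shows "bounded_op (S \<circ> T)"
proof -
  obtain C where C: "C \<ge> 0" "\<And>\<xi>. \<xi> \<in> l2 \<Longrightarrow> l2norm (S \<xi>) \<le> C * l2norm \<xi>"
    by (rule bounded_op_boundE[OF S]) blast
  obtain D where D: "D \<ge> 0" "\<And>\<xi>. \<xi> \<in> l2 \<Longrightarrow> l2norm (T \<xi>) \<le> D * l2norm \<xi>"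
    by (rule bounded_op_boundE[OF T]) blast
  show ?thesis
  proof (rule bounded_opI)
    fix \<xi> :: "'a vec" assume \<xi>: "\<xi> \<in> l2"
    note b = bounded_op_l2[OF T \<xi>]
    show "(S \<circ> T) \<xi> \<in> l2" by (simp add: bounded_op_l2[OF S b])
    show "l2norm ((S \<circ> T) \<xi>) \<le> (C * D) * l2norm \<xi>"
      unfolding mult.assoc o_apply by (rule order_trans[OF C(2)[OF b] mult_left_mono[OF D(2)[OF \<xi>] C(1)]])
  qed (simp add: bounded_op_lin[OF T] bounded_op_lin[OF S] bounded_op_l2[OF T])
qed

lemma vop_delta:
  assumes "inj_on f A"
  shows "vop A f (delta y) x = (if y \<in> A \<and> f y = x then 1 else 0)"
proof (cases "x \<in> f ` A")
  case True
  then obtain z where z: "z \<in> A" "x = f z" by blast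
  then show ?thesis
    using the_inv_into_f_f[OF assms z(1)] inj_onD[OF assms, of y z] by (auto simp: vop_def delta_def)
next
  case False
  then show ?thesis by (auto simp: vop_def)
qed

lemma vop_bounded:
  assumes f: "inj_on f A"
  shows "bounded_op (vop A f)"
proof -
  let ?g = "the_inv_into A f"
  have "L2_set (\<lambda>x. cmod (vop A f \<xi> x)) F \<le> l2norm \<xi>" if \<xi>: "\<xi> \<in> l2" and F: "finite F" for \<xi> F
  proof -
    let ?F = "F \<inter> f ` A"
    have inj: "inj_on ?g ?F" by (rule inj_on_subset[OF inj_on_the_inv_into[OF f]]) auto
    have "(\<Sum>x\<in>F. (cmod (vop A f \<xi> x))\<^sup>2) = (\<Sum>x\<in>?F. (cmod (\<xi> (?g x)))\<^sup>2)"
      by (rule sum.mono_neutral_cong_right) (auto simp: vop_def F)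
    also have "\<dots> = (\<Sum>x\<in>?g ` ?F. (cmod (\<xi> x))\<^sup>2)"
      by (simp add: sum.reindex[OF inj])
    finally have "L2_set (\<lambda>x. cmod (vop A f \<xi> x)) F = L2_set (\<lambda>x. cmod (\<xi> x)) (?g ` ?F)"
      by (simp add: L2_set_def)
    also have "\<dots> \<le> l2norm \<xi>" by (rule L2_set_le_l2norm[OF \<xi>]) (use F in simp)
    finally show ?thesis .
  qed
  note b = this
  show ?thesis
  proof (rule bounded_opI)
    fix \<xi> :: "'a vec" assume \<xi>: "\<xi> \<in> l2"
    show "vop A f \<xi> \<in> l2" by (rule l2_memI) (rule b[OF \<xi>])
    show "l2norm (vop A f \<xi>) \<le> 1 * l2norm \<xi>" unfolding mult_1 by (rule l2norm_leI) (rule b[OF \<xi>])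
  next
    fix \<xi> \<eta> :: "'a vec" and c
    show "vop A f (\<lambda>x. \<xi> x + c * \<eta> x) = (\<lambda>x. vop A f \<xi> x + c * vop A f \<eta> x)"
      unfolding vop_def by (rule ext) simp
  qed
qed

text \<open>Column \<open>y\<close> of the matrix of \<open>T\<close> is \<open>T (delta y)\<close>,
  so its entry at (x, y) is \<open>T (delta y) x\<close>; all matrix arguments below use this
  convention.\<close>

lemma bounded_op_sum_delta:
  assumes T: "bounded_op T" and F: "finite F"
  shows "T (cut F \<xi>) = (\<lambda>x. \<Sum>y\<in>F. T (delta y) x * \<xi> y)"
  using F
proof (induction F)
  case empty
  have "cut {} \<xi> = (\<lambda>x. 0)" by (simp add: cut_def)
  then show ?case using bounded_op_zero[OF T] by simp
next
  case (insert z F)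
  have e: "cut (insert z F) \<xi> = (\<lambda>x. cut F \<xi> x + \<xi> z * delta z x)"
    using insert.hyps by (auto simp: cut_def delta_def intro!: ext)
  have "cut F \<xi> \<in> l2" by (rule subsetD[OF c00_subset_l2 cut_c00[OF insert.hyps(1)]])
  then show ?case
    unfolding e using insert by (simp add: bounded_op_lin[OF T] insert.IH algebra_simps)
qed

text \<open>\<open>is_adjoint\<close> does not mention linearity or boundedness of \<open>S\<close>.
  Both follow from the adjoint relation: testing on \<open>delta x\<close> expresses each coordinate
  of \<open>S \<xi>\<close> as an inner product with \<open>T (delta x)\<close>, and Cauchy-Schwarz
  transfers the bound of \<open>T\<close>.\<close>

lemma adjoint_bounded:
  assumes T: "bounded_op T" and S: "is_adjoint T S"
  shows "bounded_op S"
proof -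
  have S1: "\<xi> \<in> l2 \<Longrightarrow> S \<xi> \<in> l2" for \<xi> using S unfolding is_adjoint_def by blast
  have S2: "\<xi> \<in> l2 \<Longrightarrow> \<eta> \<in> l2 \<Longrightarrow> l2inner (T \<xi>) \<eta> = l2inner \<xi> (S \<eta>)" for \<xi> \<eta>
    using S unfolding is_adjoint_def by blast
  obtain D where D: "D \<ge> 0" "\<And>\<xi>. \<xi> \<in> l2 \<Longrightarrow> l2norm (T \<xi>) \<le> D * l2norm \<xi>"
    by (rule bounded_op_boundE[OF T]) blast
  have ev: "S \<xi> x = l2inner (T (delta x)) \<xi>" if "\<xi> \<in> l2" for \<xi> x
    using S2[OF delta_l2 that, of x] by simp
  show ?thesis
  proof (rule bounded_opI)
    fix \<xi> :: "'a vec" assume \<xi>: "\<xi> \<in> l2"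
    show "S \<xi> \<in> l2" by (rule S1[OF \<xi>])
    show "l2norm (S \<xi>) \<le> D * l2norm \<xi>"
    proof (rule l2norm_le_by_inner[OF S1[OF \<xi>] order_refl])
      fix \<eta> :: "'a vec" assume \<eta>: "\<eta> \<in> l2"
      have "cmod (l2inner \<eta> (S \<xi>)) \<le> l2norm (T \<eta>) * l2norm \<xi>"
        using l2inner_cauchy_schwarz[OF bounded_op_l2[OF T \<eta>] \<xi>] S2[OF \<eta> \<xi>] by simp
      also have "\<dots> \<le> D * l2norm \<eta> * l2norm \<xi>" by (rule mult_right_mono[OF D(2)[OF \<eta>]]) simp
      finally show "cmod (l2inner \<eta> (S \<xi>)) \<le> D * l2norm \<xi> * l2norm \<eta>" by (simp add: mult_ac)
    next
      fix \<zeta> :: "'a vec" and \<epsilon> :: real assume "\<zeta> \<in> l2" "\<epsilon> > 0"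
      then show "\<exists>\<eta>\<in>l2. l2norm (\<lambda>x. \<zeta> x - \<eta> x) < \<epsilon>" by (intro bexI[of _ \<zeta>]) auto
    qed (use D(1) in simp)
  next
    fix \<xi> \<eta> :: "'a vec" and c assume a: "\<xi> \<in> l2" "\<eta> \<in> l2"
    have "S (\<lambda>x. \<xi> x + c * \<eta> x) z = S \<xi> z + c * S \<eta> z" for z
      unfolding ev[OF a(1)] ev[OF a(2)] ev[OF l2_lin[OF a]]
      by (subst l2inner_add_right) (simp_all add: a bounded_op_l2[OF T] l2_scale l2inner_scale_right)
    then show "S (\<lambda>x. \<xi> x + c * \<eta> x) = (\<lambda>x. S \<xi> x + c * S \<eta> x)" by (rule ext)
  qed
qed

section \<open>Propagation and the uniform Roe algebra\<close>

definition band :: "('a::metric_space) op \<Rightarrow> real \<Rightarrow> bool" where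
  "band T r \<longleftrightarrow> (\<forall>x y. dist x y > r \<longrightarrow> T (delta y) x = 0)"

lemma roe_star_alg_bounded: "S \<in> roe_star_alg \<Longrightarrow> bounded_op S"
proof (induction rule: roe_star_alg.induct)
  case (gen A f)
  then show ?case by (intro vop_bounded) (simp add: partial_translation_def)
next
  case (star T S)
  from adjoint_bounded[OF star.IH star.hyps(2)] show ?case .
next
  case (add S T)
  from bounded_op_add[OF add.IH] show ?case .
next
  case (smult T c)
  from bounded_op_smult[OF smult.IH] show ?case .
next
  case (comp S T)
  from bounded_op_comp[OF comp.IH] show ?case .
qed

lemma ulf_finite_cball:
  assumes "uniformly_locally_finite TYPE('a::metric_space)"
  shows "finite (cball (x::'a) r)"
proof -
  have "finite (cball x (max r 1))"
    using assms unfolding uniformly_locally_finite_def by (meson less_max_iff_disj zero_less_one)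
  then show ?thesis by (rule rev_finite_subset) auto
qed

lemma roe_star_alg_band:
  assumes ulf: "uniformly_locally_finite TYPE('a::metric_space)"
  shows "S \<in> roe_star_alg \<Longrightarrow> \<exists>r. band (S :: 'a op) r"
proof (induction rule: roe_star_alg.induct)
  case (gen A f)
  then obtain r where f: "inj_on f A" "\<And>x. x \<in> A \<Longrightarrow> dist x (f x) \<le> r"
    unfolding partial_translation_def by blast
  have "band (vop A f) r"
    unfolding band_def vop_delta[OF f(1)] using f(2) by (auto simp: dist_commute not_less)
  then show ?case by blast
next
  case (add S T)
  then obtain r s where "band S r" "band T s" by blast
  then have "band (\<lambda>\<xi> x. S \<xi> x + T \<xi> x) (max r s)" unfolding band_def by auto
  then show ?case by blast
next
  case (smult T c)
  then obtain s where "band T s" by blast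
  then have "band (\<lambda>\<xi> x. c * T \<xi> x) s" unfolding band_def by auto
  then show ?case by blast
next
  case (comp S T)
  then obtain r s where rs: "band S r" "band T s" by blast
  have S: "bounded_op S" using comp.hyps by (simp add: roe_star_alg_bounded)
  have "band (S \<circ> T) (r + s)"
    unfolding band_def
  proof (intro allI impI)
    fix x y :: 'a assume d: "dist x y > r + s"
    let ?F = "cball y s"
    have F: "finite ?F" by (rule ulf_finite_cball[OF ulf])
    \<comment> \<open>Column \<open>y\<close> of \<open>T\<close> lives in a ball that is finite by
      local finiteness, so an entry of the product is a finite sum; a nonzero summand needs
      \<open>z\<close> within \<open>s\<close> of \<open>y\<close> and within \<open>r\<close> of
      \<open>x\<close>.\<close>
    have "cut ?F (T (delta y)) = T (delta y)"
    proof
      fix z show "cut ?F (T (delta y)) z = T (delta y) z"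
        using rs(2) unfolding band_def cut_def by (auto simp: dist_commute not_le)
    qed
    then have "(S \<circ> T) (delta y) x = (\<Sum>z\<in>?F. S (delta z) x * T (delta y) z)"
      using bounded_op_sum_delta[OF S F, of "T (delta y)"] by simp
    also have "\<dots> = 0"
    proof (rule sum.neutral, rule ballI)
      fix z assume "z \<in> cball y s"
      then have "dist x z > r" using d dist_triangle[of x y z] by (simp add: dist_commute)
      then show "S (delta z) x * T (delta y) z = 0" using rs(1) unfolding band_def by simp
    qed
    finally show "(S \<circ> T) (delta y) x = 0" .
  qed
  then show ?case by blast
next
  case (star T S)
  then obtain r where r: "band T r" by blast
  have "S (delta y) x = cnj (T (delta x) y)" for x y
    using star.hyps(2) unfolding is_adjoint_def
    by (metis delta_l2 l2inner_delta_left l2inner_delta_right)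
  then have "band S r" using r unfolding band_def by (simp add: dist_commute)
  then show ?case by blast
qed

lemma uniform_roeI:
  assumes T: "bounded_op T"
    and a: "\<And>\<epsilon>. \<epsilon> > 0 \<Longrightarrow> \<exists>S\<in>roe_star_alg. \<forall>\<xi>\<in>l2. l2norm (\<lambda>x. T \<xi> x - S \<xi> x) \<le> \<epsilon> * l2norm \<xi>"
  shows "T \<in> uniform_roe"
proof -
  have "\<exists>S\<in>roe_star_alg. opnorm (\<lambda>\<xi> x. T \<xi> x - S \<xi> x) \<le> \<epsilon>" if e: "\<epsilon> > 0" for \<epsilon>
  proof -
    obtain S where S: "S \<in> roe_star_alg" "\<And>\<xi>. \<xi> \<in> l2 \<Longrightarrow> l2norm (\<lambda>x. T \<xi> x - S \<xi> x) \<le> \<epsilon> * l2norm \<xi>"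
      using a[OF e] by blast
    have "opnorm (\<lambda>\<xi> x. T \<xi> x - S \<xi> x) \<le> \<epsilon>" using S(2) e by (intro opnorm_leI) auto
    with S(1) show ?thesis by blast
  qed
  then show ?thesis using T unfolding uniform_roe_def by blast
qed

lemma uniform_roe_bounded: "T \<in> uniform_roe \<Longrightarrow> bounded_op T"
  unfolding uniform_roe_def by blast

lemma uniform_roe_approx:
  assumes "T \<in> uniform_roe" "\<epsilon> > 0"
  obtains S where "S \<in> roe_star_alg" "\<And>\<xi>. \<xi> \<in> l2 \<Longrightarrow> l2norm (\<lambda>x. T \<xi> x - S \<xi> x) \<le> \<epsilon> * l2norm \<xi>"
proof -
  obtain S where S: "S \<in> roe_star_alg" "opnorm (\<lambda>\<xi> x. T \<xi> x - S \<xi> x) \<le> \<epsilon>"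
    using assms unfolding uniform_roe_def by blast
  have "l2norm (\<lambda>x. T \<xi> x - S \<xi> x) \<le> \<epsilon> * l2norm \<xi>" if "\<xi> \<in> l2" for \<xi>
    by (rule order_trans[OF opnorm_bound[OF bounded_op_sub[OF uniform_roe_bounded[OF assms(1)]
        roe_star_alg_bounded[OF S(1)]] that] mult_right_mono[OF S(2)]]) simp
  with S(1) show ?thesis using that by blast
qed

lemma vop_uniform_roe: "vop A id \<in> uniform_roe"
proof (rule uniform_roeI)
  show "bounded_op (vop A id)" by (rule vop_bounded) simp
  fix \<epsilon> :: real assume "\<epsilon> > 0"
  then show "\<exists>S\<in>roe_star_alg. \<forall>\<xi>\<in>l2. l2norm (\<lambda>x. vop A id \<xi> x - S \<xi> x) \<le> \<epsilon> * l2norm \<xi>"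
    by (intro bexI[of _ "vop A id"] roe_star_alg.gen partial_translation_id) simp
qed

lemma uniform_roe_comp:
  assumes S: "S \<in> uniform_roe" and T: "T \<in> uniform_roe"
  shows "S \<circ> T \<in> uniform_roe"
proof (rule uniform_roeI)
  note bS = uniform_roe_bounded[OF S] and bT = uniform_roe_bounded[OF T]
  show "bounded_op (S \<circ> T)" by (rule bounded_op_comp[OF bS bT])
  fix \<epsilon> :: real assume e: "\<epsilon> > 0"
  obtain C where C: "C \<ge> 0" "\<And>\<xi>. \<xi> \<in> l2 \<Longrightarrow> l2norm (S \<xi>) \<le> C * l2norm \<xi>"
    by (rule bounded_op_boundE[OF bS]) blast
  obtain D where D: "D \<ge> 0" "\<And>\<xi>. \<xi> \<in> l2 \<Longrightarrow> l2norm (T \<xi>) \<le> D * l2norm \<xi>"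
    by (rule bounded_op_boundE[OF bT]) blast
  \<comment> \<open>From S T - S' T' = S (T - T') + (S - S') T': the cap 1 gives \<open>T'\<close>
    the bound \<open>D + 1\<close>, so the two terms cost \<open>C * d\<close> and
    \<open>d * (D + 1)\<close>, together at most \<epsilon>.\<close>
  define d where "d = min 1 (\<epsilon> / (C + D + 1))"
  have p: "C + D + 1 > 0" using C(1) D(1) by linarith
  have d: "d > 0" "d \<le> 1" using e p by (auto simp: d_def)
  have "d \<le> \<epsilon> / (C + D + 1)" by (simp add: d_def)
  then have d3: "d * (C + D + 1) \<le> \<epsilon>" using p by (simp add: pos_le_divide_eq)
  obtain S' where S': "S' \<in> roe_star_alg" "\<And>\<xi>. \<xi> \<in> l2 \<Longrightarrow> l2norm (\<lambda>x. S \<xi> x - S' \<xi> x) \<le> d * l2norm \<xi>"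
    by (rule uniform_roe_approx[OF S d(1)]) blast
  obtain T' where T': "T' \<in> roe_star_alg" "\<And>\<xi>. \<xi> \<in> l2 \<Longrightarrow> l2norm (\<lambda>x. T \<xi> x - T' \<xi> x) \<le> d * l2norm \<xi>"
    by (rule uniform_roe_approx[OF T d(1)]) blast
  note bS' = roe_star_alg_bounded[OF S'(1)] and bT' = roe_star_alg_bounded[OF T'(1)]
  have "l2norm (\<lambda>x. (S \<circ> T) \<xi> x - (S' \<circ> T') \<xi> x) \<le> \<epsilon> * l2norm \<xi>" if \<xi>: "\<xi> \<in> l2" for \<xi>
  proof -
    note l = bounded_op_l2[OF bT \<xi>] bounded_op_l2[OF bT' \<xi>]
    let ?\<eta> = "\<lambda>x. T \<xi> x - T' \<xi> x"
    have \<eta>: "?\<eta> \<in> l2" by (rule l2_diff[OF l])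
    have S\<eta>: "S ?\<eta> = (\<lambda>x. S (T \<xi>) x - S (T' \<xi>) x)" by (rule bounded_op_diff[OF bS l])
    have e1: "(\<lambda>x. (S \<circ> T) \<xi> x - (S' \<circ> T') \<xi> x) = (\<lambda>x. S ?\<eta> x + (S (T' \<xi>) x - S' (T' \<xi>) x))"
      unfolding S\<eta> by (rule ext) simp
    have 1: "l2norm (S ?\<eta>) \<le> C * (d * l2norm \<xi>)"
      by (rule order_trans[OF C(2)[OF \<eta>] mult_left_mono[OF T'(2)[OF \<xi>] C(1)]])
    have "l2norm (T' \<xi>) \<le> l2norm (\<lambda>x. T' \<xi> x - T \<xi> x) + l2norm (T \<xi>)"
      by (rule l2norm_triangle_sub[OF l(2,1)])
    also have "\<dots> \<le> d * l2norm \<xi> + D * l2norm \<xi>"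
      using T'(2)[OF \<xi>] D(2)[OF \<xi>] l2norm_minus_commute[of "T' \<xi>" "T \<xi>"] by linarith
    also have "\<dots> \<le> (D + 1) * l2norm \<xi>"
      using mult_right_mono[OF d(2), of "l2norm \<xi>"] by (simp add: distrib_right)
    finally have 2: "l2norm (\<lambda>x. S (T' \<xi>) x - S' (T' \<xi>) x) \<le> d * ((D + 1) * l2norm \<xi>)"
      by (rule order_trans[OF S'(2)[OF l(2)] mult_left_mono]) (use d(1) in simp)
    have "l2norm (\<lambda>x. (S \<circ> T) \<xi> x - (S' \<circ> T') \<xi> x) \<le> C * (d * l2norm \<xi>) + d * ((D + 1) * l2norm \<xi>)"
      unfolding e1
      by (rule order_trans[OF l2norm_triangle[OF bounded_op_l2[OF bS \<eta>]
          l2_diff[OF bounded_op_l2[OF bS l(2)] bounded_op_l2[OF bS' l(2)]]] add_mono[OF 1 2]])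
    also have "\<dots> = (d * (C + D + 1)) * l2norm \<xi>" by (simp add: algebra_simps)
    also have "\<dots> \<le> \<epsilon> * l2norm \<xi>" by (rule mult_right_mono[OF d3]) simp
    finally show ?thesis .
  qed
  then show "\<exists>R\<in>roe_star_alg. \<forall>\<xi>\<in>l2. l2norm (\<lambda>x. (S \<circ> T) \<xi> x - R \<xi> x) \<le> \<epsilon> * l2norm \<xi>"
    using roe_star_alg.comp[OF S'(1) T'(1)] by blast
qed

subsection \<open>Schur's lemma for families of absolutely summable functions\<close>

text \<open>One of the two sign classes carries at least half of the total mass.\<close>

lemma real_sum_abs_le_subset_sum:
  fixes a :: "'b \<Rightarrow> real"
  assumes "finite G"
  shows "\<exists>F\<subseteq>G. (\<Sum>x\<in>G. \<bar>a x\<bar>) \<le> 2 * \<bar>sum a F\<bar>"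
proof -
  let ?P = "{x\<in>G. a x \<ge> 0}" let ?N = "{x\<in>G. \<not> a x \<ge> 0}"
  have G: "?P \<union> ?N = G" by auto
  have "(\<Sum>x\<in>G. \<bar>a x\<bar>) = (\<Sum>x\<in>?P \<union> ?N. \<bar>a x\<bar>)" by (simp only: G)
  also have "\<dots> = (\<Sum>x\<in>?P. \<bar>a x\<bar>) + (\<Sum>x\<in>?N. \<bar>a x\<bar>)"
    using assms by (intro sum.union_disjoint) auto
  also have "(\<Sum>x\<in>?P. \<bar>a x\<bar>) = sum a ?P" by (intro sum.cong) auto
  also have "(\<Sum>x\<in>?N. \<bar>a x\<bar>) = (\<Sum>x\<in>?N. - a x)" by (intro sum.cong) auto
  also have "\<dots> = - sum a ?N" by (rule sum_negf)
  finally have "(\<Sum>x\<in>G. \<bar>a x\<bar>) \<le> 2 * \<bar>sum a ?P\<bar> \<or> (\<Sum>x\<in>G. \<bar>a x\<bar>) \<le> 2 * \<bar>sum a ?N\<bar>"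
    by linarith
  moreover have "?P \<subseteq> G" "?N \<subseteq> G" by auto
  ultimately show ?thesis by blast
qed

text \<open>Real and imaginary parts each contribute a factor 2, and the better of the two subsets
  serves for both, whence 4.\<close>

lemma sum_cmod_le_subset_sum:
  fixes a :: "'b \<Rightarrow> complex"
  assumes "finite G"
  shows "\<exists>F\<subseteq>G. (\<Sum>x\<in>G. cmod (a x)) \<le> 4 * cmod (sum a F)"
proof -
  obtain P where P: "P \<subseteq> G" "(\<Sum>x\<in>G. \<bar>Re (a x)\<bar>) \<le> 2 * \<bar>sum (\<lambda>x. Re (a x)) P\<bar>"
    using real_sum_abs_le_subset_sum[OF assms, of "\<lambda>x. Re (a x)"] by blast
  obtain N where N: "N \<subseteq> G" "(\<Sum>x\<in>G. \<bar>Im (a x)\<bar>) \<le> 2 * \<bar>sum (\<lambda>x. Im (a x)) N\<bar>"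
    using real_sum_abs_le_subset_sum[OF assms, of "\<lambda>x. Im (a x)"] by blast
  have "(\<Sum>x\<in>G. cmod (a x)) \<le> (\<Sum>x\<in>G. \<bar>Re (a x)\<bar> + \<bar>Im (a x)\<bar>)"
    by (intro sum_mono cmod_le)
  also have "\<dots> \<le> 2 * \<bar>Re (sum a P)\<bar> + 2 * \<bar>Im (sum a N)\<bar>"
    using P(2) N(2) by (simp add: sum.distrib)
  also have "\<dots> \<le> 2 * cmod (sum a P) + 2 * cmod (sum a N)"
    using abs_Re_le_cmod[of "sum a P"] abs_Im_le_cmod[of "sum a N"] by linarith
  finally have "(\<Sum>x\<in>G. cmod (a x)) \<le> 4 * cmod (sum a P) \<or> (\<Sum>x\<in>G. cmod (a x)) \<le> 4 * cmod (sum a N)"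
    by linarith
  with P(1) N(1) show ?thesis by blast
qed

lemma abs_summable_split_finite:
  fixes a :: "'b \<Rightarrow> complex"
  assumes s: "\<And>B. (\<lambda>x. cmod (a x)) summable_on B" and G: "finite G"
  shows "infsum a A = sum a (A \<inter> G) + infsum a (A - G)"
proof -
  have s': "a summable_on B" for B by (rule abs_summable_summable[OF s])
  have "infsum a ((A \<inter> G) \<union> (A - G)) = infsum a (A \<inter> G) + infsum a (A - G)"
    by (intro infsum_Un_disjoint s') auto
  moreover have "(A \<inter> G) \<union> (A - G) = A" by auto
  ultimately show ?thesis using G by simp
qed

text \<open>Gliding hump argument. If the l1 norms did not tend to 0, one could choose increasing
  indices and disjoint finite humps such that each chosen function has a large sum over its own hump
  and little mass both on the earlier window and beyond the new one. On the union of all humps its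
  sums then stay away from 0.\<close>

lemma schur_l1:
  fixes a :: "nat \<Rightarrow> 'b \<Rightarrow> complex"
  assumes s: "\<And>n. (\<lambda>x. cmod (a n x)) summable_on UNIV"
    and lim: "\<And>A. (\<lambda>n. infsum (a n) A) \<longlonglongrightarrow> 0"
  shows "(\<lambda>n. \<Sum>\<^sub>\<infinity>x. cmod (a n x)) \<longlonglongrightarrow> 0"
proof (rule ccontr)
  have sA: "(\<lambda>x. cmod (a n x)) summable_on B" for n B
    by (rule summable_on_subset_banach[OF s]) simp
  have nonneg: "0 \<le> (\<Sum>\<^sub>\<infinity>x\<in>B. cmod (a n x))" for n B
    by (simp add: infsum_nonneg)
  have split: "(\<Sum>\<^sub>\<infinity>x\<in>B. cmod (a n x)) = (\<Sum>x\<in>B \<inter> G. cmod (a n x)) + (\<Sum>\<^sub>\<infinity>x\<in>B - G. cmod (a n x))"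
    if "finite G" for n B G
  proof -
    have "infsum (\<lambda>x. cmod (a n x)) ((B \<inter> G) \<union> (B - G)) =
        infsum (\<lambda>x. cmod (a n x)) (B \<inter> G) + infsum (\<lambda>x. cmod (a n x)) (B - G)"
      by (intro infsum_Un_disjoint sA) auto
    moreover have "(B \<inter> G) \<union> (B - G) = B" by auto
    ultimately show ?thesis using that by simp
  qed
  assume "\<not> ?thesis"
  then obtain e where e: "e > 0" and big: "\<And>N. \<exists>n\<ge>N. (\<Sum>\<^sub>\<infinity>x. cmod (a n x)) \<ge> e"
    using nonneg unfolding LIMSEQ_def dist_real_def by (auto simp: not_less)
  \<comment> \<open>A state is (index, window, hump). Of a total mass of at least \<open>e\<close>,
    the old window and the complement of the new one each hold at most e/16, so at least 7e/8 lies
    between, and passing to a subset with factor 4 leaves the hump a sum of modulus 7e/32.\<close>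
  define Q where "Q = (\<lambda>(n::nat, G, F :: 'b set) (n'::nat, G', F'). n < n' \<and> finite G' \<and> G \<subseteq> G' \<and> F' \<subseteq> G' - G \<and>
     (\<Sum>x\<in>G. cmod (a n' x)) \<le> e/16 \<and> (\<Sum>\<^sub>\<infinity>x\<in>-G'. cmod (a n' x)) \<le> e/16 \<and> 7 * e / 32 \<le> cmod (sum (a n') F'))"
  have step: "\<exists>n' G' F'. n < n' \<and> finite G' \<and> G \<subseteq> G' \<and> F' \<subseteq> G' - G \<and>
     (\<Sum>x\<in>G. cmod (a n' x)) \<le> e/16 \<and> (\<Sum>\<^sub>\<infinity>x\<in>-G'. cmod (a n' x)) \<le> e/16 \<and> 7 * e / 32 \<le> cmod (sum (a n') F')"
    if G: "finite G" for n :: nat and G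
  proof -
    have "(\<lambda>n. \<Sum>x\<in>G. cmod (a n x)) \<longlonglongrightarrow> (\<Sum>x\<in>G. cmod 0)"
    proof (intro tendsto_sum tendsto_norm)
      fix x assume "x \<in> G"
      show "(\<lambda>n. a n x) \<longlonglongrightarrow> 0" using lim[of "{x}"] by simp
    qed
    then have "\<forall>\<^sub>F n in sequentially. (\<Sum>x\<in>G. cmod (a n x)) < e/16"
      using e by (intro order_tendstoD) auto
    then obtain N where N: "\<And>n. n \<ge> N \<Longrightarrow> (\<Sum>x\<in>G. cmod (a n x)) < e/16"
      unfolding eventually_sequentially by metis
    obtain n' where n': "n' \<ge> max N (Suc n)" "(\<Sum>\<^sub>\<infinity>x. cmod (a n' x)) \<ge> e" using big by metis
    have "(sum (\<lambda>x. cmod (a n' x)) \<longlongrightarrow> (\<Sum>\<^sub>\<infinity>x. cmod (a n' x))) (finite_subsets_at_top UNIV)"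
      by (rule infsum_tendsto[OF s])
    then have "\<forall>\<^sub>F G' in finite_subsets_at_top UNIV. sum (\<lambda>x. cmod (a n' x)) G' > (\<Sum>\<^sub>\<infinity>x. cmod (a n' x)) - e/16"
      using e by (intro order_tendstoD(1)) auto
    then obtain H where H: "finite H" "\<And>G'. finite G' \<Longrightarrow> H \<subseteq> G' \<Longrightarrow> sum (\<lambda>x. cmod (a n' x)) G' > (\<Sum>\<^sub>\<infinity>x. cmod (a n' x)) - e/16"
      unfolding eventually_finite_subsets_at_top by auto
    define G' where "G' = H \<union> G"
    have G': "finite G'" "G \<subseteq> G'" using H G by (auto simp: G'_def)
    have 1: "sum (\<lambda>x. cmod (a n' x)) G' > (\<Sum>\<^sub>\<infinity>x. cmod (a n' x)) - e/16"
      by (rule H(2)) (use G' in \<open>auto simp: G'_def\<close>)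
    have 2: "(\<Sum>\<^sub>\<infinity>x\<in>-G'. cmod (a n' x)) \<le> e/16"
      using split[OF G'(1), of n' UNIV] 1 by (simp add: Compl_eq_Diff_UNIV)
    obtain F' where F': "F' \<subseteq> G' - G" "(\<Sum>x\<in>G' - G. cmod (a n' x)) \<le> 4 * cmod (sum (a n') F')"
      using sum_cmod_le_subset_sum[of "G' - G" "a n'"] G' by auto
    have "(\<Sum>x\<in>G' - G. cmod (a n' x)) = (\<Sum>x\<in>G'. cmod (a n' x)) - (\<Sum>x\<in>G. cmod (a n' x))"
      using G' by (intro sum_diff) auto
    moreover have "(\<Sum>x\<in>G. cmod (a n' x)) < e/16" using N n'(1) by simp
    ultimately have "7 * e / 32 \<le> cmod (sum (a n') F')" using 1 n'(2) F'(2) by linarith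
    moreover have "n < n'" using n'(1) by simp
    ultimately show ?thesis using G' F'(1) 2 \<open>(\<Sum>x\<in>G. cmod (a n' x)) < e/16\<close> less_imp_le by metis
  qed
  have "\<exists>f. \<forall>k. (finite (fst (snd (f k)))) \<and> Q (f k) (f (Suc k))"
  proof (rule dependent_nat_choice)
    show "\<exists>x :: nat \<times> 'b set \<times> 'b set. finite (fst (snd x))"
      by (rule exI[of _ "(0,{},{})"]) simp
  next
    fix x :: "nat \<times> 'b set \<times> 'b set" and k :: nat
    assume x: "finite (fst (snd x))"
    obtain n G F where xe: "x = (n, G, F)" by (metis prod_cases3)
    obtain n' G' F' where *: "n < n' \<and> finite G' \<and> G \<subseteq> G' \<and> F' \<subseteq> G' - G \<and>
     (\<Sum>x\<in>G. cmod (a n' x)) \<le> e/16 \<and> (\<Sum>\<^sub>\<infinity>x\<in>-G'. cmod (a n' x)) \<le> e/16 \<and> 7 * e / 32 \<le> cmod (sum (a n') F')"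
      using step[of G n] x xe by auto
    show "\<exists>y. finite (fst (snd y)) \<and> Q x y"
      by (rule exI[of _ "(n', G', F')"]) (use * in \<open>simp add: Q_def xe\<close>)
  qed
  then obtain f where f: "\<And>k. finite (fst (snd (f k)))" "\<And>k. Q (f k) (f (Suc k))" by blast
  define N where "N k = fst (f k)" for k
  define G where "G k = fst (snd (f k))" for k
  define F where "F k = snd (snd (f k))" for k
  have fk: "f k = (N k, G k, F k)" for k by (simp add: N_def G_def F_def)
  have q: "N k < N (Suc k)" "finite (G k)" "G k \<subseteq> G (Suc k)" "F (Suc k) \<subseteq> G (Suc k) - G k"
     "(\<Sum>x\<in>G k. cmod (a (N (Suc k)) x)) \<le> e/16" "(\<Sum>\<^sub>\<infinity>x\<in>-G (Suc k). cmod (a (N (Suc k)) x)) \<le> e/16"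
     "7 * e / 32 \<le> cmod (sum (a (N (Suc k))) (F (Suc k)))" for k
    using f(2)[of k] f(1)[of k] unfolding fk Q_def by auto
  have mono: "i \<le> j \<Longrightarrow> G i \<subseteq> G j" for i j using q(3) by (rule lift_Suc_mono_le)
  have sm: "strict_mono N" using q(1) by (simp add: strict_mono_Suc_iff)
  \<comment> \<open>At index \<open>N (Suc k)\<close> the shell between the two windows meets this
    set exactly in the hump; the remaining parts contribute at most e/16 each, leaving 7e/32 - 4e/32
    = 3e/32 for every \<open>k\<close>.\<close>
  define A where "A = (\<Union>k. F (Suc k))"
  have AF: "A \<inter> (G (Suc k) - G k) = F (Suc k)" for k
  proof
    show "F (Suc k) \<subseteq> A \<inter> (G (Suc k) - G k)" using q(4) unfolding A_def by auto
    show "A \<inter> (G (Suc k) - G k) \<subseteq> F (Suc k)"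
    proof
      fix x assume x: "x \<in> A \<inter> (G (Suc k) - G k)"
      then obtain j where j: "x \<in> F (Suc j)" unfolding A_def by auto
      then have jG: "x \<in> G (Suc j)" "x \<notin> G j" using q(4) by auto
      have "j = k"
      proof (rule ccontr)
        assume "j \<noteq> k"
        then consider "Suc j \<le> k" | "Suc k \<le> j" by linarith
        then show False
        proof cases
          case 1 then show False using mono[OF 1] jG x by auto
        next
          case 2 then show False using mono[OF 2] jG x by auto
        qed
      qed
      with j show "x \<in> F (Suc k)" by simp
    qed
  qed
  have low: "3 * e / 32 \<le> cmod (infsum (a (N (Suc k))) A)" for k
  proof -
    let ?a = "a (N (Suc k))"
    have 1: "infsum ?a A = sum ?a (A \<inter> G (Suc k)) + infsum ?a (A - G (Suc k))"
      by (rule abs_summable_split_finite[OF sA q(2)])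
    have "sum ?a (A \<inter> G (Suc k)) = sum ?a ((A \<inter> G k) \<union> F (Suc k))"
      using AF[of k] q(3)[of k] by (intro sum.cong) auto
    also have "\<dots> = sum ?a (A \<inter> G k) + sum ?a (F (Suc k))"
      using q(4)[of k] q(2) by (intro sum.union_disjoint) (auto intro: finite_subset[of _ "G (Suc k)"])
    finally have 2: "infsum ?a A = sum ?a (A \<inter> G k) + sum ?a (F (Suc k)) + infsum ?a (A - G (Suc k))"
      using 1 by simp
    have 3: "cmod (sum ?a (A \<inter> G k)) \<le> e/16"
      by (rule order_trans[OF sum_norm_le[OF order_refl] order_trans[OF sum_mono2 q(5)]]) (use q(2) in auto)
    have 4: "cmod (infsum ?a (A - G (Suc k))) \<le> e/16"
      by (rule order_trans[OF norm_infsum_bound[OF sA] order_trans[OF infsum_mono2[OF sA sA] q(6)]]) auto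
    have "cmod (sum ?a (F (Suc k))) \<le> cmod (infsum ?a A) + cmod (sum ?a (A \<inter> G k)) + cmod (infsum ?a (A - G (Suc k)))"
    proof -
      have "sum ?a (F (Suc k)) = infsum ?a A - sum ?a (A \<inter> G k) - infsum ?a (A - G (Suc k))"
        using 2 by simp
      then show ?thesis by (metis norm_triangle_ineq4 order_trans add_right_mono)
    qed
    then show ?thesis using 3 4 q(7)[of k] by linarith
  qed
  have "\<forall>\<^sub>F n in sequentially. cmod (infsum (a n) A) < 3 * e / 32"
    using tendsto_norm_zero[OF lim[of A]] e by (intro order_tendstoD(2)) auto
  then obtain M where "\<And>n. n \<ge> M \<Longrightarrow> cmod (infsum (a n) A) < 3 * e / 32"
    unfolding eventually_sequentially by metis
  moreover have "N (Suc M) \<ge> M" using seq_suble[OF sm, of "Suc M"] by simp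
  ultimately show False using low[of M] by (meson not_le)
qed

text \<open>Reduction to a sequence: at each \<open>n\<close> select a member that violates the
  bound, if there is one, and the zero function otherwise. The hypothesis \<open>lim\<close> makes
  the selected functions converge to 0 on every subset, so by \<open>schur_l1\<close> violations
  occur at only finitely many \<open>n\<close>.\<close>

lemma schur_l1_uniform:
  fixes Q :: "nat \<Rightarrow> ('b \<Rightarrow> complex) set"
  assumes s: "\<And>n a. a \<in> Q n \<Longrightarrow> (\<lambda>x. cmod (a x)) summable_on UNIV"
    and lim: "\<And>A e. e > 0 \<Longrightarrow> \<forall>\<^sub>F n in sequentially. \<forall>a\<in>Q n. cmod (infsum a A) \<le> e"
    and e: "e > 0"
  shows "\<forall>\<^sub>F n in sequentially. \<forall>a\<in>Q n. (\<Sum>\<^sub>\<infinity>x. cmod (a x)) \<le> e"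
proof -
  define P where "P n a \<longleftrightarrow> a \<in> Q n \<and> \<not> (\<Sum>\<^sub>\<infinity>x. cmod (a x)) \<le> e" for n a
  define b where "b n = (if \<exists>a. P n a then SOME a. P n a else (\<lambda>_. 0))" for n
  have b1: "P n (b n)" if "P n a" for n a
    using that someI[of "P n" a] unfolding b_def by auto
  have b2: "b n \<in> Q n \<or> b n = (\<lambda>_. 0)" for n
  proof (cases "\<exists>a. P n a")
    case True
    then show ?thesis using b1 unfolding P_def by blast
  qed (simp add: b_def)
  have "(\<lambda>n. \<Sum>\<^sub>\<infinity>x. cmod (b n x)) \<longlonglongrightarrow> 0"
  proof (rule schur_l1)
    show "(\<lambda>x. cmod (b n x)) summable_on UNIV" for n
      using b2[of n] s[of "b n" n] by auto
    show "(\<lambda>n. infsum (b n) A) \<longlonglongrightarrow> 0" for A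
    proof (rule LIMSEQ_I)
      fix r :: real assume r: "r > 0"
      have "\<forall>\<^sub>F n in sequentially. \<forall>a\<in>Q n. cmod (infsum a A) \<le> r/2" using lim[of "r/2" A] r by simp
      then obtain M where M: "\<And>n a. n \<ge> M \<Longrightarrow> a \<in> Q n \<Longrightarrow> cmod (infsum a A) \<le> r/2"
        unfolding eventually_sequentially by metis
      have "cmod (infsum (b n) A - 0) < r" if n: "n \<ge> M" for n
        using b2[of n]
      proof
        assume "b n \<in> Q n"
        from M[OF n this] r show ?thesis by simp
      next
        assume "b n = (\<lambda>_. 0)"
        with r show ?thesis by simp
      qed
      then show "\<exists>no. \<forall>n\<ge>no. norm (infsum (b n) A - 0) < r" by blast
    qed
  qed
  then have "\<forall>\<^sub>F n in sequentially. (\<Sum>\<^sub>\<infinity>x. cmod (b n x)) < e"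
    using e by (rule order_tendstoD(2))
  then show ?thesis
  proof (rule eventually_mono)
    fix n assume n: "(\<Sum>\<^sub>\<infinity>x. cmod (b n x)) < e"
    show "\<forall>a\<in>Q n. (\<Sum>\<^sub>\<infinity>x. cmod (a x)) \<le> e"
    proof (rule ccontr)
      assume "\<not> ?thesis"
      then obtain a where "P n a" unfolding P_def by auto
      from b1[OF this] n show False unfolding P_def by simp
    qed
  qed
qed

text \<open>Scaling by 1/(n+1) turns boundedness on each subset into convergence to 0 there,
  uniformly over the family. The uniform Schur lemma then supplies one \<open>n\<close> at which all
  scaled l1 norms are at most 1, so n + 1 bounds the original ones.\<close>

lemma nikodym_boundedness:
  fixes Q :: "('b \<Rightarrow> complex) set"
  assumes s: "\<And>a. a \<in> Q \<Longrightarrow> (\<lambda>x. cmod (a x)) summable_on UNIV"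
    and b: "\<And>A. \<exists>C. \<forall>a\<in>Q. cmod (infsum a A) \<le> C"
  shows "\<exists>C. \<forall>a\<in>Q. (\<Sum>\<^sub>\<infinity>x. cmod (a x)) \<le> C"
proof -
  let ?s = "\<lambda>n::nat. complex_of_real (inverse (real (Suc n)))"
  define R where "R n = (\<lambda>a x. ?s n * a x) ` Q" for n
  have cs: "cmod (?s n) = inverse (real (Suc n))" for n by (simp only: norm_of_real) simp
  have "\<forall>\<^sub>F n in sequentially. \<forall>a\<in>R n. (\<Sum>\<^sub>\<infinity>x. cmod (a x)) \<le> 1"
  proof (rule schur_l1_uniform)
    fix n a assume "a \<in> R n"
    then obtain c where c: "c \<in> Q" "a = (\<lambda>x. ?s n * c x)" unfolding R_def by blast
    show "(\<lambda>x. cmod (a x)) summable_on UNIV"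
      unfolding c(2) norm_mult by (rule summable_on_cmult_right[OF s[OF c(1)]])
  next
    fix A and e :: real assume e: "e > 0"
    obtain C where C: "\<And>a. a \<in> Q \<Longrightarrow> cmod (infsum a A) \<le> C" using b[of A] by blast
    have "(\<lambda>n. inverse (real (Suc n)) * C) \<longlonglongrightarrow> 0 * C"
      by (intro tendsto_mult LIMSEQ_inverse_real_of_nat tendsto_const)
    then have "\<forall>\<^sub>F n in sequentially. inverse (real (Suc n)) * C < e"
      using e by (intro order_tendstoD(2)) auto
    then show "\<forall>\<^sub>F n in sequentially. \<forall>a\<in>R n. cmod (infsum a A) \<le> e"
    proof (rule eventually_mono, intro ballI)
      fix n a assume n: "inverse (real (Suc n)) * C < e" and "a \<in> R n"
      then obtain c where c: "c \<in> Q" "a = (\<lambda>x. ?s n * c x)" unfolding R_def by blast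
      have "cmod (infsum a A) = inverse (real (Suc n)) * cmod (infsum c A)"
        unfolding c(2) infsum_cmult_right' norm_mult cs by (rule refl)
      also have "\<dots> \<le> inverse (real (Suc n)) * C" using C[OF c(1)] by (intro mult_left_mono) auto
      finally show "cmod (infsum a A) \<le> e" using n by linarith
    qed
  qed simp
  then obtain n where n: "\<And>a. a \<in> R n \<Longrightarrow> (\<Sum>\<^sub>\<infinity>x. cmod (a x)) \<le> 1"
    unfolding eventually_sequentially by blast
  have "(\<Sum>\<^sub>\<infinity>x. cmod (a x)) \<le> real (Suc n)" if "a \<in> Q" for a
  proof -
    have "(\<Sum>\<^sub>\<infinity>x. cmod (?s n * a x)) \<le> 1" by (rule n) (use that in \<open>auto simp: R_def\<close>)
    then have "inverse (real (Suc n)) * (\<Sum>\<^sub>\<infinity>x. cmod (a x)) \<le> 1"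
      unfolding norm_mult cs infsum_cmult_right' .
    then show ?thesis by (simp add: field_simps)
  qed
  then show ?thesis by blast
qed

subsection \<open>Form bounds for matrices\<close>

text \<open>The operator norm bound of a matrix, tested on finite sections. Schur products with a
  kernel are matrices not yet known to come from operators, so norm estimates are made at this
  level.\<close>

definition mbound :: "('a \<Rightarrow> 'a \<Rightarrow> complex) \<Rightarrow> real \<Rightarrow> bool" where
  "mbound t C \<longleftrightarrow> (\<forall>F \<zeta> \<eta>. finite F \<longrightarrow>
     cmod (\<Sum>x\<in>F. \<Sum>y\<in>F. cnj (\<zeta> x) * t x y * \<eta> y)
       \<le> C * (L2_set (\<lambda>x. cmod (\<zeta> x)) F * L2_set (\<lambda>x. cmod (\<eta> x)) F))"

lemma mboundD:
  "mbound t C \<Longrightarrow> finite F \<Longrightarrow>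
     cmod (\<Sum>x\<in>F. \<Sum>y\<in>F. cnj (\<zeta> x) * t x y * \<eta> y)
       \<le> C * (L2_set (\<lambda>x. cmod (\<zeta> x)) F * L2_set (\<lambda>x. cmod (\<eta> x)) F)"
  unfolding mbound_def by blast

lemma mboundI:
  "(\<And>F \<zeta> \<eta>. finite F \<Longrightarrow> cmod (\<Sum>x\<in>F. \<Sum>y\<in>F. cnj (\<zeta> x) * t x y * \<eta> y)
       \<le> C * (L2_set (\<lambda>x. cmod (\<zeta> x)) F * L2_set (\<lambda>x. cmod (\<eta> x)) F)) \<Longrightarrow> mbound t C"
  unfolding mbound_def by blast

lemma mbound_mono:
  assumes "mbound t C" "C \<le> D"
  shows "mbound t D"
proof (rule mboundI)
  fix F :: "'a set" and \<zeta> \<eta> assume F: "finite F"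
  show "cmod (\<Sum>x\<in>F. \<Sum>y\<in>F. cnj (\<zeta> x) * t x y * \<eta> y)
       \<le> D * (L2_set (\<lambda>x. cmod (\<zeta> x)) F * L2_set (\<lambda>x. cmod (\<eta> x)) F)"
    by (rule order_trans[OF mboundD[OF assms(1) F] mult_right_mono[OF assms(2)]]) simp
qed

lemma mbound_diff:
  assumes "mbound t C" "mbound s D"
  shows "mbound (\<lambda>x y. t x y - s x y) (C + D)"
proof (rule mboundI)
  fix F :: "'a set" and \<zeta> \<eta> assume F: "finite F"
  have e: "(\<Sum>x\<in>F. \<Sum>y\<in>F. cnj (\<zeta> x) * (t x y - s x y) * \<eta> y) =
      (\<Sum>x\<in>F. \<Sum>y\<in>F. cnj (\<zeta> x) * t x y * \<eta> y) - (\<Sum>x\<in>F. \<Sum>y\<in>F. cnj (\<zeta> x) * s x y * \<eta> y)"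
    by (simp add: sum_subtractf algebra_simps)
  show "cmod (\<Sum>x\<in>F. \<Sum>y\<in>F. cnj (\<zeta> x) * (t x y - s x y) * \<eta> y)
       \<le> (C + D) * (L2_set (\<lambda>x. cmod (\<zeta> x)) F * L2_set (\<lambda>x. cmod (\<eta> x)) F)"
    unfolding e distrib_right
    by (rule order_trans[OF norm_triangle_ineq4 add_mono[OF mboundD[OF assms(1) F] mboundD[OF assms(2) F]]])
qed

lemma mbound_add:
  assumes "mbound t C" "mbound s D"
  shows "mbound (\<lambda>x y. t x y + s x y) (C + D)"
proof -
  have "mbound (\<lambda>x y. 0 - s x y) (0 + D)"
    by (rule mbound_diff[OF _ assms(2)]) (simp add: mbound_def)
  from mbound_diff[OF assms(1) this] show ?thesis by simp
qed

lemma mbound_of_op: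
  assumes T: "bounded_op T" and b: "\<And>\<xi>. \<xi> \<in> l2 \<Longrightarrow> l2norm (T \<xi>) \<le> C * l2norm \<xi>"
  shows "mbound (\<lambda>x y. T (delta y) x) C"
proof (rule mboundI)
  fix F :: "'a set" and \<zeta> \<eta> :: "'a vec" assume F: "finite F"
  have l: "cut F \<xi> \<in> l2" for \<xi> :: "'a vec" by (rule subsetD[OF c00_subset_l2 cut_c00[OF F]])
  have "(\<Sum>x\<in>F. \<Sum>y\<in>F. cnj (\<zeta> x) * T (delta y) x * \<eta> y) = (\<Sum>x\<in>F. cnj (\<zeta> x) * T (cut F \<eta>) x)"
    unfolding bounded_op_sum_delta[OF T F] by (simp add: sum_distrib_left mult.assoc)
  also have "\<dots> = l2inner (cut F \<zeta>) (T (cut F \<eta>))"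
    unfolding l2inner_cut using F by simp
  finally have "cmod (\<Sum>x\<in>F. \<Sum>y\<in>F. cnj (\<zeta> x) * T (delta y) x * \<eta> y) \<le> l2norm (cut F \<zeta>) * l2norm (T (cut F \<eta>))"
    using l2inner_cauchy_schwarz[OF l bounded_op_l2[OF T l]] by simp
  also have "\<dots> \<le> l2norm (cut F \<zeta>) * (C * l2norm (cut F \<eta>))"
    by (rule mult_left_mono[OF b[OF l]]) simp
  finally show "cmod (\<Sum>x\<in>F. \<Sum>y\<in>F. cnj (\<zeta> x) * T (delta y) x * \<eta> y)
       \<le> C * (L2_set (\<lambda>x. cmod (\<zeta> x)) F * L2_set (\<lambda>x. cmod (\<eta> x)) F)"
    unfolding l2norm_cut_finite[OF F] by (simp add: mult_ac)
qed

lemma c00_dense: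
  assumes "\<zeta> \<in> l2" "\<epsilon> > 0"
  shows "\<exists>\<eta>\<in>c00. l2norm (\<lambda>x. \<zeta> x - \<eta> x) < \<epsilon>"
proof -
  have "\<forall>\<^sub>F F in finite_subsets_at_top UNIV. l2norm (\<lambda>x. \<zeta> x - cut F \<zeta> x) < \<epsilon>"
    by (rule order_tendstoD(2)[OF cut_tendsto[OF assms(1)] assms(2)])
  then obtain F where "finite F" "l2norm (\<lambda>x. \<zeta> x - cut F \<zeta> x) < \<epsilon>"
    unfolding eventually_finite_subsets_at_top by blast
  then show ?thesis using cut_c00 by blast
qed

text \<open>Sections control \<open>T\<close> on finitely supported vectors; the a priori
  boundedness of \<open>T\<close> carries the estimate to the limit along finite truncations, where
  the unknown constant \<open>D\<close> only multiplies an error tending to 0.\<close>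

lemma op_of_mbound:
  assumes T: "bounded_op T" and b: "mbound (\<lambda>x y. T (delta y) x) C" and C: "C \<ge> 0" and \<xi>: "\<xi> \<in> l2"
  shows "l2norm (T \<xi>) \<le> C * l2norm \<xi>"
proof -
  have fin: "l2norm (T (cut F \<xi>)) \<le> C * l2norm (cut F \<xi>)" if F: "finite F" for F
  proof (rule l2norm_le_by_inner[OF _ c00_subset_l2 c00_dense])
    have l: "cut F \<xi> \<in> l2" by (rule cut_l2[OF \<xi>])
    show "T (cut F \<xi>) \<in> l2" by (rule bounded_op_l2[OF T l])
    show "0 \<le> C * l2norm (cut F \<xi>)" using C by simp
    fix \<zeta> :: "'a vec" assume \<zeta>: "\<zeta> \<in> c00"
    \<comment> \<open>The section has to contain both supports, since \<open>mbound\<close> uses one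
      finite set for rows and columns.\<close>
    define G where "G = F \<union> {x. \<zeta> x \<noteq> 0}"
    have G: "finite G" using F \<zeta> by (simp add: G_def c00_def)
    have cG: "cut G \<zeta> = \<zeta>" "cut G (cut F \<xi>) = cut F \<xi>" by (auto simp: G_def cut_def intro!: ext)
    have "l2inner (cut G \<zeta>) (T (cut G (cut F \<xi>))) = (\<Sum>x\<in>G. cnj (\<zeta> x) * T (cut G (cut F \<xi>)) x)"
      unfolding l2inner_cut using G by simp
    also have "\<dots> = (\<Sum>x\<in>G. \<Sum>y\<in>G. cnj (\<zeta> x) * T (delta y) x * cut F \<xi> y)"
      unfolding bounded_op_sum_delta[OF T G] by (simp add: sum_distrib_left mult.assoc)
    finally have "cmod (l2inner (cut G \<zeta>) (T (cut G (cut F \<xi>))))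
        \<le> C * (L2_set (\<lambda>x. cmod (\<zeta> x)) G * L2_set (\<lambda>x. cmod (cut F \<xi> x)) G)"
      using mboundD[OF b G] by simp
    also have "\<dots> = C * (l2norm (cut G \<zeta>) * l2norm (cut G (cut F \<xi>)))"
      unfolding l2norm_cut_finite[OF G] by (rule refl)
    finally show "cmod (l2inner \<zeta> (T (cut F \<xi>))) \<le> C * l2norm (cut F \<xi>) * l2norm \<zeta>"
      unfolding cG by (simp add: mult_ac)
  qed
  obtain D where D: "D \<ge> 0" "\<And>\<xi>. \<xi> \<in> l2 \<Longrightarrow> l2norm (T \<xi>) \<le> D * l2norm \<xi>"
    by (rule bounded_op_boundE[OF T]) blast
  have up: "l2norm (T \<xi>) \<le> D * l2norm (\<lambda>x. \<xi> x - cut F \<xi> x) + C * l2norm \<xi>" if F: "finite F" for F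
  proof -
    have l: "cut F \<xi> \<in> l2" by (rule cut_l2[OF \<xi>])
    have "l2norm (T \<xi>) \<le> l2norm (\<lambda>x. T \<xi> x - T (cut F \<xi>) x) + l2norm (T (cut F \<xi>))"
      by (rule l2norm_triangle_sub[OF bounded_op_l2[OF T \<xi>] bounded_op_l2[OF T l]])
    also have "\<dots> = l2norm (T (\<lambda>x. \<xi> x - cut F \<xi> x)) + l2norm (T (cut F \<xi>))"
      unfolding bounded_op_diff[OF T \<xi> l] by (rule refl)
    also have "\<dots> \<le> D * l2norm (\<lambda>x. \<xi> x - cut F \<xi> x) + C * l2norm \<xi>"
      by (rule add_mono[OF D(2)[OF l2_diff[OF \<xi> l]] order_trans[OF fin[OF F] mult_left_mono[OF l2norm_cut[OF \<xi>] C]]])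
    finally show ?thesis .
  qed
  have "((\<lambda>F. D * l2norm (\<lambda>x. \<xi> x - cut F \<xi> x) + C * l2norm \<xi>) \<longlongrightarrow> D * 0 + C * l2norm \<xi>)
      (finite_subsets_at_top UNIV)"
    by (intro tendsto_intros cut_tendsto[OF \<xi>])
  then have "l2norm (T \<xi>) \<le> D * 0 + C * l2norm \<xi>"
    by (rule tendsto_lowerbound) (auto intro!: eventually_finite_subsets_at_top_weakI up)
  then show ?thesis by simp
qed

text \<open>A Schur test: after Cauchy-Schwarz over the pairs within distance \<open>r\<close>, each
  coordinate of \<open>\<zeta>\<close> and of \<open>\<eta>\<close> occurs at most \<open>N\<close>
  times, so each of the two factors gains sqrt N.\<close>

lemma mbound_band:
  fixes t :: "'a::metric_space \<Rightarrow> 'a \<Rightarrow> complex"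
  assumes N: "\<And>x::'a. finite (cball x r) \<and> card (cball x r) \<le> N"
    and e: "\<And>x y. dist x y \<le> r \<Longrightarrow> cmod (t x y) \<le> e" "e \<ge> 0"
    and z: "\<And>x y. dist x y > r \<Longrightarrow> t x y = 0"
  shows "mbound t (e * real N)"
proof (rule mboundI)
  fix F :: "'a set" and \<zeta> \<eta> :: "'a vec" assume F: "finite F"
  let ?f = "\<lambda>p. if dist (fst p) (snd p) \<le> r then cmod (\<zeta> (fst p)) else 0"
  let ?g = "\<lambda>p. if dist (fst p) (snd p) \<le> r then cmod (\<eta> (snd p)) else 0"
  have aux: "(\<Sum>y\<in>F. if dist x y \<le> r then c else 0) \<le> real N * c" if c: "c \<ge> 0" for x :: 'a and c :: real
  proof -
    have "(\<Sum>y\<in>F. if dist x y \<le> r then c else 0) = (\<Sum>y\<in>F \<inter> cball x r. c)"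
      by (rule sum.mono_neutral_cong_right) (auto simp: F)
    also have "\<dots> = real (card (F \<inter> cball x r)) * c" by simp
    also have "\<dots> \<le> real N * c"
    proof (rule mult_right_mono[OF _ c])
      have "card (F \<inter> cball x r) \<le> card (cball x r)" using N[of x] by (intro card_mono) auto
      then show "real (card (F \<inter> cball x r)) \<le> real N" using N[of x] by linarith
    qed
    finally show ?thesis .
  qed
  have f: "L2_set ?f (F \<times> F) \<le> sqrt N * L2_set (\<lambda>x. cmod (\<zeta> x)) F"
  proof -
    have "(\<Sum>p\<in>F \<times> F. (?f p)\<^sup>2) = (\<Sum>x\<in>F. \<Sum>y\<in>F. if dist x y \<le> r then (cmod (\<zeta> x))\<^sup>2 else 0)"
      unfolding sum.cartesian_product by (intro sum.cong) auto
    also have "\<dots> \<le> (\<Sum>x\<in>F. real N * (cmod (\<zeta> x))\<^sup>2)" by (intro sum_mono aux) simp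
    finally have "(\<Sum>p\<in>F \<times> F. (?f p)\<^sup>2) \<le> real N * (\<Sum>x\<in>F. (cmod (\<zeta> x))\<^sup>2)"
      by (simp add: sum_distrib_left)
    then show ?thesis unfolding L2_set_def by (simp flip: real_sqrt_mult)
  qed
  have g: "L2_set ?g (F \<times> F) \<le> sqrt N * L2_set (\<lambda>x. cmod (\<eta> x)) F"
  proof -
    have "(\<Sum>p\<in>F \<times> F. (?g p)\<^sup>2) = (\<Sum>x\<in>F. \<Sum>y\<in>F. if dist y x \<le> r then (cmod (\<eta> y))\<^sup>2 else 0)"
      unfolding sum.cartesian_product by (intro sum.cong) (auto simp: dist_commute)
    also have "\<dots> = (\<Sum>y\<in>F. \<Sum>x\<in>F. if dist y x \<le> r then (cmod (\<eta> y))\<^sup>2 else 0)"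
      by (rule sum.swap)
    also have "\<dots> \<le> (\<Sum>x\<in>F. real N * (cmod (\<eta> x))\<^sup>2)" by (intro sum_mono aux) simp
    finally have "(\<Sum>p\<in>F \<times> F. (?g p)\<^sup>2) \<le> real N * (\<Sum>x\<in>F. (cmod (\<eta> x))\<^sup>2)"
      by (simp add: sum_distrib_left)
    then show ?thesis unfolding L2_set_def by (simp flip: real_sqrt_mult)
  qed
  have "cmod (\<Sum>x\<in>F. \<Sum>y\<in>F. cnj (\<zeta> x) * t x y * \<eta> y)
      \<le> (\<Sum>x\<in>F. \<Sum>y\<in>F. cmod (cnj (\<zeta> x) * t x y * \<eta> y))"
    by (rule order_trans[OF norm_sum sum_mono[OF norm_sum]])
  also have "\<dots> \<le> (\<Sum>x\<in>F. \<Sum>y\<in>F. e * (\<bar>?f (x, y)\<bar> * \<bar>?g (x, y)\<bar>))"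
  proof (intro sum_mono)
    fix x y
    show "cmod (cnj (\<zeta> x) * t x y * \<eta> y) \<le> e * (\<bar>?f (x, y)\<bar> * \<bar>?g (x, y)\<bar>)"
    proof (cases "dist x y \<le> r")
      case True
      have "cmod (t x y) * (cmod (\<zeta> x) * cmod (\<eta> y)) \<le> e * (cmod (\<zeta> x) * cmod (\<eta> y))"
        by (rule mult_right_mono[OF e(1)[OF True]]) simp
      then show ?thesis using True by (simp add: norm_mult mult_ac)
    qed (simp add: z)
  qed
  also have "\<dots> = e * (\<Sum>p\<in>F \<times> F. \<bar>?f p\<bar> * \<bar>?g p\<bar>)"
    unfolding sum.cartesian_product sum_distrib_left by (intro sum.cong) auto
  also have "\<dots> \<le> e * ((sqrt N * L2_set (\<lambda>x. cmod (\<zeta> x)) F) * (sqrt N * L2_set (\<lambda>x. cmod (\<eta> x)) F))"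
    by (rule mult_left_mono[OF order_trans[OF L2_set_mult_ineq mult_mono[OF f g]] e(2)]) auto
  also have "\<dots> = e * (sqrt N * sqrt N) * (L2_set (\<lambda>x. cmod (\<zeta> x)) F * L2_set (\<lambda>x. cmod (\<eta> x)) F)"
    by (simp only: mult_ac)
  also have "sqrt N * sqrt N = real N" by simp
  finally show "cmod (\<Sum>x\<in>F. \<Sum>y\<in>F. cnj (\<zeta> x) * t x y * \<eta> y)
       \<le> e * real N * (L2_set (\<lambda>x. cmod (\<zeta> x)) F * L2_set (\<lambda>x. cmod (\<eta> x)) F)" .
qed

text \<open>The multiplier splits as an average over \<open>z\<close> of compressions by the diagonal
  operators \<open>\<lambda>x. v x z\<close>.\<close>
lemma mbound_schur_multiplier:
  fixes v :: "'a \<Rightarrow> 'a vec"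
  assumes v: "\<And>x. v x \<in> l2" "\<And>x. l2norm (v x) \<le> 1" and fv: "\<And>x. finite {z. v x z \<noteq> 0}"
    and t: "mbound t C" and C: "C \<ge> 0"
  shows "mbound (\<lambda>x y. l2inner (v x) (v y) * t x y) C"
proof (rule mboundI)
  fix F :: "'a set" and \<zeta> \<eta> :: "'a vec" assume F: "finite F"
  define Z where "Z = (\<Union>x\<in>F. {z. v x z \<noteq> 0})"
  have Z: "finite Z" using F fv by (simp add: Z_def)
  have k: "l2inner (v x) (v y) = (\<Sum>z\<in>Z. cnj (v x z) * v y z)" if "x \<in> F" for x y
  proof -
    have "l2inner (v x) (v y) = (\<Sum>\<^sub>\<infinity>z\<in>Z. cnj (v x z) * v y z)"
      unfolding l2inner_def by (rule infsum_cong_neutral) (use that in \<open>auto simp: Z_def\<close>)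
    then show ?thesis using Z by simp
  qed
  \<comment> \<open>For each \<open>x\<close> the weights |v x z|^2 sum to at most 1, so the vectors
    \<open>v x z * \<xi> x\<close>, indexed by \<open>z\<close>, have joint l2 norm at most that of
    \<open>\<xi>\<close>. Cauchy-Schwarz over \<open>z\<close> then returns the constant
    \<open>C\<close> unchanged.\<close>
  have L: "L2_set (\<lambda>z. L2_set (\<lambda>x. cmod (v x z * \<xi> x)) F) Z \<le> L2_set (\<lambda>x. cmod (\<xi> x)) F" for \<xi> :: "'a vec"
  proof -
    have "(\<Sum>z\<in>Z. (L2_set (\<lambda>x. cmod (v x z * \<xi> x)) F)\<^sup>2) = (\<Sum>z\<in>Z. \<Sum>x\<in>F. (cmod (v x z))\<^sup>2 * (cmod (\<xi> x))\<^sup>2)"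
      by (simp add: L2_set_def sum_nonneg norm_mult power_mult_distrib)
    also have "\<dots> = (\<Sum>x\<in>F. \<Sum>z\<in>Z. (cmod (v x z))\<^sup>2 * (cmod (\<xi> x))\<^sup>2)" by (rule sum.swap)
    also have "\<dots> = (\<Sum>x\<in>F. (\<Sum>z\<in>Z. (cmod (v x z))\<^sup>2) * (cmod (\<xi> x))\<^sup>2)" by (simp add: sum_distrib_right)
    also have "\<dots> \<le> (\<Sum>x\<in>F. 1 * (cmod (\<xi> x))\<^sup>2)"
    proof (intro sum_mono mult_right_mono)
      fix x
      have "L2_set (\<lambda>z. cmod (v x z)) Z \<le> 1"
        by (rule order_trans[OF L2_set_le_l2norm[OF v(1) Z] v(2)])
      then show "(\<Sum>z\<in>Z. (cmod (v x z))\<^sup>2) \<le> 1" by (simp add: L2_set_def)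
    qed simp
    finally show ?thesis by (simp add: L2_set_def)
  qed
  have "(\<Sum>x\<in>F. \<Sum>y\<in>F. cnj (\<zeta> x) * (l2inner (v x) (v y) * t x y) * \<eta> y)
      = (\<Sum>x\<in>F. \<Sum>y\<in>F. \<Sum>z\<in>Z. cnj (v x z * \<zeta> x) * t x y * (v y z * \<eta> y))"
    by (intro sum.cong refl) (simp add: k sum_distrib_left sum_distrib_right mult_ac)
  also have "\<dots> = (\<Sum>x\<in>F. \<Sum>z\<in>Z. \<Sum>y\<in>F. cnj (v x z * \<zeta> x) * t x y * (v y z * \<eta> y))"
    by (intro sum.cong refl sum.swap)
  also have "\<dots> = (\<Sum>z\<in>Z. \<Sum>x\<in>F. \<Sum>y\<in>F. cnj (v x z * \<zeta> x) * t x y * (v y z * \<eta> y))"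
    by (rule sum.swap)
  finally have "cmod (\<Sum>x\<in>F. \<Sum>y\<in>F. cnj (\<zeta> x) * (l2inner (v x) (v y) * t x y) * \<eta> y)
      \<le> (\<Sum>z\<in>Z. cmod (\<Sum>x\<in>F. \<Sum>y\<in>F. cnj (v x z * \<zeta> x) * t x y * (v y z * \<eta> y)))"
    by (simp only: norm_sum)
  also have "\<dots> \<le> (\<Sum>z\<in>Z. C * (L2_set (\<lambda>x. cmod (v x z * \<zeta> x)) F * L2_set (\<lambda>x. cmod (v x z * \<eta> x)) F))"
    by (rule sum_mono[OF mboundD[OF t F]])
  also have "\<dots> = C * (\<Sum>z\<in>Z. \<bar>L2_set (\<lambda>x. cmod (v x z * \<zeta> x)) F\<bar> * \<bar>L2_set (\<lambda>x. cmod (v x z * \<eta> x)) F\<bar>)"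
    by (simp add: sum_distrib_left)
  also have "\<dots> \<le> C * (L2_set (\<lambda>x. cmod (\<zeta> x)) F * L2_set (\<lambda>x. cmod (\<eta> x)) F)"
    by (rule mult_left_mono[OF order_trans[OF L2_set_mult_ineq mult_mono[OF L L]] C]) auto
  finally show "cmod (\<Sum>x\<in>F. \<Sum>y\<in>F. cnj (\<zeta> x) * (l2inner (v x) (v y) * t x y) * \<eta> y)
      \<le> C * (L2_set (\<lambda>x. cmod (\<zeta> x)) F * L2_set (\<lambda>x. cmod (\<eta> x)) F)" .
qed

text \<open>Isolates what property A contributes to the proof. A single index governs both the width
  of the band and the accuracy on it; the summand 1 keeps both positive at \<open>n = 0\<close>, as
  property A requires of its parameters.\<close>

definition roe_kernel :: "(nat \<Rightarrow> 'a::metric_space \<Rightarrow> 'a \<Rightarrow> complex) \<Rightarrow> bool" where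
  "roe_kernel k \<longleftrightarrow>
     (\<forall>n t C. mbound t C \<longrightarrow> C \<ge> 0 \<longrightarrow> mbound (\<lambda>x y. k n x y * t x y) C) \<and>
     (\<forall>n x y. dist x y \<le> real n + 1 \<longrightarrow> cmod (k n x y - 1) \<le> 1 / (real n + 1)) \<and>
     (\<forall>n. \<exists>r>0. \<forall>x y. dist x y > r \<longrightarrow> k n x y = 0) \<and>
     (\<forall>n x y. cmod (k n x y) \<le> 1)"

text \<open>The kernel is the Gram matrix of the unit vectors from property A. The Gram form makes
  it a contractive Schur multiplier, slow variation of the vectors puts it near 1 close to the
  diagonal, and uniformly bounded supports give finite propagation.\<close>

lemma property_A_kernel:
  assumes ulf: "uniformly_locally_finite TYPE('a::metric_space)" and A: "property_A TYPE('a)"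
  shows "\<exists>k :: nat \<Rightarrow> 'a \<Rightarrow> 'a \<Rightarrow> complex. roe_kernel k"
proof -
  have "\<exists>v :: 'a \<Rightarrow> 'a vec. (\<forall>x. v x \<in> l2 \<and> l2norm (v x) = 1) \<and>
      (\<forall>x y. dist x y \<le> real n + 1 \<longrightarrow> l2norm (\<lambda>z. v x z - v y z) \<le> 1 / (real n + 1)) \<and>
      (\<exists>S. \<forall>x y. cnj (v x y) \<noteq> 0 \<longrightarrow> dist x y \<le> S)" for n :: nat
    using A[unfolded property_A_def, rule_format, of "1 / (real n + 1)" "real n + 1"] by simp
  then obtain v :: "nat \<Rightarrow> 'a \<Rightarrow> 'a vec" where v: "\<And>n x. v n x \<in> l2" "\<And>n x. l2norm (v n x) = 1"
     "\<And>n x y. dist x y \<le> real n + 1 \<Longrightarrow> l2norm (\<lambda>z. v n x z - v n y z) \<le> 1 / (real n + 1)"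
     "\<And>n. \<exists>S. \<forall>x y. cnj (v n x y) \<noteq> 0 \<longrightarrow> dist x y \<le> S"
    by metis
  define k where "k n x y = l2inner (v n x) (v n y)" for n x y
  have fin: "finite {z. v n x z \<noteq> 0}" for n x
  proof -
    obtain S where S: "\<And>x y. cnj (v n x y) \<noteq> 0 \<Longrightarrow> dist x y \<le> S" using v(4)[of n] by blast
    have "{z. v n x z \<noteq> 0} \<subseteq> cball x S" using S by auto
    then show ?thesis by (rule finite_subset[OF _ ulf_finite_cball[OF ulf]])
  qed
  have 1: "mbound (\<lambda>x y. k n x y * t x y) C" if "mbound t C" "C \<ge> 0" for n t C
    unfolding k_def by (rule mbound_schur_multiplier[OF v(1) _ fin that]) (simp add: v(2))
  have 2: "cmod (k n x y - 1) \<le> 1 / (real n + 1)" if d: "dist x y \<le> real n + 1" for n x y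
  proof -
    \<comment> \<open>Unit length makes the inner product of \<open>v n x\<close> with itself equal
      to 1, so the deviation from 1 is an inner product with the difference of the two
      vectors.\<close>
    have "k n x y - 1 = l2inner (v n x) (\<lambda>z. v n y z - v n x z)"
      using l2inner_self[OF v(1), of n x] v(2)[of n x] by (simp add: k_def l2inner_diff_right v(1))
    also have "cmod \<dots> \<le> l2norm (v n x) * l2norm (\<lambda>z. v n y z - v n x z)"
      by (rule l2inner_cauchy_schwarz[OF v(1) l2_diff[OF v(1) v(1)]])
    also have "\<dots> \<le> 1 / (real n + 1)"
      using v(3)[OF d] l2norm_minus_commute[of "v n y" "v n x"] v(2)[of n x] by simp
    finally show ?thesis .
  qed
  have 3: "\<exists>r>0. \<forall>x y. dist x y > r \<longrightarrow> k n x y = 0" for n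
  proof -
    obtain S where S: "\<And>x y. cnj (v n x y) \<noteq> 0 \<Longrightarrow> dist x y \<le> S" using v(4)[of n] by blast
    \<comment> \<open>Entries vanish unless two supports of radius \<open>S\<close> meet, hence
      \<open>S + S\<close>; the maximum with 1 secures a positive radius.\<close>
    have "k n x y = 0" if d: "dist x y > max 1 (S + S)" for x y
    proof -
      have "cnj (v n x z) * v n y z = 0" for z
      proof (rule ccontr)
        assume "cnj (v n x z) * v n y z \<noteq> 0"
        then have "dist x z \<le> S" "dist y z \<le> S" using S by auto
        then show False using d dist_triangle2[of x y z] by linarith
      qed
      then show ?thesis unfolding k_def l2inner_def by (simp only: infsum_0)
    qed
    then show ?thesis by (intro exI[of _ "max 1 (S + S)"]) auto
  qed
  have 4: "cmod (k n x y) \<le> 1" for n x y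
    using l2inner_cauchy_schwarz[OF v(1) v(1), of n x n y] by (simp add: k_def v(2))
  show ?thesis unfolding roe_kernel_def using 1 2 3 4 by blast
qed

text \<open>With d = T - S for an approximant \<open>S\<close> of finite propagation, (k - 1) T = (k
  d - d) + (k - 1) S. The first two terms are small because multiplication by \<open>k n\<close> is
  contractive, the last because \<open>S\<close> lives in one fixed band, on which
  \<open>k n\<close> tends uniformly to 1.\<close>

lemma uniform_roe_kernel:
  fixes k :: "nat \<Rightarrow> 'a::metric_space \<Rightarrow> 'a \<Rightarrow> complex"
  assumes ulf: "uniformly_locally_finite TYPE('a)" and k: "roe_kernel k"
    and T: "T \<in> uniform_roe" and e: "\<epsilon> > 0"
  shows "\<forall>\<^sub>F n in sequentially. mbound (\<lambda>x y. (k n x y - 1) * T (delta y) x) \<epsilon>"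
proof -
  have e3: "\<epsilon> / 3 > 0" using e by simp
  obtain S where S: "S \<in> roe_star_alg" "\<And>\<xi>. \<xi> \<in> l2 \<Longrightarrow> l2norm (\<lambda>x. T \<xi> x - S \<xi> x) \<le> \<epsilon> / 3 * l2norm \<xi>"
    by (rule uniform_roe_approx[OF T e3]) blast
  note bS = roe_star_alg_bounded[OF S(1)] and bT = uniform_roe_bounded[OF T]
  let ?d = "\<lambda>x y. T (delta y) x - S (delta y) x"
  have d: "mbound ?d (\<epsilon> / 3)"
    using mbound_of_op[OF bounded_op_sub[OF bT bS] S(2)] .
  have kd: "mbound (\<lambda>x y. k n x y * ?d x y) (\<epsilon> / 3)" for n
    using k d e3 unfolding roe_kernel_def by (meson less_imp_le)
  obtain D where D: "D \<ge> 0" "\<And>\<xi>. \<xi> \<in> l2 \<Longrightarrow> l2norm (S \<xi>) \<le> D * l2norm \<xi>"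
    by (rule bounded_op_boundE[OF bS]) blast
  obtain r0 where r0: "band S r0" using roe_star_alg_band[OF ulf S(1)] by blast
  define r where "r = max r0 1"
  have r: "S (delta y) x = 0" if "dist x y > r" for x y
    using r0 that unfolding band_def r_def by auto
  have "r > 0" by (simp add: r_def)
  then obtain N where N: "\<And>x::'a. finite (cball x r) \<and> card (cball x r) \<le> N"
    using ulf unfolding uniformly_locally_finite_def by metis
  have "(\<lambda>n. inverse (real (Suc n)) * (D * real N)) \<longlonglongrightarrow> 0 * (D * real N)"
    by (intro tendsto_mult LIMSEQ_inverse_real_of_nat tendsto_const)
  then have "\<forall>\<^sub>F n in sequentially. inverse (real (Suc n)) * (D * real N) < \<epsilon> / 3"
    using e3 by (intro order_tendstoD(2)) auto
  moreover have "\<forall>\<^sub>F n in sequentially. r \<le> real n"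
    using eventually_ge_at_top[of "nat \<lceil>r\<rceil>"] by (rule eventually_mono) linarith
  ultimately show ?thesis
  proof eventually_elim
    fix n :: nat assume n: "inverse (real (Suc n)) * (D * real N) < \<epsilon> / 3" "r \<le> real n"
    have "mbound (\<lambda>x y. (k n x y - 1) * S (delta y) x) (D / (real n + 1) * real N)"
    proof (rule mbound_band[OF N])
      fix x y :: 'a assume dr: "dist x y \<le> r"
      have 1: "cmod (k n x y - 1) \<le> 1 / (real n + 1)"
        using k dr n(2) unfolding roe_kernel_def by auto
      have 2: "cmod (S (delta y) x) \<le> D"
        using cmod_le_l2norm[OF bounded_op_l2[OF bS delta_l2], of y x] D(2)[OF delta_l2, of y] by simp
      show "cmod ((k n x y - 1) * S (delta y) x) \<le> D / (real n + 1)"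
        unfolding norm_mult using mult_mono[OF 1 2] by simp
    qed (use D(1) r in auto)
    then have "mbound (\<lambda>x y. (k n x y - 1) * S (delta y) x) (\<epsilon> / 3)"
      by (rule mbound_mono) (use n(1) in \<open>simp add: field_simps\<close>)
    from mbound_add[OF mbound_diff[OF kd d] this, of n]
    have "mbound (\<lambda>x y. (k n x y * ?d x y - ?d x y) + (k n x y - 1) * S (delta y) x) \<epsilon>" by simp
    then show "mbound (\<lambda>x y. (k n x y - 1) * T (delta y) x) \<epsilon>" by (simp add: algebra_simps)
  qed
qed

subsection \<open>Unitaries normalising the diagonal\<close>

lemma has_sum_sum:
  fixes f :: "'i \<Rightarrow> 'b \<Rightarrow> complex"
  assumes "\<And>i. i \<in> I \<Longrightarrow> (f i has_sum s i) A"
  shows "((\<lambda>x. \<Sum>i\<in>I. f i x) has_sum (\<Sum>i\<in>I. s i)) A"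
  using assms by (induction I rule: infinite_finite_induct) (simp_all add: has_sum_add)

text \<open>Toggling the membership of \<open>y\<close> is an involution of \<open>Pow F\<close>
  that flips exactly one of the two factors, so the sum equals its own negative.\<close>

lemma sum_signs_orthogonal:
  fixes F :: "'b set"
  assumes "finite F" "y \<in> F" "z \<noteq> y"
  shows "(\<Sum>B\<in>Pow F. (if z \<in> B then -1 else 1) * (if y \<in> B then -1 else (1::complex))) = 0"
    (is "sum ?g _ = 0")
proof -
  have neg: "S = 0" if "S = - S" for S :: complex using that by (simp add: complex_eq_iff)
  define i where "i B = (if y \<in> B then B - {y} else insert y B)" for B
  have "sum ?g (Pow F) = (\<Sum>B\<in>Pow F. - ?g B)"
    by (rule sum.reindex_bij_witness[of _ i i]) (use assms in \<open>auto simp: i_def\<close>)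
  also have "\<dots> = - sum ?g (Pow F)" by (rule sum_negf)
  finally have "sum ?g (Pow F) = - sum ?g (Pow F)" .
  then show ?thesis by (rule neg)
qed

text \<open>Homogeneity reduces to the unit ball. This makes the test vectors a bounded family, to
  which the uniform form of Schur's lemma can be applied.\<close>

lemma mbound_unitI:
  assumes C: "C \<ge> 0"
    and b: "\<And>F \<zeta> \<eta>. finite F \<Longrightarrow> L2_set (\<lambda>x. cmod (\<zeta> x)) F \<le> 1 \<Longrightarrow> L2_set (\<lambda>x. cmod (\<eta> x)) F \<le> 1 \<Longrightarrow>
      cmod (\<Sum>x\<in>F. \<Sum>y\<in>F. cnj (\<zeta> x) * t x y * \<eta> y) \<le> C"
  shows "mbound t C"
proof (rule mboundI)
  fix F :: "'a set" and \<zeta> \<eta> :: "'a vec" assume F: "finite F"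
  let ?a = "L2_set (\<lambda>x. cmod (\<zeta> x)) F" and ?b = "L2_set (\<lambda>x. cmod (\<eta> x)) F"
  show "cmod (\<Sum>x\<in>F. \<Sum>y\<in>F. cnj (\<zeta> x) * t x y * \<eta> y) \<le> C * (?a * ?b)"
  proof (cases "?a = 0 \<or> ?b = 0")
    case True
    then have "(\<forall>x\<in>F. \<zeta> x = 0) \<or> (\<forall>x\<in>F. \<eta> x = 0)"
      using F by (simp add: L2_set_eq_0_iff)
    then have "(\<Sum>x\<in>F. \<Sum>y\<in>F. cnj (\<zeta> x) * t x y * \<eta> y) = 0"
      by (intro sum.neutral ballI) auto
    then show ?thesis using C by simp
  next
    case False
    then have ab: "?a > 0" "?b > 0" by (auto simp: order.strict_iff_order)
    let ?\<zeta> = "\<lambda>x. complex_of_real (1 / ?a) * \<zeta> x" and ?\<eta> = "\<lambda>x. complex_of_real (1 / ?b) * \<eta> x"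
    have 1: "L2_set (\<lambda>x. cmod (complex_of_real c * \<xi> x)) F = c * L2_set (\<lambda>x. cmod (\<xi> x)) F" if "c \<ge> 0" for c and \<xi> :: "'a vec"
      using that by (simp add: norm_mult L2_set_right_distrib)
    have e: "(\<Sum>x\<in>F. \<Sum>y\<in>F. cnj (?\<zeta> x) * t x y * ?\<eta> y) =
        (complex_of_real (1 / ?a) * complex_of_real (1 / ?b)) * (\<Sum>x\<in>F. \<Sum>y\<in>F. cnj (\<zeta> x) * t x y * \<eta> y)"
      unfolding sum_distrib_left complex_cnj_mult complex_cnj_complex_of_real
      by (intro sum.cong refl) (simp only: mult_ac)
    have "cmod (\<Sum>x\<in>F. \<Sum>y\<in>F. cnj (?\<zeta> x) * t x y * ?\<eta> y) \<le> C"
      by (rule b[OF F]) (use ab in \<open>simp_all only: 1 zero_le_divide_1_iff less_imp_le\<close>, auto)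
    then have "1 / (?a * ?b) * cmod (\<Sum>x\<in>F. \<Sum>y\<in>F. cnj (\<zeta> x) * t x y * \<eta> y) \<le> C"
      unfolding e norm_mult norm_of_real using ab by simp
    then show ?thesis using ab by (simp add: pos_divide_le_eq)
  qed
qed

text \<open>The entries supported near the diagonal are coded by a triple: the position of \<open>x\<close> in the
  ball around \<open>y\<close>, the position of \<open>y\<close> in the ball around \<open>x\<close>, and the value at \<open>(x, y)\<close>.
  Pairs with a given code form the graph of a partial translation.\<close>
lemma finite_valued_band_matrix:
  fixes t :: "'a::metric_space \<Rightarrow> 'a \<Rightarrow> complex"
  assumes N: "\<And>x::'a. finite (cball x r) \<and> card (cball x r) \<le> N"
    and Q: "finite Q" "\<And>x y. t x y \<in> Q"
  shows "\<exists>S\<in>roe_star_alg. \<forall>x y. S (delta y) x = (if dist x y \<le> r then t x y else 0)"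
proof -
  have "\<exists>g :: 'a \<Rightarrow> nat. inj_on g (cball y r) \<and> g ` cball y r \<subseteq> {..<N}" for y :: 'a
  proof -
    obtain g :: "'a \<Rightarrow> nat" and m where g: "g ` cball y r = {i. i < m}" "inj_on g (cball y r)"
      using finite_imp_inj_to_nat_seg[of "cball y r"] N[of y] by auto
    have "m \<le> N" using card_image[OF g(2)] g(1) N[of y] by simp
    then show ?thesis using g by (intro exI[of _ g]) auto
  qed
  then obtain idx :: "'a \<Rightarrow> 'a \<Rightarrow> nat" where idx: "\<And>y. inj_on (idx y) (cball y r)"
      "\<And>y. idx y ` cball y r \<subseteq> {..<N}" by metis
  define P where "P x y = (idx y x, idx x y, t x y)" for x y
  define I where "I = {..<N} \<times> {..<N} \<times> Q"
  have I: "finite I" using Q by (simp add: I_def)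
  have PI: "P x y \<in> I" if "dist x y \<le> r" for x y
  proof -
    have "idx y x \<in> {..<N}" "idx x y \<in> {..<N}"
      using subsetD[OF idx(2) imageI] that by (simp_all add: dist_commute)
    then show ?thesis using Q(2) by (simp add: P_def I_def)
  qed
  have u1: "x = x'" if "dist x y \<le> r" "dist x' y \<le> r" "P x y = P x' y" for x x' y
    using inj_onD[OF idx(1)[of y], of x x'] that by (simp add: P_def dist_commute)
  have u2: "y = y'" if "dist x y \<le> r" "dist x y' \<le> r" "P x y = P x y'" for x y y'
    using inj_onD[OF idx(1)[of x], of y y'] that by (simp add: P_def)
  define A where "A p = {y. \<exists>x. dist x y \<le> r \<and> P x y = p}" for p
  define f where "f p y = (SOME x. dist x y \<le> r \<and> P x y = p)" for p y
  have f: "dist (f p y) y \<le> r \<and> P (f p y) y = p" if "y \<in> A p" for p y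
  proof -
    have "\<exists>x. dist x y \<le> r \<and> P x y = p" using that by (simp add: A_def)
    from someI_ex[OF this] show ?thesis unfolding f_def .
  qed
  have fe: "y \<in> A p \<and> f p y = x \<longleftrightarrow> dist x y \<le> r \<and> P x y = p" for p x y
  proof
    assume "y \<in> A p \<and> f p y = x"
    then show "dist x y \<le> r \<and> P x y = p" using f[of y p] by simp
  next
    assume a: "dist x y \<le> r \<and> P x y = p"
    then have y: "y \<in> A p" by (auto simp: A_def)
    have "f p y = x" by (rule u1[of _ y]) (use f[OF y] a in simp_all)
    with y show "y \<in> A p \<and> f p y = x" by simp
  qed
  have inj: "inj_on (f p) (A p)" for p
  proof (rule inj_onI)
    fix y y' assume a: "y \<in> A p" "y' \<in> A p" "f p y = f p y'"
    show "y = y'" using f[OF a(1)] f[OF a(2)] a(3) by (intro u2[of "f p y"]) simp_all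
  qed
  have pt: "partial_translation (A p) (f p)" for p
    unfolding partial_translation_def using inj f by (metis dist_commute)
  have "(\<lambda>\<xi> x. \<Sum>p\<in>J. snd (snd p) * vop (A p) (f p) \<xi> x) \<in> roe_star_alg" if "finite J" for J
    using that
  proof (induction J)
    case empty
    \<comment> \<open>\<open>roe_star_alg\<close> has no rule for the zero operator; it arises as 0
      times a generator.\<close>
    have "(\<lambda>\<xi> x. 0 * vop (A p) (f p) \<xi> x) \<in> roe_star_alg" for p
      by (rule roe_star_alg.smult[OF roe_star_alg.gen[OF pt]])
    then show ?case by simp
  next
    case (insert p J)
    have "(\<lambda>\<xi> x. (snd (snd p) * vop (A p) (f p) \<xi> x) + (\<Sum>p\<in>J. snd (snd p) * vop (A p) (f p) \<xi> x)) \<in> roe_star_alg"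
      by (rule roe_star_alg.add[OF roe_star_alg.smult[OF roe_star_alg.gen[OF pt]] insert.IH])
    then show ?case using insert.hyps by simp
  qed
  note S = this[OF I]
  have "(\<Sum>p\<in>I. snd (snd p) * vop (A p) (f p) (delta y) x) = (if dist x y \<le> r then t x y else 0)" for x y
  proof -
    have "(\<Sum>p\<in>I. snd (snd p) * vop (A p) (f p) (delta y) x)
        = (\<Sum>p\<in>I. if P x y = p then (if dist x y \<le> r then snd (snd p) else 0) else 0)"
      unfolding vop_delta[OF inj] fe by (intro sum.cong) auto
    also have "\<dots> = (if P x y \<in> I then (if dist x y \<le> r then snd (snd (P x y)) else 0) else 0)"
      using I by simp
    finally show ?thesis using PI by (auto simp: P_def)
  qed
  then show ?thesis by (intro bexI[OF _ S] allI)
qed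

text \<open>A rounding map for bounded matrix entries: with finitely many values, a band matrix
  decomposes into finitely many partial translations.\<close>

lemma complex_finite_net:
  assumes d: "\<delta> > 0"
  obtains Q and q :: "complex \<Rightarrow> complex" where "finite Q" "\<And>w. q w \<in> Q" "\<And>w. cmod w \<le> R \<Longrightarrow> cmod (w - q w) \<le> \<delta>"
proof -
  have "compact (cball (0::complex) R)" by simp
  then have "\<exists>Q. finite Q \<and> cball (0::complex) R \<subseteq> (\<Union>x\<in>Q. ball x \<delta>)"
    using d by (simp add: compact_eq_totally_bounded)
  then obtain Q where Q: "finite Q" "cball (0::complex) R \<subseteq> (\<Union>x\<in>Q. ball x \<delta>)" by auto
  define q where "q w = (if \<exists>z\<in>Q. dist z w < \<delta> then SOME z. z \<in> Q \<and> dist z w < \<delta> else 0)" for w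
  have q: "q w \<in> Q \<and> dist (q w) w < \<delta>" if "\<exists>z\<in>Q. dist z w < \<delta>" for w
  proof -
    have "\<exists>z. z \<in> Q \<and> dist z w < \<delta>" using that unfolding Bex_def .
    from someI_ex[OF this] show ?thesis unfolding q_def using that by simp
  qed
  show ?thesis
  proof
    \<comment> \<open>The value 0 is the default of \<open>q\<close> at arguments that no net point
      approximates.\<close>
    show "finite (insert 0 Q)" using Q by simp
    show "q w \<in> insert 0 Q" for w using q[of w] by (auto simp: q_def)
    fix w assume "cmod w \<le> R"
    then have "w \<in> cball 0 R" by simp
    from subsetD[OF Q(2) this] have "\<exists>z\<in>Q. dist z w < \<delta>" by (simp add: mem_ball)
    from q[OF this] show "cmod (w - q w) \<le> \<delta>" by (simp add: dist_norm norm_minus_commute)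
  qed
qed

text \<open>Converse to \<open>uniform_roe_kernel\<close>. The matrix
  \<open>k n x y * u (delta y) x\<close> has finite propagation and bounded entries; once these are
  rounded to finitely many values, it is the matrix of an element of
  \<open>roe_star_alg\<close>.\<close>

lemma uniform_roe_if_kernel:
  fixes u :: "('a::metric_space) op"
  assumes ulf: "uniformly_locally_finite TYPE('a)" and k: "roe_kernel k"
    and u: "bounded_op u"
    and lim: "\<And>\<epsilon>. \<epsilon> > 0 \<Longrightarrow> \<exists>n. mbound (\<lambda>x y. (k n x y - 1) * u (delta y) x) \<epsilon>"
  shows "u \<in> uniform_roe"
proof (rule uniform_roeI[OF u])
  fix \<epsilon> :: real assume e: "\<epsilon> > 0"
  have "\<epsilon> / 2 > 0" using e by simp
  from lim[OF this] obtain n where n: "mbound (\<lambda>x y. (k n x y - 1) * u (delta y) x) (\<epsilon> / 2)" by blast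
  have "\<exists>r>0. \<forall>x y. dist x y > r \<longrightarrow> k n x y = 0"
    using k by (simp add: roe_kernel_def)
  then obtain r where r: "r > 0" "\<And>x y. dist x y > r \<Longrightarrow> k n x y = 0" by auto
  obtain N where N: "\<And>x::'a. finite (cball x r) \<and> card (cball x r) \<le> N"
    using ulf[unfolded uniformly_locally_finite_def, rule_format, OF r(1)] by auto
  obtain D where D: "D \<ge> 0" "\<And>\<xi>. \<xi> \<in> l2 \<Longrightarrow> l2norm (u \<xi>) \<le> D * l2norm \<xi>"
    by (rule bounded_op_boundE[OF u]) blast
  \<comment> \<open>An entrywise error \<delta> in a band with at most \<open>N\<close> entries per
    row and column costs \<open>\<delta> * real N\<close> in norm, and this must fit into the half
    of \<epsilon> not spent on the multiplier.\<close>
  define \<delta> where "\<delta> = \<epsilon> / 2 / (real N + 1)"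
  have dl: "\<delta> > 0" using e by (simp add: \<delta>_def add_nonneg_pos)
  have dN: "\<delta> * real N \<le> \<epsilon> / 2" using e by (simp add: \<delta>_def field_simps)
  obtain Q and q :: "complex \<Rightarrow> complex" where q: "finite Q" "\<And>w. q w \<in> Q" "\<And>w. cmod w \<le> D \<Longrightarrow> cmod (w - q w) \<le> \<delta>"
    by (rule complex_finite_net[OF dl, of D]) blast
  let ?t = "\<lambda>x y. k n x y * u (delta y) x"
  obtain S where S: "S \<in> roe_star_alg" "\<And>x y. S (delta y) x = (if dist x y \<le> r then q (?t x y) else 0)"
    using finite_valued_band_matrix[OF N q(1), of "\<lambda>x y. q (?t x y)"] q(2) by blast
  have tD: "cmod (?t x y) \<le> D" for x y
  proof -
    have 1: "cmod (k n x y) \<le> 1" using k unfolding roe_kernel_def by blast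
    have 2: "cmod (u (delta y) x) \<le> D"
      using cmod_le_l2norm[OF bounded_op_l2[OF u delta_l2], of y x] D(2)[OF delta_l2, of y] by simp
    show ?thesis unfolding norm_mult using mult_mono[OF 1 2] by simp
  qed
  have "mbound (\<lambda>x y. ?t x y - S (delta y) x) (\<delta> * real N)"
    by (rule mbound_band[OF N]) (use q(3)[OF tD] dl r(2) in \<open>auto simp: S(2)\<close>)
  from mbound_diff[OF mbound_mono[OF this dN] n]
  have "mbound (\<lambda>x y. u (delta y) x - S (delta y) x) \<epsilon>" by (simp add: algebra_simps)
  then have "l2norm (\<lambda>x. u \<xi> x - S \<xi> x) \<le> \<epsilon> * l2norm \<xi>" if "\<xi> \<in> l2" for \<xi>
    using op_of_mbound[OF bounded_op_sub[OF u roe_star_alg_bounded[OF S(1)]]] e that by simp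
  with S(1) show "\<exists>S\<in>roe_star_alg. \<forall>\<xi>\<in>l2. l2norm (\<lambda>x. u \<xi> x - S \<xi> x) \<le> \<epsilon> * l2norm \<xi>" by blast
qed

text \<open>Averaging over diagonal sign matrices \<open>s\<close> turns the entries of \<open>u s u\<^sup>* s\<close> into
  \<open>u\<^sub>x\<^sub>y\<close> times the conjugate of \<open>u\<^sub>y\<^sub>y\<close>, and the latter factor is invertible.
  Schur's lemma makes the approximation of \<open>u s u\<^sup>*\<close> uniform in \<open>s\<close>.\<close>
lemma normalizer_in_uniform_roe:
  fixes u u' :: "('a::metric_space) op"
  assumes ulf: "uniformly_locally_finite TYPE('a)" and A: "property_A TYPE('a)"
    and u: "bounded_op u" and u': "bounded_op u'"
    and adj: "\<And>\<xi> \<eta>. \<xi> \<in> l2 \<Longrightarrow> \<eta> \<in> l2 \<Longrightarrow> l2inner (u \<xi>) \<eta> = l2inner \<xi> (u' \<eta>)"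
    and conj: "\<And>A. u \<circ> vop A id \<circ> u' \<in> uniform_roe"
    and diag: "\<And>x. cmod (u (delta x) x - 1) \<le> 1 / 2"
  shows "u \<in> uniform_roe"
proof -
  obtain k :: "nat \<Rightarrow> 'a \<Rightarrow> 'a \<Rightarrow> complex" where k: "roe_kernel k"
    using property_A_kernel[OF ulf A] by blast
  \<comment> \<open>\<open>b x\<close> is the complex conjugate of row \<open>x\<close> of
    \<open>u\<close>, see \<open>bt\<close>. Entries of the conjugated projection onto
    \<open>A\<close> thus become inner products of rows restricted to \<open>A\<close>.\<close>
  define b where "b x = u' (delta x)" for x
  have b: "b x \<in> l2" for x unfolding b_def by (rule bounded_op_l2[OF u' delta_l2])
  have bt: "b x z = cnj (u (delta z) x)" for x z
    using adj[OF delta_l2 delta_l2, of z x] by (simp add: b_def)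
  have mat: "(u \<circ> vop A id \<circ> u') (delta y) x = (\<Sum>\<^sub>\<infinity>z\<in>A. cnj (b x z) * b y z)" for A x y
  proof -
    have l: "cut A (b y) \<in> l2" by (rule cut_l2[OF b])
    have "l2inner (u (cut A (b y))) (delta x) = l2inner (cut A (b y)) (b x)"
      unfolding b_def by (rule adj[OF l[unfolded b_def] delta_l2])
    then have "cnj (u (cut A (b y)) x) = cnj (l2inner (b x) (cut A (b y)))"
      by (simp add: l2inner_cnj)
    then show ?thesis by (simp add: vop_id b_def[symmetric] l2inner_cut_right)
  qed
  \<comment> \<open>The density, in \<open>z\<close>, of the set function that sends
    \<open>A\<close> to the form of the multiplied matrix of
    \<open>u \<circ> vop A id \<circ> u'\<close> at \<open>\<zeta>\<close> and
    \<open>\<eta>\<close>; \<open>asum\<close> is this statement. The hypothesis \<open>conj\<close>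
    makes its sums over each \<open>A\<close> small, uniformly over unit vectors.\<close>
  define a where "a n F \<zeta> \<eta> z = (\<Sum>x\<in>F. \<Sum>y\<in>F. cnj (\<zeta> x) * ((k n x y - 1) * (cnj (b x z) * b y z)) * \<eta> y)"
    for n F and \<zeta> \<eta> :: "'a vec" and z
  have asum: "(a n F \<zeta> \<eta> has_sum (\<Sum>x\<in>F. \<Sum>y\<in>F. cnj (\<zeta> x) * ((k n x y - 1) * (u \<circ> vop A id \<circ> u') (delta y) x) * \<eta> y)) A"
    for n F and \<zeta> \<eta> :: "'a vec" and A
    unfolding a_def mat
    by (intro has_sum_sum has_sum_cmult_left has_sum_cmult_right has_sum_infsum l2_prod_summable b)
  define Q where "Q n = {a n F \<zeta> \<eta> | F \<zeta> \<eta>. finite F \<and> L2_set (\<lambda>x. cmod (\<zeta> x)) F \<le> 1 \<and> L2_set (\<lambda>x. cmod (\<eta> x)) F \<le> 1}" for n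
  have Qsum: "(\<lambda>x. cmod (c x)) summable_on UNIV" if "c \<in> Q n" for c n
    using that asum[THEN has_sum_imp_summable] unfolding Q_def
    by (auto simp flip: summable_on_iff_abs_summable_on_complex)
  have Qlim: "\<forall>\<^sub>F n in sequentially. \<forall>c\<in>Q n. (\<Sum>\<^sub>\<infinity>x. cmod (c x)) \<le> e" if e: "e > 0" for e
  proof (rule schur_l1_uniform[OF Qsum _ e])
    fix A and d :: real assume d: "d > 0"
    show "\<forall>\<^sub>F n in sequentially. \<forall>c\<in>Q n. cmod (infsum c A) \<le> d"
      using uniform_roe_kernel[OF ulf k conj[of A] d]
    proof (rule eventually_mono, intro ballI)
      fix n c
      assume m: "mbound (\<lambda>x y. (k n x y - 1) * (u \<circ> vop A id \<circ> u') (delta y) x) d" and "c \<in> Q n"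
      then obtain F \<zeta> \<eta> where c: "c = a n F \<zeta> \<eta>" "finite F" "L2_set (\<lambda>x. cmod (\<zeta> x)) F \<le> 1" "L2_set (\<lambda>x. cmod (\<eta> x)) F \<le> 1"
        unfolding Q_def by blast
      have "cmod (infsum c A) \<le> d * (L2_set (\<lambda>x. cmod (\<zeta> x)) F * L2_set (\<lambda>x. cmod (\<eta> x)) F)"
        unfolding c(1) infsumI[OF asum] by (rule mboundD[OF m c(2)])
      also have "\<dots> \<le> d * (1 * 1)"
        using d c(3,4) by (intro mult_left_mono mult_mono) auto
      finally show "cmod (infsum c A) \<le> d" by simp
    qed
  qed
  show ?thesis
  proof (rule uniform_roe_if_kernel[OF ulf k u])
    fix \<epsilon> :: real assume e: "\<epsilon> > 0"
    then have "\<epsilon> / 2 > 0" by simp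
    from Qlim[OF this] obtain n where n: "\<And>c. c \<in> Q n \<Longrightarrow> (\<Sum>\<^sub>\<infinity>x. cmod (c x)) \<le> \<epsilon> / 2"
      unfolding eventually_sequentially by blast
    have "mbound (\<lambda>x y. (k n x y - 1) * u (delta y) x) \<epsilon>"
    proof (rule mbound_unitI)
      fix F :: "'a set" and \<zeta> \<eta> :: "'a vec"
      assume F: "finite F" and \<zeta>: "L2_set (\<lambda>x. cmod (\<zeta> x)) F \<le> 1" and \<eta>: "L2_set (\<lambda>x. cmod (\<eta> x)) F \<le> 1"
      define s where "s B z = (if z \<in> B then -1 else (1::complex))" for B and z :: 'a
      have s: "cmod (s B z) = 1" for B z by (simp add: s_def)
      \<comment> \<open>The modulus of \<open>b y y\<close> is at least 1/2, so dividing by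
        \<open>2 * b y y\<close> keeps \<open>\<eta>'\<close> pointwise below \<open>\<eta>\<close>.
        The factor 2 returns at the end in \<open>2 * ?G\<close>, which is why \<epsilon>/2 was
        requested.\<close>
      define \<eta>' where "\<eta>' y = \<eta> y / (2 * b y y)" for y
      have by0: "cmod (b y y) \<ge> 1 / 2" for y
      proof -
        have "cmod (b y y) = cmod (u (delta y) y)" by (simp add: bt)
        then show ?thesis
          using diag[of y] norm_triangle_ineq2[of 1 "u (delta y) y"] norm_minus_commute[of "1::complex" "u (delta y) y"] by simp
      qed
      have \<eta>e: "\<eta> y = 2 * b y y * \<eta>' y" for y
        using by0[of y] by (auto simp: \<eta>'_def)
      have \<eta>'le: "cmod (\<eta>' y) \<le> cmod (\<eta> y)" for y
      proof -
        have "1 * cmod (\<eta>' y) \<le> (2 * cmod (b y y)) * cmod (\<eta>' y)"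
          using by0[of y] by (intro mult_right_mono) auto
        then show ?thesis unfolding \<eta>e[of y] by (simp add: norm_mult)
      qed
      have aQ: "a n F \<zeta> (\<lambda>y. s B y * \<eta>' y) \<in> Q n" for B
      proof -
        have "L2_set (\<lambda>x. cmod (s B x * \<eta>' x)) F \<le> L2_set (\<lambda>x. cmod (\<eta> x)) F"
          by (rule L2_set_mono) (auto simp: norm_mult s \<eta>'le)
        then have "L2_set (\<lambda>x. cmod (s B x * \<eta>' x)) F \<le> 1" using \<eta> by linarith
        with F \<zeta> show ?thesis unfolding Q_def by blast
      qed
      \<comment> \<open>The terms with z = y: there \<open>cnj (b x y)\<close> is the entry of
        \<open>u\<close> at (x, y), and \<open>b y y\<close> cancels against the denominator of
        \<open>\<eta>'\<close>, so this is half of the form to be estimated.\<close>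
      let ?G = "\<Sum>x\<in>F. \<Sum>y\<in>F. cnj (\<zeta> x) * ((k n x y - 1) * (cnj (b x y) * b y y)) * \<eta>' y"
      have orth: "(\<Sum>B\<in>Pow F. s B z * s B y) = (if y = z then 2 ^ card F else 0)" if "y \<in> F" for y z
      proof (cases "y = z")
        case True
        have "s B z * s B z = 1" for B by (simp add: s_def)
        then show ?thesis using True F by (simp add: card_Pow)
      next
        case False
        then show ?thesis using sum_signs_orthogonal[OF F that, of z] by (simp add: s_def)
      qed
      \<comment> \<open>The sign at \<open>z\<close> belongs to the sign matrix between
        \<open>u\<close> and its adjoint, the sign at \<open>y\<close> to the one on the right;
        summing over all \<open>B\<close> leaves only y = z.\<close>
      have inner: "(\<Sum>B\<in>Pow F. s B z * a n F \<zeta> (\<lambda>y. s B y * \<eta>' y) z)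
          = 2 ^ card F * (\<Sum>x\<in>F. cnj (\<zeta> x) * ((k n x z - 1) * (cnj (b x z) * b z z)) * \<eta>' z)" if z: "z \<in> F" for z
      proof -
        have "(\<Sum>B\<in>Pow F. s B z * a n F \<zeta> (\<lambda>y. s B y * \<eta>' y) z)
          = (\<Sum>B\<in>Pow F. \<Sum>x\<in>F. \<Sum>y\<in>F. (s B z * s B y) * (cnj (\<zeta> x) * ((k n x y - 1) * (cnj (b x z) * b y z)) * \<eta>' y))"
          unfolding a_def sum_distrib_left by (intro sum.cong refl) (simp only: mult_ac)
        also have "\<dots> = (\<Sum>x\<in>F. \<Sum>B\<in>Pow F. \<Sum>y\<in>F. (s B z * s B y) * (cnj (\<zeta> x) * ((k n x y - 1) * (cnj (b x z) * b y z)) * \<eta>' y))"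
          by (rule sum.swap)
        also have "\<dots> = (\<Sum>x\<in>F. \<Sum>y\<in>F. \<Sum>B\<in>Pow F. (s B z * s B y) * (cnj (\<zeta> x) * ((k n x y - 1) * (cnj (b x z) * b y z)) * \<eta>' y))"
          by (intro sum.cong refl sum.swap)
        also have "\<dots> = (\<Sum>x\<in>F. \<Sum>y\<in>F. if y = z then 2 ^ card F * (cnj (\<zeta> x) * ((k n x y - 1) * (cnj (b x z) * b y z)) * \<eta>' y) else 0)"
          unfolding sum_distrib_right[symmetric] by (intro sum.cong refl) (simp add: orth)
        also have "\<dots> = (\<Sum>x\<in>F. 2 ^ card F * (cnj (\<zeta> x) * ((k n x z - 1) * (cnj (b x z) * b z z)) * \<eta>' z))"
          using F z by simp
        finally show ?thesis by (simp only: sum_distrib_left)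
      qed
      have "2 ^ card F * ?G = (\<Sum>z\<in>F. 2 ^ card F * (\<Sum>x\<in>F. cnj (\<zeta> x) * ((k n x z - 1) * (cnj (b x z) * b z z)) * \<eta>' z))"
        unfolding sum_distrib_left[symmetric] by (subst sum.swap) (rule refl)
      also have "\<dots> = (\<Sum>z\<in>F. \<Sum>B\<in>Pow F. s B z * a n F \<zeta> (\<lambda>y. s B y * \<eta>' y) z)"
        by (intro sum.cong refl inner[symmetric])
      also have "\<dots> = (\<Sum>B\<in>Pow F. \<Sum>z\<in>F. s B z * a n F \<zeta> (\<lambda>y. s B y * \<eta>' y) z)" by (rule sum.swap)
      finally have "cmod (2 ^ card F * ?G) \<le> (\<Sum>B\<in>Pow F. cmod (\<Sum>z\<in>F. s B z * a n F \<zeta> (\<lambda>y. s B y * \<eta>' y) z))"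
        by (simp only: norm_sum)
      also have "\<dots> \<le> (\<Sum>B\<in>Pow F. \<epsilon> / 2)"
      proof (rule sum_mono)
        fix B
        \<comment> \<open>The signs have modulus 1, so one l1 bound serves every \<open>B\<close>;
          sums over individual subsets would give an index \<open>n\<close> depending on
          \<open>B\<close>.\<close>
        have "cmod (\<Sum>z\<in>F. s B z * a n F \<zeta> (\<lambda>y. s B y * \<eta>' y) z) \<le> (\<Sum>z\<in>F. cmod (a n F \<zeta> (\<lambda>y. s B y * \<eta>' y) z))"
          by (rule order_trans[OF norm_sum]) (simp add: norm_mult s)
        also have "\<dots> \<le> (\<Sum>\<^sub>\<infinity>z. cmod (a n F \<zeta> (\<lambda>y. s B y * \<eta>' y) z))"
          by (rule finite_sum_le_infsum[OF Qsum[OF aQ] F]) auto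
        also have "\<dots> \<le> \<epsilon> / 2" by (rule n[OF aQ])
        finally show "cmod (\<Sum>z\<in>F. s B z * a n F \<zeta> (\<lambda>y. s B y * \<eta>' y) z) \<le> \<epsilon> / 2" .
      qed
      also have "\<dots> = 2 ^ card F * (\<epsilon> / 2)" using F by (simp add: card_Pow)
      finally have "2 ^ card F * cmod ?G \<le> 2 ^ card F * (\<epsilon> / 2)"
        by (simp only: norm_mult norm_power norm_numeral)
      then have G: "cmod ?G \<le> \<epsilon> / 2" by (simp only: mult_le_cancel_left_pos zero_less_power zero_less_numeral)
      have "(\<Sum>x\<in>F. \<Sum>y\<in>F. cnj (\<zeta> x) * ((k n x y - 1) * u (delta y) x) * \<eta> y) = 2 * ?G"
        unfolding sum_distrib_left by (intro sum.cong refl) (simp add: \<eta>e bt)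
      then show "cmod (\<Sum>x\<in>F. \<Sum>y\<in>F. cnj (\<zeta> x) * ((k n x y - 1) * u (delta y) x) * \<eta> y) \<le> \<epsilon>"
        using G by (simp only: norm_mult norm_numeral)
    qed (use e in simp)
    then show "\<exists>n. mbound (\<lambda>x y. (k n x y - 1) * u (delta y) x) \<epsilon>" by blast
  qed
qed

subsection \<open>Commutators of coarse operators with finite projections\<close>

lemma linear_op_onD:
  assumes "linear_op_on D H"
  shows linear_op_on_sub: "D \<subseteq> l2" and linear_op_on_l2: "\<xi> \<in> D \<Longrightarrow> \<xi> \<in> l2" "\<xi> \<in> D \<Longrightarrow> H \<xi> \<in> l2"
    and linear_op_on_lin: "\<xi> \<in> D \<Longrightarrow> \<eta> \<in> D \<Longrightarrow> (\<lambda>x. \<xi> x + c * \<eta> x) \<in> D"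
  using assms unfolding linear_op_on_def by blast+

lemma self_adjoint_opD:
  assumes "self_adjoint_op D H"
  shows self_adjoint_linear: "linear_op_on D H"
    and self_adjoint_dense: "\<xi> \<in> l2 \<Longrightarrow> \<epsilon> > 0 \<Longrightarrow> \<exists>\<eta>\<in>D. l2norm (\<lambda>x. \<xi> x - \<eta> x) < \<epsilon>"
    and self_adjoint_sym: "\<xi> \<in> D \<Longrightarrow> \<eta> \<in> D \<Longrightarrow> l2inner (H \<xi>) \<eta> = l2inner \<xi> (H \<eta>)"
  using assms unfolding self_adjoint_op_def by blast+

lemma coarse_op_cut:
  assumes "coarse_op D H" "\<xi> \<in> D"
  shows "cut A \<xi> \<in> D"
proof -
  have "vop A id ` D \<subseteq> D"
    using assms(1) partial_translation_id unfolding coarse_op_def by blast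
  then show ?thesis using assms(2) unfolding vop_id by blast
qed

lemma coarse_op_cut_bound:
  assumes "coarse_op D H"
  obtains C where "C \<ge> 0" "\<And>\<xi>. \<xi> \<in> D \<Longrightarrow> l2norm (\<lambda>x. H (cut A \<xi>) x - cut A (H \<xi>) x) \<le> C * l2norm \<xi>"
proof -
  obtain C where C: "\<forall>\<xi>\<in>D. l2norm (\<lambda>x. H (vop A id \<xi>) x - vop A id (H \<xi>) x) \<le> C * l2norm \<xi>"
    using assms partial_translation_id[of A] unfolding coarse_op_def by blast
  have "l2norm (\<lambda>x. H (cut A \<xi>) x - cut A (H \<xi>) x) \<le> max C 0 * l2norm \<xi>" if "\<xi> \<in> D" for \<xi>
    by (rule order_trans[OF C[unfolded vop_id, rule_format, OF that] mult_right_mono]) auto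
  then show ?thesis using that[of "max C 0"] by simp
qed

text \<open>By density some domain vector is nonzero at \<open>x\<close>. Cutting it to {x} stays in
  the domain by coarseness and yields a nonzero multiple of \<open>delta x\<close>.\<close>

lemma c00_subset_coarse_domain:
  assumes sa: "self_adjoint_op D H" and co: "coarse_op D H"
  shows "c00 \<subseteq> D"
proof -
  note lin = self_adjoint_linear[OF sa]
  have del: "(\<lambda>y. c * delta x y) \<in> D" for c x
  proof -
    have "(1::real) / 2 > 0" by simp
    from self_adjoint_dense[OF sa delta_l2 this] obtain \<eta>
      where \<eta>: "\<eta> \<in> D" "l2norm (\<lambda>y. delta x y - \<eta> y) < 1 / 2" by blast
    have "(\<lambda>y. delta x y - \<eta> y) \<in> l2" by (rule l2_diff[OF delta_l2 linear_op_on_l2(1)[OF lin \<eta>(1)]])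
    from cmod_le_l2norm[OF this, of x] \<eta>(2) have "cmod (1 - \<eta> x) < 1 / 2"
      by (simp add: delta_def)
    then have nz: "\<eta> x \<noteq> 0" by auto
    have cD: "cut {x} \<eta> \<in> D" by (rule coarse_op_cut[OF co \<eta>(1)])
    \<comment> \<open>The domain is closed under \<xi> + c \<eta>, so a scalar multiple is written
      as a vector plus a multiple of itself; hence the coefficient
      \<open>c / \<eta> x - 1\<close>.\<close>
    have "(\<lambda>y. c * delta x y) = (\<lambda>y. cut {x} \<eta> y + (c / \<eta> x - 1) * cut {x} \<eta> y)"
      using nz by (auto simp: delta_def cut_def field_simps intro!: ext)
    then show ?thesis using linear_op_on_lin[OF lin cD cD] by simp
  qed
  have "cut F \<xi> \<in> D" if "finite F" for F and \<xi> :: "'a vec"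
    using that
  proof (induction F)
    case empty
    have "cut {} \<xi> = (\<lambda>y. 0 * delta x y)" for x by (auto simp: cut_def)
    then show ?case using del by metis
  next
    case (insert z F)
    have "cut (insert z F) \<xi> = (\<lambda>x. cut F \<xi> x + 1 * (\<xi> z * delta z x))"
      using insert.hyps by (auto simp: cut_def delta_def intro!: ext)
    then show ?case using linear_op_on_lin[OF lin insert.IH del, of 1] by simp
  qed
  then have *: "cut {x. \<xi> x \<noteq> 0} \<xi> \<in> D" if "\<xi> \<in> c00" for \<xi>
    using that by (simp add: c00_def)
  have "cut {x. \<xi> x \<noteq> 0} \<xi> = \<xi>" for \<xi> :: "'a vec" by (auto simp: cut_def)
  then show ?thesis using * by auto
qed

text \<open>For \<open>\<eta>, \<xi>\<close> in the domain, \<open>A \<mapsto> \<langle>[h, \<chi>\<^sub>A] \<eta>, \<xi>\<rangle>\<close> is a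
  countably additive measure on the index set, so Nikodym's theorem applies.\<close>
lemma coarse_op_cut_uniform_bound:
  assumes sa: "self_adjoint_op D H" and co: "coarse_op D H"
  obtains C where "C \<ge> 0"
    "\<And>F \<eta>. \<eta> \<in> D \<Longrightarrow> l2norm (\<lambda>x. H (cut F \<eta>) x - cut F (H \<eta>) x) \<le> C * l2norm \<eta>"
proof -
  note lin = self_adjoint_linear[OF sa]
  note l = linear_op_on_l2[OF lin]
  \<comment> \<open>Symmetry moves \<open>H\<close> from \<open>cut A \<eta>\<close> onto
    \<open>\<xi>\<close>. What remains involves \<open>A\<close> only as the range of summation, so
    the commutator form acquires a density.\<close>
  define a where "a \<eta> \<xi> x = cnj (H \<eta> x) * \<xi> x - cnj (\<eta> x) * H \<xi> x" for \<eta> \<xi> x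
  have asum: "(a \<eta> \<xi> has_sum (l2inner (cut A (H \<eta>)) \<xi> - l2inner (H (cut A \<eta>)) \<xi>)) A"
    if \<eta>: "\<eta> \<in> D" and \<xi>: "\<xi> \<in> D" for \<eta> \<xi> A
  proof -
    have "((\<lambda>x. cnj (H \<eta> x) * \<xi> x + - (cnj (\<eta> x) * H \<xi> x)) has_sum
        (l2inner (cut A (H \<eta>)) \<xi> + - l2inner (cut A \<eta>) (H \<xi>))) A"
      unfolding l2inner_cut
      by (intro has_sum_add has_sum_uminusI has_sum_infsum l2_prod_summable l \<eta> \<xi>)
    then show ?thesis
      unfolding a_def self_adjoint_sym[OF sa coarse_op_cut[OF co \<eta>] \<xi>] by simp
  qed
  \<comment> \<open>The weight \<open>w\<close> normalises \<open>\<eta>\<close> and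
    \<open>\<xi>\<close> without a division and so covers vectors of norm 0 as well.\<close>
  define Q where "Q = {(\<lambda>x. complex_of_real w * a \<eta> \<xi> x) | w \<eta> \<xi>. \<eta> \<in> D \<and> \<xi> \<in> D \<and> w \<ge> 0 \<and> w * (l2norm \<eta> * l2norm \<xi>) \<le> 1}"
  have "\<exists>C. \<forall>c\<in>Q. (\<Sum>\<^sub>\<infinity>x. cmod (c x)) \<le> C"
  proof (rule nikodym_boundedness)
    fix c assume "c \<in> Q"
    then obtain w \<eta> \<xi> where c: "c = (\<lambda>x. complex_of_real w * a \<eta> \<xi> x)" "\<eta> \<in> D" "\<xi> \<in> D" unfolding Q_def by blast
    have "c summable_on UNIV"
      unfolding c(1) by (rule summable_on_cmult_right[OF has_sum_imp_summable[OF asum[OF c(2,3)]]])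
    then show "(\<lambda>x. cmod (c x)) summable_on UNIV"
      by (simp only: summable_on_iff_abs_summable_on_complex)
  next
    fix A
    obtain C where C: "C \<ge> 0" "\<And>\<xi>. \<xi> \<in> D \<Longrightarrow> l2norm (\<lambda>x. H (cut A \<xi>) x - cut A (H \<xi>) x) \<le> C * l2norm \<xi>"
      by (rule coarse_op_cut_bound[OF co, of A]) blast
    have "cmod (infsum c A) \<le> C" if cQ: "c \<in> Q" for c
    proof -
      obtain w \<eta> \<xi> where c: "c = (\<lambda>x. complex_of_real w * a \<eta> \<xi> x)" "\<eta> \<in> D" "\<xi> \<in> D"
          "w \<ge> 0" "w * (l2norm \<eta> * l2norm \<xi>) \<le> 1" using cQ unfolding Q_def by blast
      note m = l(2)[OF coarse_op_cut[OF co c(2)]] cut_l2[OF l(2)[OF c(2)]] l(1)[OF c(3)]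
      have "infsum (a \<eta> \<xi>) A = - l2inner (\<lambda>x. H (cut A \<eta>) x - cut A (H \<eta>) x) \<xi>"
        unfolding infsumI[OF asum[OF c(2,3)]] by (subst l2inner_diff_left[OF m]) simp
      then have "cmod (infsum (a \<eta> \<xi>) A) \<le> l2norm (\<lambda>x. H (cut A \<eta>) x - cut A (H \<eta>) x) * l2norm \<xi>"
        using l2inner_cauchy_schwarz[OF l2_diff[OF m(1,2)] m(3)] by simp
      also have "\<dots> \<le> C * l2norm \<eta> * l2norm \<xi>" by (rule mult_right_mono[OF C(2)[OF c(2)]]) simp
      finally have 1: "cmod (infsum (a \<eta> \<xi>) A) \<le> C * l2norm \<eta> * l2norm \<xi>" .
      have "cmod (infsum c A) = w * cmod (infsum (a \<eta> \<xi>) A)"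
        unfolding c(1) infsum_cmult_right' norm_mult norm_of_real using c(4) by simp
      also have "\<dots> \<le> w * (C * l2norm \<eta> * l2norm \<xi>)" by (rule mult_left_mono[OF 1 c(4)])
      also have "\<dots> = C * (w * (l2norm \<eta> * l2norm \<xi>))" by (simp only: mult_ac)
      also have "\<dots> \<le> C * 1" by (rule mult_left_mono[OF c(5) C(1)])
      finally show ?thesis by simp
    qed
    then show "\<exists>C. \<forall>c\<in>Q. cmod (infsum c A) \<le> C" by blast
  qed
  then obtain C0 where C0: "\<And>c. c \<in> Q \<Longrightarrow> (\<Sum>\<^sub>\<infinity>x. cmod (c x)) \<le> C0" by blast
  define C where "C = max C0 0"
  have C: "C \<ge> 0" "\<And>c. c \<in> Q \<Longrightarrow> (\<Sum>\<^sub>\<infinity>x. cmod (c x)) \<le> C" using C0 by (auto simp: C_def intro: max.coboundedI1)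
  have w: "w * cmod (infsum (a \<eta> \<xi>) A) \<le> C" if "\<eta> \<in> D" "\<xi> \<in> D" "w \<ge> 0" "w * (l2norm \<eta> * l2norm \<xi>) \<le> 1" for w \<eta> \<xi> A
  proof -
    let ?c = "\<lambda>x. complex_of_real w * a \<eta> \<xi> x"
    have cQ: "?c \<in> Q" using that unfolding Q_def by blast
    have s: "(\<lambda>x. cmod (?c x)) summable_on B" for B
    proof -
      have "?c summable_on B"
        by (rule summable_on_cmult_right[OF has_sum_imp_summable[OF asum[OF that(1,2)]]])
      then show ?thesis by (simp only: summable_on_iff_abs_summable_on_complex)
    qed
    have "w * cmod (infsum (a \<eta> \<xi>) A) = cmod (infsum ?c A)"
      unfolding infsum_cmult_right' norm_mult norm_of_real using that(3) by simp
    also have "\<dots> \<le> (\<Sum>\<^sub>\<infinity>x\<in>A. cmod (?c x))" by (rule norm_infsum_bound[OF s])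
    also have "\<dots> \<le> (\<Sum>\<^sub>\<infinity>x. cmod (?c x))" by (rule infsum_mono2[OF s s]) auto
    also have "\<dots> \<le> C" by (rule C(2)[OF cQ])
    finally show ?thesis .
  qed
  have b: "cmod (infsum (a \<eta> \<xi>) A) \<le> C * (l2norm \<eta> * l2norm \<xi>)" if \<eta>: "\<eta> \<in> D" and \<xi>: "\<xi> \<in> D" for \<eta> \<xi> A
  proof (cases "l2norm \<eta> * l2norm \<xi> = 0")
    case True
    have "cmod (infsum (a \<eta> \<xi>) A) = 0"
    proof (rule ccontr)
      assume "cmod (infsum (a \<eta> \<xi>) A) \<noteq> 0"
      then have p: "cmod (infsum (a \<eta> \<xi>) A) > 0" by simp
      \<comment> \<open>When the product of the norms is 0, every nonnegative weight is admissible;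
        this one makes the left side equal to \<open>C + 1\<close>.\<close>
      have "(C + 1) / cmod (infsum (a \<eta> \<xi>) A) * cmod (infsum (a \<eta> \<xi>) A) \<le> C"
      proof (rule w[OF \<eta> \<xi>])
        show "0 \<le> (C + 1) / cmod (infsum (a \<eta> \<xi>) A)" using C(1) by simp
        show "(C + 1) / cmod (infsum (a \<eta> \<xi>) A) * (l2norm \<eta> * l2norm \<xi>) \<le> 1" unfolding True by simp
      qed
      then show False using p by simp
    qed
    then show ?thesis unfolding True by simp
  next
    case False
    then have p: "l2norm \<eta> * l2norm \<xi> > 0" by (simp add: order.strict_iff_order)
    have "1 / (l2norm \<eta> * l2norm \<xi>) * cmod (infsum (a \<eta> \<xi>) A) \<le> C"
      by (rule w[OF \<eta> \<xi>]) (use p in \<open>simp_all add: less_imp_le\<close>)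
    then show ?thesis using p by (simp add: pos_divide_le_eq)
  qed
  show ?thesis
  proof (rule that[OF C(1)])
    fix F and \<eta> :: "'a vec" assume \<eta>: "\<eta> \<in> D"
    note m = l(2)[OF coarse_op_cut[OF co \<eta>]] cut_l2[OF l(2)[OF \<eta>]]
    show "l2norm (\<lambda>x. H (cut F \<eta>) x - cut F (H \<eta>) x) \<le> C * l2norm \<eta>"
    proof (rule l2norm_le_by_inner[OF l2_diff[OF m] linear_op_on_sub[OF lin] self_adjoint_dense[OF sa]])
      fix \<xi> :: "'a vec" assume \<xi>: "\<xi> \<in> D"
      have "infsum (a \<eta> \<xi>) F = - l2inner (\<lambda>x. H (cut F \<eta>) x - cut F (H \<eta>) x) \<xi>"
        unfolding infsumI[OF asum[OF \<eta> \<xi>]] by (subst l2inner_diff_left[OF m l(1)[OF \<xi>]]) simp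
      then have "cmod (l2inner (\<lambda>x. H (cut F \<eta>) x - cut F (H \<eta>) x) \<xi>) \<le> C * (l2norm \<eta> * l2norm \<xi>)"
        using b[OF \<eta> \<xi>, of F] by simp
      then show "cmod (l2inner \<xi> (\<lambda>x. H (cut F \<eta>) x - cut F (H \<eta>) x)) \<le> C * l2norm \<eta> * l2norm \<xi>"
        by (subst l2inner_cnj[symmetric]) (simp add: mult.assoc)
    qed (use C(1) in simp_all)
  qed
qed

lemma l2inner_cut_tendsto:
  assumes "\<eta> \<in> l2" "\<xi> \<in> l2"
  shows "((\<lambda>F. l2inner (cut F \<eta>) \<xi>) \<longlongrightarrow> l2inner \<eta> \<xi>) (finite_subsets_at_top UNIV)"
proof -
  have "(sum (\<lambda>x. cnj (\<eta> x) * \<xi> x) \<longlongrightarrow> l2inner \<eta> \<xi>) (finite_subsets_at_top UNIV)"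
    unfolding l2inner_def by (rule infsum_tendsto[OF l2_prod_summable[OF assms]])
  moreover have "\<forall>\<^sub>F F in finite_subsets_at_top UNIV. sum (\<lambda>x. cnj (\<eta> x) * \<xi> x) F = l2inner (cut F \<eta>) \<xi>"
    by (rule eventually_finite_subsets_at_top_weakI) (simp add: l2inner_cut)
  ultimately show ?thesis by (rule Lim_transform_eventually)
qed

text \<open>Let c be the truncation of \<open>\<eta>\<close> to a finite \<open>F\<close>. As c lies
  in both domains, <cut F (H \<eta>), \<xi>> - <c, K \<xi>> equals <(H - K) c, \<xi>> minus the
  commutator of \<open>H\<close> with \<open>cut F\<close> tested on \<open>\<eta>\<close> and
  \<open>\<xi>\<close>. The hypothesis on \<open>c00\<close> bounds the former and Nikodym's theorem
  the latter, both uniformly in \<open>F\<close>, so the bound survives the limit.\<close>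

lemma coarse_difference_form_bound:
  assumes saH: "self_adjoint_op DH H" and coH: "coarse_op DH H"
    and saK: "self_adjoint_op DK K" and coK: "coarse_op DK K"
    and HK: "\<exists>C. \<forall>\<xi>\<in>c00. l2norm (\<lambda>x. H \<xi> x - K \<xi> x) \<le> C * l2norm \<xi>"
  obtains C where "C \<ge> 0" "\<And>\<eta> \<xi>. \<eta> \<in> DH \<Longrightarrow> \<xi> \<in> DK \<Longrightarrow>
    cmod (l2inner (H \<eta>) \<xi> - l2inner \<eta> (K \<xi>)) \<le> C * (l2norm \<eta> * l2norm \<xi>)"
proof -
  note lH = linear_op_on_l2[OF self_adjoint_linear[OF saH]]
    and lK = linear_op_on_l2[OF self_adjoint_linear[OF saK]]
  note cH = c00_subset_coarse_domain[OF saH coH] and cK = c00_subset_coarse_domain[OF saK coK]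
  obtain C1 where C1: "C1 \<ge> 0"
    "\<And>F \<eta>. \<eta> \<in> DH \<Longrightarrow> l2norm (\<lambda>x. H (cut F \<eta>) x - cut F (H \<eta>) x) \<le> C1 * l2norm \<eta>"
    by (rule coarse_op_cut_uniform_bound[OF saH coH]) blast
  obtain C0 where C0: "\<And>\<xi>. \<xi> \<in> c00 \<Longrightarrow> l2norm (\<lambda>x. H \<xi> x - K \<xi> x) \<le> C0 * l2norm \<xi>" using HK by blast
  define C2 where "C2 = max C0 0"
  have C2: "C2 \<ge> 0" "l2norm (\<lambda>x. H \<xi> x - K \<xi> x) \<le> C2 * l2norm \<xi>" if "\<xi> \<in> c00" for \<xi>
    using order_trans[OF C0[OF that] mult_right_mono[of C0 C2 "l2norm \<xi>"]] by (auto simp: C2_def)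
  have C2p: "C2 \<ge> 0" by (simp add: C2_def)
  show ?thesis
  proof (rule that[of "C1 + C2"])
    show "C1 + C2 \<ge> 0" using C1(1) C2p by simp
    fix \<eta> \<xi> assume \<eta>: "\<eta> \<in> DH" and \<xi>: "\<xi> \<in> DK"
    have fin: "cmod (l2inner (cut F (H \<eta>)) \<xi> - l2inner (cut F \<eta>) (K \<xi>)) \<le> (C1 + C2) * (l2norm \<eta> * l2norm \<xi>)"
      if F: "finite F" for F
    proof -
      let ?c = "cut F \<eta>"
      have c: "?c \<in> c00" by (rule cut_c00[OF F])
      have cDH: "?c \<in> DH" and cDK: "?c \<in> DK" using c cH cK by (auto dest: subsetD)
      note m = lH(2)[OF cDH] cut_l2[OF lH(2)[OF \<eta>], of F] lK(2)[OF cDK] lK(1)[OF \<xi>]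
      have "l2inner (cut F (H \<eta>)) \<xi> - l2inner (cut F \<eta>) (K \<xi>) = l2inner (cut F (H \<eta>)) \<xi> - l2inner (K ?c) \<xi>"
        using self_adjoint_sym[OF saK cDK \<xi>] by simp
      also have "\<dots> = l2inner (\<lambda>x. H ?c x - K ?c x) \<xi> - l2inner (\<lambda>x. H ?c x - cut F (H \<eta>) x) \<xi>"
        unfolding l2inner_diff_left[OF m(1,3,4)] l2inner_diff_left[OF m(1,2,4)] by simp
      finally have "cmod (l2inner (cut F (H \<eta>)) \<xi> - l2inner (cut F \<eta>) (K \<xi>)) \<le>
          cmod (l2inner (\<lambda>x. H ?c x - K ?c x) \<xi>) + cmod (l2inner (\<lambda>x. H ?c x - cut F (H \<eta>) x) \<xi>)"
        by (simp only: norm_triangle_ineq4)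
      also have "\<dots> \<le> l2norm (\<lambda>x. H ?c x - K ?c x) * l2norm \<xi> + l2norm (\<lambda>x. H ?c x - cut F (H \<eta>) x) * l2norm \<xi>"
        by (intro add_mono l2inner_cauchy_schwarz l2_diff m)
      also have "\<dots> \<le> C2 * l2norm \<eta> * l2norm \<xi> + C1 * l2norm \<eta> * l2norm \<xi>"
      proof (intro add_mono mult_right_mono)
        show "l2norm (\<lambda>x. H ?c x - K ?c x) \<le> C2 * l2norm \<eta>"
          by (rule order_trans[OF C2(2)[OF c] mult_left_mono[OF l2norm_cut[OF lH(1)[OF \<eta>]] C2p]])
        show "l2norm (\<lambda>x. H ?c x - cut F (H \<eta>) x) \<le> C1 * l2norm \<eta>" by (rule C1(2)[OF \<eta>])
      qed simp_all
      finally show ?thesis by (simp add: algebra_simps)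
    qed
    have "((\<lambda>F. cmod (l2inner (cut F (H \<eta>)) \<xi> - l2inner (cut F \<eta>) (K \<xi>))) \<longlongrightarrow>
        cmod (l2inner (H \<eta>) \<xi> - l2inner \<eta> (K \<xi>))) (finite_subsets_at_top UNIV)"
      by (intro tendsto_norm tendsto_diff l2inner_cut_tendsto lH lK \<eta> \<xi>)
    then show "cmod (l2inner (H \<eta>) \<xi> - l2inner \<eta> (K \<xi>)) \<le> (C1 + C2) * (l2norm \<eta> * l2norm \<xi>)"
      by (rule tendsto_upperbound) (auto intro!: eventually_finite_subsets_at_top_weakI fin)
  qed
qed

subsection \<open>Comparison of unitary groups\<close>

lemma exp_groupD:
  assumes "exp_group U D H"
  shows exp_group_bounded: "bounded_op (U t)"
    and exp_group_norm: "\<xi> \<in> l2 \<Longrightarrow> l2norm (U t \<xi>) = l2norm \<xi>"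
    and exp_group_0: "\<xi> \<in> l2 \<Longrightarrow> U 0 \<xi> = \<xi>"
    and exp_group_add: "\<xi> \<in> l2 \<Longrightarrow> U (s + t) \<xi> = U s (U t \<xi>)"
    and exp_group_cont: "\<xi> \<in> l2 \<Longrightarrow> ((\<lambda>t. l2norm (\<lambda>x. U t \<xi> x - U s \<xi> x)) \<longlongrightarrow> 0) (at s)"
    and exp_group_domI: "\<xi> \<in> l2 \<Longrightarrow> \<eta> \<in> l2 \<Longrightarrow>
      ((\<lambda>t. l2norm (\<lambda>x. (U t \<xi> x - \<xi> x) / complex_of_real t - \<eta> x)) \<longlongrightarrow> 0) (at 0) \<Longrightarrow> \<xi> \<in> D"
    and exp_group_gen: "\<xi> \<in> D \<Longrightarrow>
      ((\<lambda>t. l2norm (\<lambda>x. (U t \<xi> x - \<xi> x) / complex_of_real t - \<i> * H \<xi> x)) \<longlongrightarrow> 0) (at 0)"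
  using assms unfolding exp_group_def by blast+

lemma exp_group_l2: "exp_group U D H \<Longrightarrow> \<xi> \<in> l2 \<Longrightarrow> U t \<xi> \<in> l2"
  by (rule bounded_op_l2[OF exp_group_bounded])

lemma exp_group_cancel:
  assumes U: "exp_group U D H" and \<xi>: "\<xi> \<in> l2"
  shows "U t (U (- t) \<xi>) = \<xi>" "U (- t) (U t \<xi>) = \<xi>"
  using exp_group_add[OF U \<xi>, of t "- t"] exp_group_add[OF U \<xi>, of "- t" t] exp_group_0[OF U \<xi>] by simp_all

lemma exp_group_inner:
  assumes U: "exp_group U D H" and \<xi>: "\<xi> \<in> l2" and \<eta>: "\<eta> \<in> l2"
  shows "l2inner (U t \<xi>) (U t \<eta>) = l2inner \<xi> \<eta>"
proof -
  have "l2norm (\<lambda>x. U t \<xi> x + c * U t \<eta> x) = l2norm (\<lambda>x. \<xi> x + c * \<eta> x)" for c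
    using exp_group_norm[OF U l2_lin[OF \<xi> \<eta>], of t c]
    unfolding bounded_op_lin[OF exp_group_bounded[OF U] \<xi> \<eta>] .
  then have "4 * l2inner (U t \<xi>) (U t \<eta>) = 4 * l2inner \<xi> \<eta>"
    unfolding l2inner_polarization[OF exp_group_l2[OF U \<xi>] exp_group_l2[OF U \<eta>]] l2inner_polarization[OF \<xi> \<eta>]
    by (simp only:)
  then show ?thesis by simp
qed

lemma exp_group_adj:
  assumes U: "exp_group U D H" and \<xi>: "\<xi> \<in> l2" and \<eta>: "\<eta> \<in> l2"
  shows "l2inner (U t \<xi>) \<eta> = l2inner \<xi> (U (- t) \<eta>)"
  using exp_group_inner[OF U \<xi> exp_group_l2[OF U \<eta>], of t "- t"]
  unfolding exp_group_cancel(1)[OF U \<eta>] .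

text \<open>\<open>U t\<close> commutes with the difference quotients and is isometric, so it
  carries the derivative at \<open>\<xi>\<close> to one at \<open>U t \<xi>\<close>; existence of
  that derivative characterises the domain.\<close>

lemma exp_group_invariant:
  assumes U: "exp_group U D H" and lin: "linear_op_on D H" and \<xi>: "\<xi> \<in> D"
  shows "U t \<xi> \<in> D"
proof -
  note l = linear_op_on_l2[OF lin \<xi>]
  let ?\<eta> = "\<lambda>x. \<i> * H \<xi> x"
  have \<eta>: "?\<eta> \<in> l2" by (rule l2_scale[OF l(2)])
  note bU = exp_group_bounded[OF U, of t]
  have "l2norm (\<lambda>x. (U s (U t \<xi>) x - U t \<xi> x) / complex_of_real s - U t ?\<eta> x) =
      l2norm (\<lambda>x. (U s \<xi> x - \<xi> x) / complex_of_real s - \<i> * H \<xi> x)" for s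
  proof -
    let ?d = "\<lambda>x. inverse (complex_of_real s) * (U s \<xi> x - \<xi> x)"
    have Us: "U s \<xi> \<in> l2" by (rule exp_group_l2[OF U l(1)])
    have d: "?d \<in> l2" by (rule l2_scale[OF l2_diff[OF Us l(1)]])
    have c: "U s (U t \<xi>) = U t (U s \<xi>)"
      using exp_group_add[OF U l(1), of s t] exp_group_add[OF U l(1), of t s] by (simp add: add.commute)
    have Ud: "U t ?d = (\<lambda>x. inverse (complex_of_real s) * (U s (U t \<xi>) x - U t \<xi> x))"
      unfolding bounded_op_scale[OF bU l2_diff[OF Us l(1)]] bounded_op_diff[OF bU Us l(1)] c by (rule refl)
    have "U t (\<lambda>x. ?d x - ?\<eta> x) = (\<lambda>x. (U s (U t \<xi>) x - U t \<xi> x) / complex_of_real s - U t ?\<eta> x)"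
      unfolding bounded_op_diff[OF bU d \<eta>] Ud by (simp add: divide_inverse mult.commute)
    moreover have "(\<lambda>x. ?d x - ?\<eta> x) = (\<lambda>x. (U s \<xi> x - \<xi> x) / complex_of_real s - \<i> * H \<xi> x)"
      by (simp add: divide_inverse mult.commute)
    ultimately show ?thesis using exp_group_norm[OF U l2_diff[OF d \<eta>], of t] by simp
  qed
  then have "((\<lambda>s. l2norm (\<lambda>x. (U s (U t \<xi>) x - U t \<xi> x) / complex_of_real s - U t ?\<eta> x)) \<longlongrightarrow> 0) (at 0)"
    using exp_group_gen[OF U \<xi>] by simp
  then show ?thesis by (rule exp_group_domI[OF U exp_group_l2[OF U l(1)] exp_group_l2[OF U \<eta>]])
qed

text \<open>Product rule. The factor -\<i> arises because the first slot turns \<i> H into -\<i>,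
  while the second keeps \<i> K.\<close>

lemma exp_group_inner_deriv_0:
  assumes U: "exp_group U DH H" and V: "exp_group V DK K"
    and linH: "linear_op_on DH H" and linK: "linear_op_on DK K"
    and \<eta>: "\<eta> \<in> DH" and \<xi>: "\<xi> \<in> DK"
  shows "((\<lambda>s. (l2inner (U s \<eta>) (V s \<xi>) - l2inner \<eta> \<xi>) / complex_of_real s) \<longlongrightarrow>
     - \<i> * (l2inner (H \<eta>) \<xi> - l2inner \<eta> (K \<xi>))) (at 0)"
proof -
  note lH = linear_op_on_l2[OF linH \<eta>] and lK = linear_op_on_l2[OF linK \<xi>]
  define A where "A s = (\<lambda>x. (U s \<eta> x - \<eta> x) / complex_of_real s)" for s
  define B where "B s = (\<lambda>x. (V s \<xi> x - \<xi> x) / complex_of_real s)" for s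
  let ?h = "\<lambda>x. \<i> * H \<eta> x" and ?k = "\<lambda>x. \<i> * K \<xi> x"
  have h: "?h \<in> l2" and k: "?k \<in> l2" by (rule l2_scale lH lK)+
  have Us: "U s \<eta> \<in> l2" and Vs: "V s \<xi> \<in> l2" for s
    by (rule exp_group_l2[OF U lH(1)], rule exp_group_l2[OF V lK(1)])
  have A: "A s \<in> l2" and B: "B s \<in> l2" for s
    unfolding A_def B_def by (rule l2_divide l2_diff Us Vs lH lK)+
  have At: "((\<lambda>s. l2norm (\<lambda>x. A s x - ?h x)) \<longlongrightarrow> 0) (at 0)"
    unfolding A_def by (rule exp_group_gen[OF U \<eta>])
  have Bt: "((\<lambda>s. l2norm (\<lambda>x. B s x - ?k x)) \<longlongrightarrow> 0) (at 0)"
    unfolding B_def by (rule exp_group_gen[OF V \<xi>])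
  have Vt: "((\<lambda>s. l2norm (\<lambda>x. V s \<xi> x - \<xi> x)) \<longlongrightarrow> 0) (at 0)"
    using exp_group_cont[OF V lK(1), of 0] unfolding exp_group_0[OF V lK(1)] .
  let ?L = "l2inner ?h \<xi> + l2inner \<eta> ?k"
  have quot: "(l2inner (U s \<eta>) (V s \<xi>) - l2inner \<eta> \<xi>) / complex_of_real s = l2inner (A s) (V s \<xi>) + l2inner \<eta> (B s)" for s
  proof -
    have 1: "l2inner (A s) (V s \<xi>) = inverse (complex_of_real s) * (l2inner (U s \<eta>) (V s \<xi>) - l2inner \<eta> (V s \<xi>))"
    proof -
      have "A s = (\<lambda>x. inverse (complex_of_real s) * (U s \<eta> x - \<eta> x))"
        unfolding A_def by (simp add: divide_inverse mult.commute)
      then have "l2inner (A s) (V s \<xi>) = cnj (inverse (complex_of_real s)) * l2inner (\<lambda>x. U s \<eta> x - \<eta> x) (V s \<xi>)"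
        by (simp only: l2inner_scale_left)
      then show ?thesis unfolding l2inner_diff_left[OF Us lH(1) Vs] by simp
    qed
    have 2: "l2inner \<eta> (B s) = inverse (complex_of_real s) * (l2inner \<eta> (V s \<xi>) - l2inner \<eta> \<xi>)"
    proof -
      have "B s = (\<lambda>x. inverse (complex_of_real s) * (V s \<xi> x - \<xi> x))"
        unfolding B_def by (simp add: divide_inverse mult.commute)
      then have "l2inner \<eta> (B s) = inverse (complex_of_real s) * l2inner \<eta> (\<lambda>x. V s \<xi> x - \<xi> x)"
        by (simp only: l2inner_scale_right)
      then show ?thesis unfolding l2inner_diff_right[OF lH(1) Vs lK(1)] .
    qed
    show ?thesis unfolding 1 2 by (simp add: divide_inverse algebra_simps)
  qed
  have bnd: "norm (l2inner (A s) (V s \<xi>) + l2inner \<eta> (B s) - ?L) \<le>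
      l2norm (\<lambda>x. A s x - ?h x) * l2norm \<xi> + l2norm ?h * l2norm (\<lambda>x. V s \<xi> x - \<xi> x)
      + l2norm \<eta> * l2norm (\<lambda>x. B s x - ?k x)" for s
  proof -
    have e: "l2inner (A s) (V s \<xi>) + l2inner \<eta> (B s) - ?L =
        l2inner (\<lambda>x. A s x - ?h x) (V s \<xi>) + l2inner ?h (\<lambda>x. V s \<xi> x - \<xi> x) + l2inner \<eta> (\<lambda>x. B s x - ?k x)"
      unfolding l2inner_diff_left[OF A h Vs] l2inner_diff_right[OF h Vs lK(1)] l2inner_diff_right[OF lH(1) B k] by simp
    have "norm (l2inner (A s) (V s \<xi>) + l2inner \<eta> (B s) - ?L) \<le> cmod (l2inner (\<lambda>x. A s x - ?h x) (V s \<xi>)) + cmod (l2inner ?h (\<lambda>x. V s \<xi> x - \<xi> x))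
        + cmod (l2inner \<eta> (\<lambda>x. B s x - ?k x))"
      unfolding e by (rule order_trans[OF norm_triangle_ineq add_right_mono[OF norm_triangle_ineq]])
    also have "\<dots> \<le> l2norm (\<lambda>x. A s x - ?h x) * l2norm (V s \<xi>) + l2norm ?h * l2norm (\<lambda>x. V s \<xi> x - \<xi> x)
        + l2norm \<eta> * l2norm (\<lambda>x. B s x - ?k x)"
      by (rule add_mono[OF add_mono])
         (rule l2inner_cauchy_schwarz[OF l2_diff[OF A h] Vs] l2inner_cauchy_schwarz[OF h l2_diff[OF Vs lK(1)]]
          l2inner_cauchy_schwarz[OF lH(1) l2_diff[OF B k]])+
    finally show ?thesis unfolding exp_group_norm[OF V lK(1)] .
  qed
  have "((\<lambda>s. l2norm (\<lambda>x. A s x - ?h x) * l2norm \<xi> + l2norm ?h * l2norm (\<lambda>x. V s \<xi> x - \<xi> x)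
      + l2norm \<eta> * l2norm (\<lambda>x. B s x - ?k x)) \<longlongrightarrow> 0 * l2norm \<xi> + l2norm ?h * 0 + l2norm \<eta> * 0) (at 0)"
    by (intro tendsto_add tendsto_mult At Bt Vt tendsto_const)
  then have "((\<lambda>s. l2norm (\<lambda>x. A s x - ?h x) * l2norm \<xi> + l2norm ?h * l2norm (\<lambda>x. V s \<xi> x - \<xi> x)
      + l2norm \<eta> * l2norm (\<lambda>x. B s x - ?k x)) \<longlongrightarrow> 0) (at 0)" by simp
  then have "((\<lambda>s. l2inner (A s) (V s \<xi>) + l2inner \<eta> (B s) - ?L) \<longlongrightarrow> 0) (at 0)"
    by (rule Lim_null_comparison[rotated]) (rule always_eventually, rule allI, rule bnd)
  then have "((\<lambda>s. l2inner (A s) (V s \<xi>) + l2inner \<eta> (B s)) \<longlongrightarrow> ?L) (at 0)"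
    by (rule LIM_zero_cancel)
  moreover have "?L = - \<i> * (l2inner (H \<eta>) \<xi> - l2inner \<eta> (K \<xi>))"
    unfolding l2inner_scale_left l2inner_scale_right by (simp add: algebra_simps)
  ultimately show ?thesis unfolding quot by simp
qed

text \<open>By the group law the derivative at time \<open>s\<close> is the derivative at 0 for
  \<open>U s \<eta>\<close> and \<open>V s \<xi>\<close>. These stay in the domains with unchanged
  norms, so one constant bounds the derivative at all times.\<close>

lemma exp_group_inner_lipschitz:
  assumes U: "exp_group U DH H" and V: "exp_group V DK K"
    and linH: "linear_op_on DH H" and linK: "linear_op_on DK K"
    and C: "C \<ge> 0" and b: "\<And>\<eta> \<xi>. \<eta> \<in> DH \<Longrightarrow> \<xi> \<in> DK \<Longrightarrow>
      cmod (l2inner (H \<eta>) \<xi> - l2inner \<eta> (K \<xi>)) \<le> C * (l2norm \<eta> * l2norm \<xi>)"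
    and \<eta>: "\<eta> \<in> DH" and \<xi>: "\<xi> \<in> DK"
  shows "cmod (l2inner (U t \<eta>) (V t \<xi>) - l2inner \<eta> \<xi>) \<le> C * \<bar>t\<bar> * (l2norm \<eta> * l2norm \<xi>)"
proof -
  note lH = linear_op_on_l2[OF linH \<eta>] and lK = linear_op_on_l2[OF linK \<xi>]
  define \<phi> where "\<phi> s = l2inner (U s \<eta>) (V s \<xi>)" for s
  define \<phi>' where "\<phi>' s = - \<i> * (l2inner (H (U s \<eta>)) (V s \<xi>) - l2inner (U s \<eta>) (K (V s \<xi>)))" for s
  let ?M = "C * (l2norm \<eta> * l2norm \<xi>)"
  have dom: "U s \<eta> \<in> DH" "V s \<xi> \<in> DK" for s
    by (rule exp_group_invariant[OF U linH \<eta>], rule exp_group_invariant[OF V linK \<xi>])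
  have \<phi>'b: "cmod (\<phi>' s) \<le> ?M" for s
    using b[OF dom[of s]] unfolding \<phi>'_def norm_mult exp_group_norm[OF U lH(1)] exp_group_norm[OF V lK(1)] by simp
  have \<phi>d: "((\<lambda>h. (\<phi> (s + h) - \<phi> s) / complex_of_real h) \<longlongrightarrow> \<phi>' s) (at 0)" for s
  proof -
    have "\<phi> (s + h) = l2inner (U h (U s \<eta>)) (V h (V s \<xi>))" for h
      unfolding \<phi>_def using exp_group_add[OF U lH(1), of h s] exp_group_add[OF V lK(1), of h s]
      by (simp add: add.commute)
    then show ?thesis
      using exp_group_inner_deriv_0[OF U V linH linK dom[of s]] unfolding \<phi>'_def by (simp add: \<phi>_def)
  qed
  \<comment> \<open>The mean value theorem needs a real function. Projecting \<phi> onto the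
    direction of its own increment loses nothing: \<open>g\<close> increases by |w|^2, while its
    derivative is at most |w| times the bound for \<phi>'.\<close>
  define w where "w = \<phi> t - \<phi> 0"
  define g where "g s = Re (cnj w * \<phi> s)" for s
  have gd: "DERIV g s :> Re (cnj w * \<phi>' s)" for s
    unfolding DERIV_def
  proof -
    have lim: "((\<lambda>h. Re (cnj w * ((\<phi> (s + h) - \<phi> s) / complex_of_real h))) \<longlongrightarrow> Re (cnj w * \<phi>' s)) (at 0)"
      by (intro tendsto_Re tendsto_mult tendsto_const \<phi>d)
    have e: "Re (cnj w * ((\<phi> (s + h) - \<phi> s) / complex_of_real h)) = (g (s + h) - g s) / h" for h
      unfolding g_def times_divide_eq_right Re_divide_of_real right_diff_distrib minus_complex.simps by (rule refl)
    show "((\<lambda>h. (g (s + h) - g s) / h) \<longlongrightarrow> Re (cnj w * \<phi>' s)) (at 0)" using lim unfolding e .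
  qed
  have gb: "\<bar>Re (cnj w * \<phi>' s)\<bar> \<le> cmod w * ?M" for s
    by (rule order_trans[OF abs_Re_le_cmod]) (simp add: norm_mult mult_left_mono \<phi>'b)
  have "\<bar>g t - g 0\<bar> \<le> \<bar>t\<bar> * (cmod w * ?M)"
  proof -
    consider "t = 0" | "t > 0" | "t < 0" by linarith
    then show ?thesis
    proof cases
      case 2
      obtain z where "g t - g 0 = (t - 0) * Re (cnj w * \<phi>' z)"
        using MVT2[OF 2, of g "\<lambda>s. Re (cnj w * \<phi>' s)"] gd by blast
      then show ?thesis using mult_left_mono[OF gb[of z], of "\<bar>t\<bar>"] by (simp add: abs_mult)
    next
      case 3
      obtain z where "g 0 - g t = (0 - t) * Re (cnj w * \<phi>' z)"
        using MVT2[OF 3, of g "\<lambda>s. Re (cnj w * \<phi>' s)"] gd by blast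
      then have "\<bar>g 0 - g t\<bar> = \<bar>t\<bar> * \<bar>Re (cnj w * \<phi>' z)\<bar>" by (simp add: abs_mult)
      then show ?thesis using mult_left_mono[OF gb[of z], of "\<bar>t\<bar>"] by (simp add: abs_minus_commute)
    qed simp
  qed
  moreover have "g t - g 0 = (cmod w)\<^sup>2"
  proof -
    have "g t - g 0 = Re (cnj w * w)" unfolding g_def w_def by (simp add: algebra_simps)
    also have "cnj w * w = complex_of_real ((cmod w)\<^sup>2)"
      by (subst complex_norm_square, rule mult.commute)
    finally show ?thesis by simp
  qed
  ultimately have sq: "cmod w * cmod w \<le> cmod w * (\<bar>t\<bar> * ?M)"
    by (simp add: power2_eq_square mult_ac)
  have "cmod w \<le> \<bar>t\<bar> * ?M"
  proof (cases "w = 0")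
    case True
    then show ?thesis using C by simp
  next
    case False
    then show ?thesis by (intro iffD1[OF mult_le_cancel_left_pos sq]) simp
  qed
  moreover have "\<phi> 0 = l2inner \<eta> \<xi>"
    unfolding \<phi>_def exp_group_0[OF U lH(1)] exp_group_0[OF V lK(1)] by (rule refl)
  ultimately show ?thesis unfolding w_def by (simp add: \<phi>_def mult_ac)
qed

lemma op_bound_dense:
  assumes T: "bounded_op T" and D: "D \<subseteq> l2"
    and dense: "\<And>\<zeta> \<epsilon>. \<zeta> \<in> l2 \<Longrightarrow> \<epsilon> > 0 \<Longrightarrow> \<exists>\<eta>\<in>D. l2norm (\<lambda>x. \<zeta> x - \<eta> x) < \<epsilon>"
    and b: "\<And>\<eta>. \<eta> \<in> D \<Longrightarrow> l2norm (T \<eta>) \<le> C * l2norm \<eta>" and C: "C \<ge> 0" and \<xi>: "\<xi> \<in> l2"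
  shows "l2norm (T \<xi>) \<le> C * l2norm \<xi>"
proof (rule field_le_epsilon)
  fix \<epsilon> :: real assume e: "\<epsilon> > 0"
  obtain E where E: "E \<ge> 0" "\<And>\<xi>. \<xi> \<in> l2 \<Longrightarrow> l2norm (T \<xi>) \<le> E * l2norm \<xi>"
    by (rule bounded_op_boundE[OF T]) blast
  have p: "E + C + 1 > 0" using E(1) C by linarith
  have "\<epsilon> / (E + C + 1) > 0" using e p by simp
  from dense[OF \<xi> this] obtain \<eta> where \<eta>: "\<eta> \<in> D" "l2norm (\<lambda>x. \<xi> x - \<eta> x) < \<epsilon> / (E + C + 1)" by blast
  define d where "d = l2norm (\<lambda>x. \<xi> x - \<eta> x)"
  have d: "0 \<le> d" "d * (E + C + 1) \<le> \<epsilon>" using \<eta>(2) p by (auto simp: d_def pos_less_divide_eq less_imp_le)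
  have \<eta>2: "\<eta> \<in> l2" using \<eta>(1) D by (rule subsetD[rotated])
  have "l2norm (T \<xi>) \<le> l2norm (\<lambda>x. T \<xi> x - T \<eta> x) + l2norm (T \<eta>)"
    by (rule l2norm_triangle_sub[OF bounded_op_l2[OF T \<xi>] bounded_op_l2[OF T \<eta>2]])
  also have "\<dots> = l2norm (T (\<lambda>x. \<xi> x - \<eta> x)) + l2norm (T \<eta>)"
    unfolding bounded_op_diff[OF T \<xi> \<eta>2] by (rule refl)
  also have "\<dots> \<le> E * d + C * l2norm \<eta>"
    unfolding d_def by (rule add_mono[OF E(2)[OF l2_diff[OF \<xi> \<eta>2]] b[OF \<eta>(1)]])
  also have "\<dots> \<le> E * d + C * (d + l2norm \<xi>)"
    using l2norm_triangle_sub[OF \<eta>2 \<xi>] C unfolding d_def l2norm_minus_commute[of \<xi> \<eta>]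
    by (intro add_left_mono mult_left_mono)
  also have "\<dots> \<le> C * l2norm \<xi> + \<epsilon>" using d by (simp add: algebra_simps)
  finally show "l2norm (T \<xi>) \<le> C * l2norm \<xi> + \<epsilon>" .
qed

text \<open>The Lipschitz estimate is available only for \<open>\<eta>\<close> in \<open>DH\<close>
  and \<open>\<zeta>\<close> in \<open>DK\<close>, so density is used in each slot in turn. Moving
  \<open>U t\<close> to the left slot turns <\<eta>, (u - 1) \<zeta>>, with u =
  \<open>U t \<circ> V (- t)\<close>, into the increment estimated there, at time -t.\<close>

lemma exp_group_comparison:
  assumes saH: "self_adjoint_op DH H" and coH: "coarse_op DH H"
    and saK: "self_adjoint_op DK K" and coK: "coarse_op DK K"
    and U: "exp_group U DH H" and V: "exp_group V DK K"
    and HK: "\<exists>C. \<forall>\<xi>\<in>c00. l2norm (\<lambda>x. H \<xi> x - K \<xi> x) \<le> C * l2norm \<xi>"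
  obtains C where "C \<ge> 0"
    "\<And>t \<xi>. \<xi> \<in> l2 \<Longrightarrow> l2norm (\<lambda>x. U t (V (- t) \<xi>) x - \<xi> x) \<le> C * \<bar>t\<bar> * l2norm \<xi>"
proof -
  note linH = self_adjoint_linear[OF saH] and linK = self_adjoint_linear[OF saK]
  obtain C where C: "C \<ge> 0" "\<And>\<eta> \<xi>. \<eta> \<in> DH \<Longrightarrow> \<xi> \<in> DK \<Longrightarrow>
    cmod (l2inner (H \<eta>) \<xi> - l2inner \<eta> (K \<xi>)) \<le> C * (l2norm \<eta> * l2norm \<xi>)"
    by (rule coarse_difference_form_bound[OF saH coH saK coK HK]) blast
  show ?thesis
  proof (rule that[OF C(1)])
    fix t and \<xi> :: "'a vec" assume \<xi>: "\<xi> \<in> l2"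
    have Ct: "C * \<bar>t\<bar> \<ge> 0" using C(1) by simp
    have "bounded_op (\<lambda>\<xi> x. (U t \<circ> V (- t)) \<xi> x - (\<lambda>\<xi>. \<xi>) \<xi> x)"
    proof (rule bounded_op_sub[OF bounded_op_comp[OF exp_group_bounded[OF U] exp_group_bounded[OF V]]])
      show "bounded_op (\<lambda>\<xi>. \<xi>)" by (rule bounded_opI[where C = 1]) simp_all
    qed
    then have T: "bounded_op (\<lambda>\<xi> x. U t (V (- t) \<xi>) x - \<xi> x)" by (simp add: o_def)
    show "l2norm (\<lambda>x. U t (V (- t) \<xi>) x - \<xi> x) \<le> C * \<bar>t\<bar> * l2norm \<xi>"
    proof (rule op_bound_dense[OF T linear_op_on_sub[OF linK] self_adjoint_dense[OF saK] _ Ct \<xi>])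
      fix \<zeta> assume \<zeta>: "\<zeta> \<in> DK"
      have \<zeta>2: "\<zeta> \<in> l2" by (rule linear_op_on_l2(1)[OF linK \<zeta>])
      have uz: "U t (V (- t) \<zeta>) \<in> l2" by (rule exp_group_l2[OF U exp_group_l2[OF V \<zeta>2]])
      show "l2norm (\<lambda>x. U t (V (- t) \<zeta>) x - \<zeta> x) \<le> C * \<bar>t\<bar> * l2norm \<zeta>"
      proof (rule l2norm_le_by_inner[OF l2_diff[OF uz \<zeta>2] linear_op_on_sub[OF linH] self_adjoint_dense[OF saH]])
        fix \<eta> assume \<eta>: "\<eta> \<in> DH"
        have \<eta>2: "\<eta> \<in> l2" by (rule linear_op_on_l2(1)[OF linH \<eta>])
        have "l2inner \<eta> (\<lambda>x. U t (V (- t) \<zeta>) x - \<zeta> x) = l2inner (U (- t) \<eta>) (V (- t) \<zeta>) - l2inner \<eta> \<zeta>"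
          unfolding l2inner_diff_right[OF \<eta>2 uz \<zeta>2] exp_group_adj[OF U \<eta>2 exp_group_l2[OF V \<zeta>2]] by simp
        then show "cmod (l2inner \<eta> (\<lambda>x. U t (V (- t) \<zeta>) x - \<zeta> x)) \<le> C * \<bar>t\<bar> * l2norm \<zeta> * l2norm \<eta>"
          using exp_group_inner_lipschitz[OF U V linH linK C \<eta> \<zeta>, of "- t"] by (simp add: mult_ac)
      qed (use Ct in simp_all)
    qed
  qed
qed

subsection \<open>The cocycle\<close>

text \<open>\<open>adj\<close> is a Hilbert choice, determined by the adjoint relation only on
  \<open>l2\<close>; there the coordinates, tested by \<open>delta x\<close>, fix it.\<close>

lemma adj_eq:
  assumes S: "is_adjoint T S" and \<xi>: "\<xi> \<in> l2"
  shows "adj T \<xi> = S \<xi>"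
proof
  fix x
  have a: "is_adjoint T (adj T)" unfolding adj_def by (rule someI[of "is_adjoint T", OF S])
  have "l2inner (delta x) (adj T \<xi>) = l2inner (T (delta x)) \<xi>"
    using a \<xi> delta_l2 unfolding is_adjoint_def by metis
  also have "\<dots> = l2inner (delta x) (S \<xi>)"
    using S \<xi> delta_l2 unfolding is_adjoint_def by metis
  finally show "adj T \<xi> x = S \<xi> x" by simp
qed

text \<open>Operators are total functions on all complex families, but identities such as the
  cocycle law hold only on \<open>l2\<close>. Membership depends on these values alone.\<close>

lemma uniform_roe_cong:
  assumes T: "T \<in> uniform_roe" and e: "\<And>\<xi>. \<xi> \<in> l2 \<Longrightarrow> S \<xi> = T \<xi>"
  shows "S \<in> uniform_roe"
proof (rule uniform_roeI)
  note bT = uniform_roe_bounded[OF T]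
  obtain C where C: "C \<ge> 0" "\<And>\<xi>. \<xi> \<in> l2 \<Longrightarrow> l2norm (T \<xi>) \<le> C * l2norm \<xi>"
    by (rule bounded_op_boundE[OF bT]) blast
  show "bounded_op S"
    by (rule bounded_opI[where C = C]) (simp_all add: e C bounded_op_l2[OF bT] l2_lin bounded_op_lin[OF bT])
  fix \<epsilon> :: real assume "\<epsilon> > 0"
  then obtain R where "R \<in> roe_star_alg" "\<And>\<xi>. \<xi> \<in> l2 \<Longrightarrow> l2norm (\<lambda>x. T \<xi> x - R \<xi> x) \<le> \<epsilon> * l2norm \<xi>"
    by (rule uniform_roe_approx[OF T]) blast
  then show "\<exists>R\<in>roe_star_alg. \<forall>\<xi>\<in>l2. l2norm (\<lambda>x. S \<xi> x - R \<xi> x) \<le> \<epsilon> * l2norm \<xi>"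
    by (intro bexI[of _ R]) (simp_all add: e)
qed

lemma opnorm_nonneg:
  assumes "bounded_op (T :: 'a op)"
  shows "0 \<le> opnorm T"
  using order_trans[OF l2norm_nonneg opnorm_bound[OF assms delta_l2]] by simp

text \<open>The cocycle law and the perturbation formula are cancellations in the two groups. The
  estimate \<open>small\<close> enters twice: it bounds the diagonal entries of \<open>u t\<close>
  for small \<open>t\<close>, and it gives norm continuity.\<close>

lemma flow_cocycle:
  fixes U V :: "real \<Rightarrow> ('a::metric_space) op"
  assumes ulf: "uniformly_locally_finite TYPE('a)" and A: "property_A TYPE('a)"
    and U: "exp_group U DH H" and V: "exp_group V DK K"
    and fU: "induces_flow U" and fV: "induces_flow V"
    and C: "C \<ge> 0" and small: "\<And>t \<xi>. \<xi> \<in> l2 \<Longrightarrow> l2norm (\<lambda>x. U t (V (- t) \<xi>) x - \<xi> x) \<le> C * \<bar>t\<bar> * l2norm \<xi>"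
  shows "cocycle_perturbation (conj_flow U) (conj_flow V)"
proof -
  define u where "u t = U t \<circ> V (- t)" for t
  define u' where "u' t = V t \<circ> U (- t)" for t
  note lU = exp_group_l2[OF U] and lV = exp_group_l2[OF V]
  note bU = exp_group_bounded[OF U] and bV = exp_group_bounded[OF V]
  have bu: "bounded_op (u t)" and bu': "bounded_op (u' t)" for t
    unfolding u_def u'_def by (rule bounded_op_comp[OF bU bV], rule bounded_op_comp[OF bV bU])
  have ad: "l2inner (u t \<xi>) \<eta> = l2inner \<xi> (u' t \<eta>)" if "\<xi> \<in> l2" "\<eta> \<in> l2" for t \<xi> \<eta>
    unfolding u_def u'_def o_apply exp_group_adj[OF U lV[OF that(1)] that(2)]
      exp_group_adj[OF V that(1) lU[OF that(2)]] by simp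
  have isad: "is_adjoint (u t) (u' t)" for t
    unfolding is_adjoint_def using ad bounded_op_l2[OF bu'] by blast
  have adj: "adj (u t) \<xi> = V t (U (- t) \<xi>)" if "\<xi> \<in> l2" for t \<xi>
    using adj_eq[OF isad that] by (simp add: u'_def)
  have conjU: "conj_flow U t a \<in> uniform_roe" and conjV: "conj_flow V t a \<in> uniform_roe"
    if "a \<in> uniform_roe" for t a
    using fU fV that unfolding induces_flow_def by blast+
  have conj: "u t \<circ> vop B id \<circ> u' t \<in> uniform_roe" for t B
  proof -
    \<comment> \<open>Conjugation by \<open>u t\<close> is the \<open>V\<close>-flow at time -t
      followed by the \<open>U\<close>-flow at time t, and both preserve the algebra.\<close>
    have "u t \<circ> vop B id \<circ> u' t = conj_flow U t (conj_flow V (- t) (vop B id))"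
      by (rule ext) (simp add: conj_flow_def u_def u'_def)
    then show ?thesis using conjU[OF conjV[OF vop_uniform_roe]] by simp
  qed
  have usmall: "u t \<in> uniform_roe" if t: "C * \<bar>t\<bar> \<le> 1 / 2" for t
  proof (rule normalizer_in_uniform_roe[OF ulf A bu bu' ad conj])
    fix x :: 'a
    have "(\<lambda>y. u t (delta x) y - delta x y) \<in> l2"
      by (rule l2_diff[OF bounded_op_l2[OF bu delta_l2] delta_l2])
    from cmod_le_l2norm[OF this, of x] have "cmod (u t (delta x) x - 1) \<le> l2norm (\<lambda>y. u t (delta x) y - delta x y)"
      by (simp add: delta_def)
    also have "\<dots> \<le> C * \<bar>t\<bar> * 1"
      using small[OF delta_l2, of t x] by (simp add: u_def)
    finally show "cmod (u t (delta x) x - 1) \<le> 1 / 2" using t by linarith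
  qed
  have coc: "u (t + s) \<xi> = (u t \<circ> conj_flow V t (u s)) \<xi>" if \<xi>: "\<xi> \<in> l2" for t s \<xi>
  proof -
    have "- (t + s) = - s + - t" by simp
    then have "V (- (t + s)) \<xi> = V (- s) (V (- t) \<xi>)"
      using exp_group_add[OF V \<xi>, of "- s" "- t"] by (simp only:)
    then show ?thesis
      unfolding u_def conj_flow_def o_apply
      using exp_group_add[OF U lV[OF lV[OF \<xi>]], of t s "- s" "- t"]
        exp_group_cancel(2)[OF V lU[OF lV[OF lV[OF \<xi>]]], of t s "- s" "- t"] by simp
  qed
  have uroe: "u t \<in> uniform_roe" for t
  proof -
    \<comment> \<open>Chosen so that steps of length t / (n + 1) are short enough for
      \<open>usmall\<close>; the successor avoids division by 0.\<close>
    obtain n :: nat where n: "2 * (C * \<bar>t\<bar>) \<le> real n" using real_arch_simple by blast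
    define r where "r = t / real (Suc n)"
    have "C * \<bar>r\<bar> = C * \<bar>t\<bar> / real (Suc n)" by (simp add: r_def)
    also have "\<dots> \<le> 1 / 2" using n by (simp add: divide_simps)
    finally have r: "u r \<in> uniform_roe" by (rule usmall)
    have "u (real m * r) \<in> uniform_roe" for m
    proof (induction m)
      case 0
      show ?case by (rule usmall) simp
    next
      case (Suc m)
      have "u (real (Suc m) * r) = u (real m * r + r)" by (simp add: algebra_simps)
      \<comment> \<open>The cocycle law writes the next operator, on \<open>l2\<close>, as a product
        of \<open>u (real m * r)\<close> with a flow image of \<open>u r\<close>, both in the
        algebra.\<close>
      then show ?case
        using uniform_roe_cong[OF uniform_roe_comp[OF Suc.IH conjV[OF r, of "real m * r"]] coc] by simp
    qed
    from this[of "Suc n"] show ?thesis by (simp add: r_def)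
  qed
  have cont: "opnorm (\<lambda>\<xi> x. u t \<xi> x - u s \<xi> x) \<le> C * \<bar>t - s\<bar>" for t s
  proof (rule opnorm_leI)
    fix \<xi> :: "'a vec" assume \<xi>: "\<xi> \<in> l2"
    have \<zeta>: "V (- s) \<xi> \<in> l2" by (rule lV[OF \<xi>])
    \<comment> \<open>The aim is \<open>u t - u s = U s (u (t - s) - 1) V (- s)\<close> on
      \<open>l2\<close>; the outer factors are isometric, so \<open>small\<close> applies at time t
      - s.\<close>
    have vt: "V (- t) \<xi> = V (- (t - s)) (V (- s) \<xi>)"
      using exp_group_add[OF V \<xi>, of "- (t - s)" "- s"] by simp
    have ut: "u t \<xi> = U s (U (t - s) (V (- (t - s)) (V (- s) \<xi>)))"
      unfolding u_def o_apply vt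
      using exp_group_add[OF U lV[OF \<zeta>], of s "t - s" "- (t - s)"] by simp
    have us: "u s \<xi> = U s (V (- s) \<xi>)" by (simp add: u_def)
    have w: "U (t - s) (V (- (t - s)) (V (- s) \<xi>)) \<in> l2" by (rule lU[OF lV[OF \<zeta>]])
    have "l2norm (\<lambda>x. u t \<xi> x - u s \<xi> x) = l2norm (\<lambda>x. U (t - s) (V (- (t - s)) (V (- s) \<xi>)) x - V (- s) \<xi> x)"
      unfolding ut us bounded_op_diff[OF bU w \<zeta>, symmetric] by (rule exp_group_norm[OF U l2_diff[OF w \<zeta>]])
    also have "\<dots> \<le> C * \<bar>t - s\<bar> * l2norm \<xi>"
      using small[OF \<zeta>, of "t - s"] unfolding exp_group_norm[OF V \<xi>] .
    finally show "l2norm (\<lambda>x. u t \<xi> x - u s \<xi> x) \<le> C * \<bar>t - s\<bar> * l2norm \<xi>" .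
  qed (use C in simp)
  have tend: "((\<lambda>t. opnorm (\<lambda>\<xi> x. u t \<xi> x - u s \<xi> x)) \<longlongrightarrow> 0) (at s)" for s
  proof (rule tendsto_sandwich[OF always_eventually always_eventually tendsto_const])
    show "\<forall>t. 0 \<le> opnorm (\<lambda>\<xi> x. u t \<xi> x - u s \<xi> x)"
      by (rule allI, rule opnorm_nonneg[OF bounded_op_sub[OF bu bu]])
    show "\<forall>t. opnorm (\<lambda>\<xi> x. u t \<xi> x - u s \<xi> x) \<le> C * \<bar>t - s\<bar>" by (rule allI, rule cont)
    have "((\<lambda>t. C * \<bar>t - s\<bar>) \<longlongrightarrow> C * \<bar>s - s\<bar>) (at s)" by (intro tendsto_intros)
    then show "((\<lambda>t. C * \<bar>t - s\<bar>) \<longlongrightarrow> 0) (at s)" by simp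
  qed
  have uni: "unitary_op (u t)" for t
  proof -
    have 1: "adj (u t) (u t \<xi>) = \<xi>" and 2: "u t (adj (u t) \<xi>) = \<xi>" if \<xi>: "\<xi> \<in> l2" for \<xi>
      unfolding adj[OF bounded_op_l2[OF bu \<xi>]] adj[OF \<xi>]
      by (simp_all add: u_def exp_group_cancel[OF U] exp_group_cancel[OF V] lU lV \<xi>)
    show ?thesis
      unfolding unitary_op_def eq_on_l2_def using bu isad 1 2 by auto
  qed
  have "is_cocycle (conj_flow V) u"
    unfolding is_cocycle_def eq_on_l2_def using uroe uni tend coc by blast
  moreover have "eq_on_l2 (conj_flow U t a) (u t \<circ> conj_flow V t a \<circ> adj (u t))" if a: "a \<in> uniform_roe" for t a
    unfolding eq_on_l2_def
  proof
    fix \<xi> :: "'a vec" assume \<xi>: "\<xi> \<in> l2"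
    have aU: "a (U (- t) \<xi>) \<in> l2" by (rule bounded_op_l2[OF uniform_roe_bounded[OF a] lU[OF \<xi>]])
    show "conj_flow U t a \<xi> = (u t \<circ> conj_flow V t a \<circ> adj (u t)) \<xi>"
      unfolding o_apply adj[OF \<xi>] conj_flow_def exp_group_cancel(2)[OF V lU[OF \<xi>]]
      by (simp add: u_def exp_group_cancel(2)[OF V aU])
  qed
  ultimately show ?thesis unfolding cocycle_perturbation_def by blast
qed

theorem theorem1p4p5:
  fixes DH DK :: "('a::metric_space) vec set"
    and H K :: "'a op"
    and U V :: "real \<Rightarrow> 'a op"
  assumes "uniformly_locally_finite TYPE('a)"
    and "property_A TYPE('a)"
    and "self_adjoint_op DH H" and "coarse_op DH H"
    and "self_adjoint_op DK K" and "coarse_op DK K"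
    and "exp_group U DH H" and "exp_group V DK K"
    and "induces_flow U" and "induces_flow V"
    and "\<exists>C. \<forall>\<xi>\<in>c00. l2norm (\<lambda>x. H \<xi> x - K \<xi> x) \<le> C * l2norm \<xi>"
  shows "cocycle_perturbation (conj_flow U) (conj_flow V) \<and>
         cocycle_perturbation (conj_flow V) (conj_flow U)"
proof
  obtain C where C: "C \<ge> 0"
    "\<And>t \<xi>. \<xi> \<in> l2 \<Longrightarrow> l2norm (\<lambda>x. U t (V (- t) \<xi>) x - \<xi> x) \<le> C * \<bar>t\<bar> * l2norm \<xi>"
    by (rule exp_group_comparison[OF assms(3-8) assms(11)]) blast
  show "cocycle_perturbation (conj_flow U) (conj_flow V)"
    by (rule flow_cocycle[OF assms(1,2,7,8,9,10) C])
next
  \<comment> \<open>Norms do not see the sign of the difference, so the operators may exchange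
    roles; this yields the cocycle for the other flow.\<close>
  have "\<exists>C. \<forall>\<xi>\<in>c00. l2norm (\<lambda>x. K \<xi> x - H \<xi> x) \<le> C * l2norm \<xi>"
    using assms(11) by (subst l2norm_minus_commute)
  then obtain C where C: "C \<ge> 0"
    "\<And>t \<xi>. \<xi> \<in> l2 \<Longrightarrow> l2norm (\<lambda>x. V t (U (- t) \<xi>) x - \<xi> x) \<le> C * \<bar>t\<bar> * l2norm \<xi>"
    by (rule exp_group_comparison[OF assms(5,6,3,4) assms(8,7)]) blast
  show "cocycle_perturbation (conj_flow V) (conj_flow U)"
    by (rule flow_cocycle[OF assms(1,2,8,7,10,9) C])
qed

end
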